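(* Let $\alpha_1,\rho_1,\rho_2,\mu>0$, let $e_z,m\in\mathbb{R}^3$ be non-collinear unit vectors, and set $W_\rho=-\rho_1S^2(e_z)-\rho_2S^2(m)$, which is a positive-definite symmetric matrix. Consider the time-invariant ODE with state $\xi=(z_{p_1},\tilde Q)$, $\tilde Q=(\tilde q_0,\tilde q)$, on $\Upsilon=\mathbb{R}^3\times\mathbb{S}^3$ given by $$\begin{cases} \dot z_{p_1}=-\alpha_1z_{p_1},\\ \dot{\tilde q}_0=\tilde q^T\left(I+\frac{\mu}{\rho_2}e_ze_z^T\right)\varpi+\frac12\rho_1\tilde q^TS(e_z)\left(I-2\tilde q_0S(\tilde q)+2S^2(\tilde q)\right)z_{p_1},\\ \dot{\tilde q}=-\left(\tilde q_0I+S(\tilde q)\right)\left(I+\frac{\mu}{\rho_2}e_ze_z^T\right)\varpi-\frac12\rho_1\left(\tilde q_0I+S(\tilde q)\right)S(e_z)\left(I-2\tilde q_0S(\tilde q)+2S^2(\tilde q)\right)z_{p_1}, \end{cases}\qquad(\mathrm{E})$$ where $\varpi=\left(\tilde q_0I-S(\tilde q)\right)W_\rho\tilde q$. Let $$V(\xi)=\frac{\rho_1^2}{\alpha_1}\|z_{p_1}\|^2+2\tilde q^TW_\rho\tilde q .$$ Then the following hold. (1) The equilibrium points of $(\mathrm{E})$ are $$\widetilde\Omega_1=\{(0,(\pm1,0))\},\qquad \widetilde\Omega_2=\{(0,(0,\pm v_{j\rho})),\ j=1,2,3\},$$ where $v_{j\rho}$, $1\le j\le 3$, are unit eigenvectors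 of $W_\rho$. (2) All trajectories of $(\mathrm{E})$ converge to one of the equilibrium points defined in item (1). (3) The equilibrium set $\widetilde\Omega_1$ (which corresponds to the equilibrium point $z_{p_1}=0$, $\tilde R=I$) is asymptotically stable, with a domain of attraction containing $$V_c=\{\xi=(z_{p_1},\tilde Q)\in\Upsilon : V(\xi)<2\lambda_{\min}(W_\rho)\}.$$ (4) The equilibria of the set $\widetilde\Omega_2$ are unstable, and the system $(\mathrm{E})$ is almost globally asymptotically stable with respect to $\widetilde\Omega_1$.
   Context: For $v\in\mathbb{R}^3$, $S(v)$ denotes the $3\times 3$ skew-symmetric matrix with $S(v)w=v\times w$ for all $w\in\mathbb{R}^3$, and $S^2(v)=S(v)S(v)$; $I$ is the $3\times3$ identity matrix. $\mathbb{S}^3$ is the set of unit quaternions $\tilde Q=(\tilde q_0,\tilde q)$ with scalar part $\tilde q_0\in\mathbb{R}$ and vector part $\tilde q\in\mathbb{R}^3$, $\tilde q_0^2+\|\tilde q\|^2=1$. The rotation matrix associated with $\tilde Q$ is $\tilde R=I+2\tilde q_0S(\tilde q)+2S^2(\tilde q)$. $\lambda_{\min}(W_\rho)$ is the smallest eigenvalue of $W_\rho$. A dynamical system $\dot x=f(x)$ on a differential manifold $X$ is called almost globally asymptotically stable with respect to an equilibrium point $x_0$ (here: with respect to the set $\widetilde\Omega_1$ of equilibrium points) if it is (Lyapunov) locally stable with respect to $x_0$ (resp. the set) and there exists an open and dense subset $X_1$ of $X$ such that every trajectory starting in $X_1$ converges asymptotically to $x_0$ (resp. to the set).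
   Formalization: The second equilibrium set is taken as (0,(0,v)) for all unit eigenvectors v of W_ρ; it equals the six listed points when the eigenvalues are distinct, while the six-point list is incomplete for a repeated eigenvalue (ρ1 = ρ2, e_z orthogonal to m). *)

theory Defs
  imports "HOL-Analysis.Analysis"
begin

definition skew :: "real^3 \<Rightarrow> real^3^3" where
  "skew v = matrix (cross3 v)"

lemma skew_vector_mult: "skew v *v w = cross3 v w"
proof -
  have "linear (cross3 v)"
    by (intro linearI) (simp_all add: cross_add_right cross_mult_right)
  then show ?thesis by (simp add: skew_def matrix_works)
qed

abbreviation skew2 :: "real^3 \<Rightarrow> real^3^3" where
  "skew2 v \<equiv> skew v ** skew v"

(* v w^T *)
definition outer :: "real^'m \<Rightarrow> real^'n \<Rightarrow> real^'n^'m" where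
  "outer v w = (\<chi> i j. v $ i * w $ j)"

definition eigenvector_of :: "real^'n^'n \<Rightarrow> real \<Rightarrow> real^'n \<Rightarrow> bool" where
  "eigenvector_of A l v \<longleftrightarrow> v \<noteq> 0 \<and> A *v v = l *\<^sub>R v"

definition min_eigenvalue :: "real^'n^'n \<Rightarrow> real" where
  "min_eigenvalue A = (LEAST l. \<exists>v. eigenvector_of A l v)"

definition W_rho :: "real \<Rightarrow> real \<Rightarrow> real^3 \<Rightarrow> real^3 \<Rightarrow> real^3^3" where
  "W_rho \<rho>1 \<rho>2 e m = - (\<rho>1 *\<^sub>R skew2 e) - \<rho>2 *\<^sub>R skew2 m"

lemma transpose_skew: "transpose (skew v) = - skew v"
  by (simp add: skew_def matrix_def transpose_def vec_eq_iff forall_3 cross3_def axis_def)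

lemma W_rho_symmetric: "transpose (W_rho \<rho>1 \<rho>2 e m) = W_rho \<rho>1 \<rho>2 e m"
proof -
  have "transpose (skew2 v) = skew2 v" for v
    unfolding matrix_transpose_mul transpose_skew
    by (simp add: matrix_matrix_mult_def vec_eq_iff)
  then have "transpose (skew2 v) $ i $ j = skew2 v $ i $ j" for v i j
    by simp
  then have "skew2 v $ j $ i = skew2 v $ i $ j" for v i j
    by (simp only: transpose_def vec_lambda_beta)
  then show ?thesis
    unfolding W_rho_def vec_eq_iff transpose_def vec_lambda_beta
      vector_minus_component vector_uminus_component vector_scaleR_component
    by metis
qed

lemma W_rho_quadratic_form:
  "x \<bullet> (W_rho \<rho>1 \<rho>2 e m *v x) = \<rho>1 * (norm (cross3 e x))\<^sup>2 + \<rho>2 * (norm (cross3 m x))\<^sup>2"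
proof -
  have triple: "x \<bullet> cross3 v (cross3 v x) = - (norm (cross3 v x))\<^sup>2" for v :: "real^3"
    unfolding power2_norm_eq_inner by (simp add: cross3_simps)
  have split: "(- (a *\<^sub>R A) - b *\<^sub>R B) *v x = - (a *\<^sub>R (A *v x)) - b *\<^sub>R (B *v x)"
    for a b :: real and A B :: "real^3^3"
    by (simp add: vec_eq_iff matrix_vector_mult_def sum_3 algebra_simps)
  show ?thesis
    unfolding W_rho_def split matrix_vector_mul_assoc[symmetric] skew_vector_mult
    by (simp add: inner_diff_right triple)
qed

lemma W_rho_positive_definite:
  assumes "\<rho>1 > 0" "\<rho>2 > 0" "\<not> collinear {0, e, m}" "x \<noteq> 0"
  shows "x \<bullet> (W_rho \<rho>1 \<rho>2 e m *v x) > 0"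
proof -
  have "cross3 e x \<noteq> 0 \<or> cross3 m x \<noteq> 0"
  proof (rule ccontr)
    assume "\<not> ?thesis"
    then have "collinear {0, e, x}" "collinear {0, m, x}"
      by (simp_all only: cross_eq_0 de_Morgan_disj not_not)
    then have "collinear {e, 0, x}" "collinear {0, x, m}"
      by (simp_all only: insert_commute)
    with assms(4) have "collinear {e, 0, m}"
      using collinear_3_trans by blast
    with assms(3) show False by (simp only: insert_commute)
  qed
  then show ?thesis
  proof
    assume "cross3 e x \<noteq> 0"
    then show ?thesis
      unfolding W_rho_quadratic_form using assms(1,2) by (intro add_pos_nonneg) simp_all
  next
    assume "cross3 m x \<noteq> 0"
    then show ?thesis
      unfolding W_rho_quadratic_form using assms(1,2) by (intro add_nonneg_pos) simp_all
  qed
qed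

(* A state (z, q0, q) consists of z and the quaternion with scalar part q0 and vector part q. *)
type_synonym state = "(real^3) \<times> real \<times> (real^3)"

definition state_manifold :: "state set" where
  "state_manifold = {(z, q0, q). q0\<^sup>2 + (norm q)\<^sup>2 = 1}"

fun quat_rotation :: "real \<times> (real^3) \<Rightarrow> real^3^3" where
  "quat_rotation (q0, q) = mat 1 + (2 * q0) *\<^sub>R skew q + 2 *\<^sub>R skew2 q"

fun varpi :: "real \<Rightarrow> real \<Rightarrow> real^3 \<Rightarrow> real^3 \<Rightarrow> real \<times> (real^3) \<Rightarrow> real^3" where
  "varpi \<rho>1 \<rho>2 e m (q0, q) =
     ((q0 *\<^sub>R mat 1 - skew q) ** W_rho \<rho>1 \<rho>2 e m) *v q"

fun vector_field ::
  "real \<Rightarrow> real \<Rightarrow> real \<Rightarrow> real \<Rightarrow> real^3 \<Rightarrow> real^3 \<Rightarrow> state \<Rightarrow> state" where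
  "vector_field \<alpha>1 \<rho>1 \<rho>2 \<mu> e m (z, q0, q) =
     (let w = varpi \<rho>1 \<rho>2 e m (q0, q);
          A = mat 1 + (\<mu> / \<rho>2) *\<^sub>R outer e e;
          B = mat 1 - (2 * q0) *\<^sub>R skew q + 2 *\<^sub>R skew2 q;
          T = q0 *\<^sub>R mat 1 + skew q
      in (- (\<alpha>1 *\<^sub>R z),
          q \<bullet> (A *v w) + 1/2 * \<rho>1 * (q \<bullet> ((skew e ** B) *v z)),
          - ((T ** A) *v w) - (1/2 * \<rho>1) *\<^sub>R ((T ** skew e ** B) *v z)))"

fun V_fun :: "real \<Rightarrow> real \<Rightarrow> real \<Rightarrow> real^3 \<Rightarrow> real^3 \<Rightarrow> state \<Rightarrow> real" where
  "V_fun \<alpha>1 \<rho>1 \<rho>2 e m (z, q0, q) =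
     \<rho>1\<^sup>2 / \<alpha>1 * (norm z)\<^sup>2 + 2 * (q \<bullet> (W_rho \<rho>1 \<rho>2 e m *v q))"

definition Omega1 :: "state set" where
  "Omega1 = {(0, 1, 0), (0, -1, 0)}"

(* All unit eigenvectors are taken, so that the definition also covers a repeated eigenvalue
   of W_rho (which occurs when rho1 = rho2 and e, m are orthogonal). If the eigenvalues are
   distinct, these are the six points (0, 0, v_j), (0, 0, - v_j), j = 1, 2, 3. *)
definition Omega2 :: "real \<Rightarrow> real \<Rightarrow> real^3 \<Rightarrow> real^3 \<Rightarrow> state set" where
  "Omega2 \<rho>1 \<rho>2 e m =
     {(0, 0, v) | v. norm v = 1 \<and> (\<exists>l. eigenvector_of (W_rho \<rho>1 \<rho>2 e m) l v)}"

(* In the following notions f is a vector field tangent to the set X of the ambient space 'a. *)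

definition equilibria :: "('a::real_normed_vector \<Rightarrow> 'a) \<Rightarrow> 'a set \<Rightarrow> 'a set" where
  "equilibria f X = {x \<in> X. f x = 0}"

(* Only the values x t with t >= 0 matter. *)
definition trajectory :: "('a::real_normed_vector \<Rightarrow> 'a) \<Rightarrow> 'a set \<Rightarrow> (real \<Rightarrow> 'a) \<Rightarrow> bool" where
  "trajectory f X x \<longleftrightarrow>
     (\<forall>t\<ge>0. x t \<in> X \<and> (x has_vector_derivative f (x t)) (at t within {0..}))"

definition converges_to_set :: "(real \<Rightarrow> 'a::metric_space) \<Rightarrow> 'a set \<Rightarrow> bool" where
  "converges_to_set x A \<longleftrightarrow> ((\<lambda>t. infdist (x t) A) \<longlongrightarrow> 0) at_top"

definition lyapunov_stable :: "('a::real_normed_vector \<Rightarrow> 'a) \<Rightarrow> 'a set \<Rightarrow> 'a set \<Rightarrow> bool" where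
  "lyapunov_stable f X A \<longleftrightarrow>
     (\<forall>\<epsilon>>0. \<exists>\<delta>>0. \<forall>x. trajectory f X x \<and> infdist (x 0) A < \<delta> \<longrightarrow>
        (\<forall>t\<ge>0. infdist (x t) A < \<epsilon>))"

(* The existence clause excludes initial points without a trajectory defined for all t >= 0,
   for which the second clause would hold vacuously. *)
definition domain_of_attraction ::
  "('a::real_normed_vector \<Rightarrow> 'a) \<Rightarrow> 'a set \<Rightarrow> 'a set \<Rightarrow> 'a set" where
  "domain_of_attraction f X A =
     {\<xi> \<in> X. (\<exists>x. trajectory f X x \<and> x 0 = \<xi>) \<and>
             (\<forall>x. trajectory f X x \<and> x 0 = \<xi> \<longrightarrow> converges_to_set x A)}"

definition asymptotically_stable ::
  "('a::real_normed_vector \<Rightarrow> 'a) \<Rightarrow> 'a set \<Rightarrow> 'a set \<Rightarrow> bool" where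
  "asymptotically_stable f X A \<longleftrightarrow>
     lyapunov_stable f X A \<and>
     (\<exists>\<delta>>0. {\<xi> \<in> X. infdist \<xi> A < \<delta>} \<subseteq> domain_of_attraction f X A)"

definition almost_globally_asymptotically_stable ::
  "('a::real_normed_vector \<Rightarrow> 'a) \<Rightarrow> 'a set \<Rightarrow> 'a set \<Rightarrow> bool" where
  "almost_globally_asymptotically_stable f X A \<longleftrightarrow>
     lyapunov_stable f X A \<and>
     (\<exists>X1. openin (top_of_set X) X1 \<and> X \<subseteq> closure X1 \<and>
           X1 \<subseteq> domain_of_attraction f X A)"

end

theory Submission
  imports Defs
begin

text \<open>In quaternion notation the attitude equation reads
  \<open>Q' = L(Q) (d(z, Q) - A (L(Q)\<^sup>T M Q))\<close> with \<open>M = diag(0, W\<^sub>\<rho>)\<close>, so up to the exponentially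
  decaying input \<open>z\<close> it is a twisted gradient descent of the quadratic form \<open>Q \<bullet> M Q\<close> on the sphere.
  Along trajectories \<open>V\<close> decreases at least at the rate \<open>\<psi> = \<rho>\<^sub>1\<^sup>2 \<bar>z\<bar>\<^sup>2 + \<bar>L(Q)\<^sup>T M Q\<bar>\<^sup>2\<close>, whose zeros are the
  equilibria. For a self-adjoint map, \<open>\<bar>x \<bullet> N x\<bar>\<close> is bounded by a multiple of \<open>\<bar>N x\<bar>\<^sup>2\<close>. With
  \<open>N = M - l\<close> this gives a Lojasiewicz inequality for \<open>V\<close> near every level, hence trajectories of
  finite length and convergence to a single equilibrium, even when an eigenvalue of \<open>W\<^sub>\<rho>\<close> is repeated
  and the equilibria are not isolated.

  For almost global stability no stable manifold theorem is needed. If a trajectory tends to an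
  equilibrium of level \<open>l > 0\<close>, a late state can be perturbed in the direction of the scalar axis, where
  \<open>M - l\<close> is negative. A quadratic form of the difference of the two trajectories would then tend to
  minus infinity if both stayed at the level \<open>l\<close>, so the perturbed one tends to a different level.
  Choosing the lowest limit level among the trajectories that start in a given open set, which exists
  because there are finitely many eigenvalues, yields a trajectory that tends to level 0.\<close>

section \<open>Differential inequalities and global solutions\<close>

text \<open>The twist is the matrix \<open>A\<close>: because of it the linearization at an
  equilibrium need not be self-adjoint, so growth along unstable directions cannot be read off from
  eigenvectors of \<open>M\<close>. The form of \<open>M - l\<close> alone does not help: it
  vanishes on the kernel of \<open>M - l\<close>, where error terms of order |D|^2 in the difference
  D of two solutions have nothing to absorb them. The shift by \<kappa> makes the form equal to
  \<kappa> |D|^2 there, at the price of a cross term between \<kappa> D and \<open>A\<close>, which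
  the spectral gap dominates once \<kappa> is small. The resulting inequality holds only near the
  level, so the perturbation is made at a late time and carried back to time 0. This is why
  solutions are prescribed at an arbitrary time and why distances of solutions are bounded in both
  time directions. The two solutions share their first component, so the input has no difference of
  its own.\<close>

lemma norm_increment_le:
  fixes x :: "real \<Rightarrow> 'a::real_normed_vector"
  assumes "a \<le> b" "{a..b} \<subseteq> S"
    and x: "\<And>t. t \<in> {a..b} \<Longrightarrow> (x has_vector_derivative x' t) (at t within S)"
    and \<phi>: "\<And>t. t \<in> {a..b} \<Longrightarrow> (\<phi> has_real_derivative \<phi>' t) (at t within S)"
    and le: "\<And>t. t \<in> {a..b} \<Longrightarrow> norm (x' t) \<le> \<phi>' t"
  shows "norm (x b - x a) \<le> \<phi> b - \<phi> a"
proof (cases "a = b")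
  case False
  then have "a < b" using assms(1) by simp
  have x1: "(x has_vector_derivative x' t) (at t within {a..b})" if "t \<in> {a..b}" for t
    using x[OF that] assms(2) has_vector_derivative_within_subset by blast
  have \<phi>1: "(\<phi> has_vector_derivative \<phi>' t) (at t within {a..b})" if "t \<in> {a..b}" for t
    using \<phi>[OF that] assms(2) has_vector_derivative_within_subset
    unfolding has_real_derivative_iff_has_vector_derivative by blast
  show ?thesis
  proof (rule differentiable_bound_general[OF \<open>a < b\<close>])
    show "continuous_on {a..b} x" "continuous_on {a..b} \<phi>"
      using x1 \<phi>1 continuous_on_vector_derivative by blast+
    show "(x has_vector_derivative x' t) (at t)" "(\<phi> has_vector_derivative \<phi>' t) (at t)"
      if "a < t" "t < b" for t
      using x1[of t] \<phi>1[of t] that at_within_Icc_at[of a t b] by auto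
    show "norm (x' t) \<le> \<phi>' t" if "a < t" "t < b" for t
      using le[of t] that by simp
  qed
qed simp

lemma deriv_nonneg_mono:
  assumes "a \<le> b" "{a..b} \<subseteq> S"
    and "\<And>t. t \<in> {a..b} \<Longrightarrow> (\<phi> has_real_derivative \<phi>' t) (at t within S)"
    and "\<And>t. t \<in> {a..b} \<Longrightarrow> 0 \<le> \<phi>' t"
  shows "\<phi> a \<le> \<phi> b"
  using norm_increment_le[OF assms(1,2), of "\<lambda>_. 0::real" "\<lambda>_. 0" \<phi> \<phi>'] assms(3,4) by simp

text \<open>The product of \<open>h\<close> with the integrating factor
  \<open>exp (- k * (t - a))\<close> is nonincreasing. The rate \<open>k\<close> has either sign: it
  is negative for the decay of \<open>V\<close> and positive for distances and for the escape from a
  level.\<close>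

lemma gronwall:
  assumes "a \<le> b" "{a..b} \<subseteq> S"
    and h: "\<And>t. t \<in> {a..b} \<Longrightarrow> (h has_real_derivative h' t) (at t within S)"
    and le: "\<And>t. t \<in> {a..b} \<Longrightarrow> h' t \<le> k * h t"
  shows "h b \<le> h a * exp (k * (b - a))"
proof -
  have "- (h a * exp (- k * (a - a))) \<le> - (h b * exp (- k * (b - a)))"
  proof (rule deriv_nonneg_mono[OF assms(1,2)])
    fix t assume t: "t \<in> {a..b}"
    show "((\<lambda>t. - (h t * exp (- k * (t - a)))) has_real_derivative
        (k * h t - h' t) * exp (- k * (t - a))) (at t within S)"
      by (rule derivative_eq_intros h[OF t] refl | simp add: algebra_simps)+
    show "0 \<le> (k * h t - h' t) * exp (- k * (t - a))"
      using le[OF t] by simp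
  qed
  then have "h b * exp (- k * (b - a)) \<le> h a" by simp
  then have "h b * exp (- k * (b - a)) * exp (k * (b - a)) \<le> h a * exp (k * (b - a))"
    by (rule mult_right_mono) simp
  then show ?thesis by (simp add: mult.assoc flip: exp_add)
qed

text \<open>Bounds the past by the future. It turns a small perturbation at a late time into a small
  perturbation of the initial state.\<close>

lemma gronwall_backward:
  assumes "a \<le> b" "{a..b} \<subseteq> S"
    and h: "\<And>t. t \<in> {a..b} \<Longrightarrow> (h has_real_derivative h' t) (at t within S)"
    and le: "\<And>t. t \<in> {a..b} \<Longrightarrow> - k * h t \<le> h' t"
  shows "h a \<le> h b * exp (k * (b - a))"
proof -
  have "h a * exp (k * (a - a)) \<le> h b * exp (k * (b - a))"
  proof (rule deriv_nonneg_mono[OF assms(1,2)])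
    fix t assume t: "t \<in> {a..b}"
    show "((\<lambda>t. h t * exp (k * (t - a))) has_real_derivative
        (k * h t + h' t) * exp (k * (t - a))) (at t within S)"
      by (rule derivative_eq_intros h[OF t] refl | simp add: algebra_simps)+
    show "0 \<le> (k * h t + h' t) * exp (k * (t - a))"
      using le[OF t] by simp
  qed
  then show ?thesis by simp
qed

lemma has_real_derivative_norm_power2:
  fixes x :: "real \<Rightarrow> 'a::real_inner"
  assumes "(x has_vector_derivative x') (at t within S)"
  shows "((\<lambda>t. (norm (x t))\<^sup>2) has_real_derivative 2 * (x t \<bullet> x')) (at t within S)"
proof -
  have "((\<lambda>t. x t \<bullet> x t) has_derivative (\<lambda>h. x t \<bullet> (h *\<^sub>R x') + (h *\<^sub>R x') \<bullet> x t)) (at t within S)"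
    using assms unfolding has_vector_derivative_def by (intro has_derivative_inner)
  then show ?thesis
    unfolding power2_norm_eq_inner has_field_derivative_def
    by (rule has_derivative_eq_rhs) (auto simp: inner_commute)
qed

text \<open>Both estimates are obtained for the squared distance, which is differentiable even where
  the distance vanishes, and the square root is taken at the end.\<close>

lemma solution_dist_le:
  fixes x y :: "real \<Rightarrow> 'a::real_inner"
  assumes "a \<le> b" "{a..b} \<subseteq> S"
    and x: "\<And>t. t \<in> {a..b} \<Longrightarrow> (x has_vector_derivative x' t) (at t within S)"
    and y: "\<And>t. t \<in> {a..b} \<Longrightarrow> (y has_vector_derivative y' t) (at t within S)"
    and le: "\<And>t. t \<in> {a..b} \<Longrightarrow> norm (x' t - y' t) \<le> L * norm (x t - y t)"
  shows "norm (x b - y b) \<le> norm (x a - y a) * exp (L * (b - a))"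
    and "norm (x a - y a) \<le> norm (x b - y b) * exp (L * (b - a))"
proof -
  let ?h = "\<lambda>t. (norm (x t - y t))\<^sup>2"
  let ?h' = "\<lambda>t. 2 * ((x t - y t) \<bullet> (x' t - y' t))"
  have h: "(?h has_real_derivative ?h' t) (at t within S)" if "t \<in> {a..b}" for t
    using x[OF that] y[OF that]
    by (intro has_real_derivative_norm_power2 has_vector_derivative_diff)
  have bd: "\<bar>?h' t\<bar> \<le> (2 * L) * ?h t" if "t \<in> {a..b}" for t
  proof -
    have "\<bar>(x t - y t) \<bullet> (x' t - y' t)\<bar> \<le> norm (x t - y t) * norm (x' t - y' t)"
      by (rule Cauchy_Schwarz_ineq2)
    also have "\<dots> \<le> norm (x t - y t) * (L * norm (x t - y t))"
      using le[OF that] by (intro mult_left_mono) auto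
    finally show ?thesis by (simp add: power2_eq_square abs_mult mult.left_commute)
  qed
  have ex: "exp (2 * L * (b - a)) = (exp (L * (b - a)))\<^sup>2"
    by (simp add: exp_double[symmetric] algebra_simps)
  have "?h b \<le> ?h a * exp (2 * L * (b - a))"
    using gronwall[OF assms(1,2) h, of "2 * L"] bd by fastforce
  then show "norm (x b - y b) \<le> norm (x a - y a) * exp (L * (b - a))"
    unfolding ex power_mult_distrib[symmetric] by (rule power2_le_imp_le) simp
  have "?h a \<le> ?h b * exp (2 * L * (b - a))"
    using gronwall_backward[OF assms(1,2) h, of "2 * L"] bd
    by (smt (verit) mult_minus_left)
  then show "norm (x a - y a) \<le> norm (x b - y b) * exp (L * (b - a))"
    unfolding ex power_mult_distrib[symmetric] by (rule power2_le_imp_le) simp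
qed

text \<open>The fixed point is sought among the bounded functions \<open>x / w\<close> with weight
  \<open>w t = exp (2 * L * \<bar>t - T\<bar>)\<close>, for which the integral operator is a contraction on the whole
  half line. The initial time \<open>T\<close> is arbitrary, so the solution also extends backwards to \<open>0\<close>.\<close>

theorem global_solution_exists:
  fixes G :: "real \<Rightarrow> 'a::banach \<Rightarrow> 'a"
  assumes cont: "continuous_on ({0..} \<times> UNIV) (\<lambda>(t, x). G t x)"
    and lip: "\<And>t x y. 0 \<le> t \<Longrightarrow> norm (G t x - G t y) \<le> L * norm (x - y)"
    and bnd: "\<And>t x. 0 \<le> t \<Longrightarrow> norm (G t x) \<le> C"
    and "0 < L" "0 \<le> T"
  shows "\<exists>x. x T = \<xi> \<and> (\<forall>t\<ge>0. (x has_vector_derivative G t (x t)) (at t within {0..}))"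
proof -
  define w where "w t = exp (2 * L * \<bar>t - T\<bar>)" for t
  have w_cont: "continuous_on S w" for S
    unfolding w_def by (intro continuous_intros)
  have w_ge: "2 * L * \<bar>t - T\<bar> \<le> w t" "1 \<le> w t" for t
    unfolding w_def using \<open>0 < L\<close> exp_ge_add_one_self[of "2 * L * \<bar>t - T\<bar>"]
      mult_nonneg_nonneg[of "2 * L" "\<bar>t - T\<bar>"] by linarith+
  have "C \<ge> 0" using bnd[of 0] norm_ge_zero order_trans by blast
  define g where "g u s = G s (w s *\<^sub>R apply_bcontfun u s)" for u :: "real \<Rightarrow>\<^sub>C 'a" and s
  \<comment> \<open>All integrals start at 0, so that \<open>I u t - I u T\<close> is the integral
    from \<open>T\<close> to \<open>t\<close> for \<open>t\<close> on either side of
    \<open>T\<close>.\<close>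
  define I where "I u t = integral {0..t} (g u)" for u t
  have g_cont: "continuous_on {0..} (g u)" for u
  proof -
    have "continuous_on {0..} (\<lambda>s. (\<lambda>(t, x). G t x) (s, w s *\<^sub>R apply_bcontfun u s))"
      by (rule continuous_on_compose2[OF cont]) (auto intro!: continuous_intros w_cont)
    then show ?thesis by (simp add: g_def)
  qed
  have I_deriv: "(I u has_vector_derivative g u t) (at t within {0..})" if "0 \<le> t" for u t
  proof -
    have "((\<lambda>t. integral {0..t} (g u)) has_vector_derivative g u t) (at t within {0..t+1})"
      using that by (intro integral_has_vector_derivative continuous_on_subset[OF g_cont]) auto
    moreover have "at t within {0..t+1} = at t within {0..}"
      using that by (intro at_within_nhd[of t "{..<t+1}"]) auto
    ultimately show ?thesis by (simp add: I_def[abs_def])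
  qed
  have I_bound: "norm (I u b - I u a) \<le> C * \<bar>b - a\<bar>" if "0 \<le> a" "0 \<le> b" for u a b
  proof -
    have *: "norm (I u b - I u a) \<le> C * b - C * a" if "0 \<le> a" "a \<le> b" for a b
    proof (rule norm_increment_le[where S = "{0..}"])
      show "(I u has_vector_derivative g u t) (at t within {0..})" if "t \<in> {a..b}" for t
        using that \<open>0 \<le> a\<close> by (intro I_deriv) simp
      show "((\<lambda>t. C * t) has_real_derivative C) (at t within {0..})" for t
        by (rule derivative_eq_intros refl | simp)+
      show "norm (g u t) \<le> C" if "t \<in> {a..b}" for t
        unfolding g_def using that \<open>0 \<le> a\<close> by (intro bnd) simp
    qed (use that in auto)
    show ?thesis
      using *[of a b] *[of b a] that norm_minus_commute[of "I u a" "I u b"]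
      by (cases "a \<le> b") (simp_all add: right_diff_distrib)
  qed
  have g_lip: "norm (g u t - g v t) \<le> L * dist u v * w t" if "0 \<le> t" for u v t
  proof -
    have "norm (g u t - g v t) \<le> L * norm (w t *\<^sub>R apply_bcontfun u t - w t *\<^sub>R apply_bcontfun v t)"
      unfolding g_def by (rule lip[OF that])
    also have "\<dots> = L * (w t * dist (apply_bcontfun u t) (apply_bcontfun v t))"
      using w_ge(2)[of t] by (simp add: dist_norm flip: scaleR_diff_right)
    also have "\<dots> \<le> L * (w t * dist u v)"
      using \<open>0 < L\<close> w_ge(2)[of t] by (intro mult_left_mono dist_bounded) auto
    finally show ?thesis by (simp add: mult_ac)
  qed
  \<comment> \<open>The weight grows at rate \<open>2 * L\<close> away from \<open>T\<close> on both
    sides, so integrating \<open>L * dist u v * w\<close> gives half of \<open>dist u v * w\<close>.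
    This is the source of the contraction factor 1/2.\<close>
  have I_lip: "norm ((I u t - I u T) - (I v t - I v T)) \<le> dist u v / 2 * w t"
    if "0 \<le> t" for u v t
  proof (cases "T \<le> t")
    case True
    have "norm ((I u t - I v t) - (I u T - I v T))
        \<le> dist u v / 2 * exp (2 * L * (t - T)) - dist u v / 2 * exp (2 * L * (T - T))"
    proof (rule norm_increment_le[where S = "{0..}", OF True])
      show "((\<lambda>t. I u t - I v t) has_vector_derivative g u s - g v s) (at s within {0..})"
        if "s \<in> {T..t}" for s
        using that \<open>0 \<le> T\<close> by (intro has_vector_derivative_diff I_deriv) auto
      show "((\<lambda>t. dist u v / 2 * exp (2 * L * (t - T))) has_real_derivative
          L * dist u v * exp (2 * L * (s - T))) (at s within {0..})" for s
        by (rule derivative_eq_intros refl | simp)+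
      show "norm (g u s - g v s) \<le> L * dist u v * exp (2 * L * (s - T))" if "s \<in> {T..t}" for s
        using g_lip[of s u v] that \<open>0 \<le> T\<close> by (simp add: w_def)
    qed (use \<open>0 \<le> T\<close> in auto)
    also have "\<dots> \<le> dist u v / 2 * w t" using True by (simp add: w_def)
    finally show ?thesis by (simp add: algebra_simps)
  next
    case False
    then have "t \<le> T" by simp
    have "norm ((I u T - I v T) - (I u t - I v t))
        \<le> - (dist u v / 2 * exp (2 * L * (T - T))) - - (dist u v / 2 * exp (2 * L * (T - t)))"
    proof (rule norm_increment_le[where S = "{0..}", OF \<open>t \<le> T\<close>])
      show "((\<lambda>t. I u t - I v t) has_vector_derivative g u s - g v s) (at s within {0..})"
        if "s \<in> {t..T}" for s
        using that \<open>0 \<le> t\<close> by (intro has_vector_derivative_diff I_deriv) auto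
      show "((\<lambda>t. - (dist u v / 2 * exp (2 * L * (T - t)))) has_real_derivative
          L * dist u v * exp (2 * L * (T - s))) (at s within {0..})" for s
        by (rule derivative_eq_intros refl | simp)+
      show "norm (g u s - g v s) \<le> L * dist u v * exp (2 * L * (T - s))" if "s \<in> {t..T}" for s
        using g_lip[of s u v] that \<open>0 \<le> t\<close> by (simp add: w_def)
    qed (use \<open>0 \<le> t\<close> in auto)
    also have "\<dots> \<le> dist u v / 2 * w t" using False by (simp add: w_def)
    also have "norm ((I u T - I v T) - (I u t - I v t)) = norm ((I u t - I u T) - (I v t - I v T))"
      by (subst norm_minus_commute) (simp add: algebra_simps)
    finally show ?thesis .
  qed
  \<comment> \<open>Bounded continuous functions live on the whole line; \<open>max 0 t\<close>
    continues the operator constantly to negative times.\<close>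
  define F where "F u t = (1 / w (max 0 t)) *\<^sub>R (\<xi> + I u (max 0 t) - I u T)" for u t
  have F_bcontfun: "F u \<in> bcontfun" for u
  proof -
    have I_cont: "continuous_on {0..} (I u)"
      using I_deriv continuous_on_vector_derivative by (metis atLeast_iff)
    have "continuous_on UNIV (\<lambda>t. I u (max 0 t))" "continuous_on UNIV (\<lambda>t. w (max 0 t))"
      by (rule continuous_on_compose2[OF I_cont] continuous_on_compose2[OF w_cont[of UNIV]],
          auto intro!: continuous_intros)+
    moreover have "w t \<noteq> 0" for t by (simp add: w_def)
    ultimately have "continuous_on UNIV (F u)"
      unfolding F_def by (intro continuous_intros) auto
    moreover have "norm (F u t) \<le> norm \<xi> + C / (2 * L)" for t
    proof -
      let ?t = "max 0 t"
      have "norm (\<xi> + I u ?t - I u T) \<le> norm \<xi> + norm (I u ?t - I u T)"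
        by (metis add_diff_eq norm_triangle_ineq)
      also have "\<dots> \<le> norm \<xi> + C * \<bar>?t - T\<bar>"
        using I_bound[of T ?t u] \<open>0 \<le> T\<close> by auto
      also have "\<dots> \<le> norm \<xi> * w ?t + C / (2 * L) * w ?t"
      proof (rule add_mono)
        show "norm \<xi> \<le> norm \<xi> * w ?t"
          using mult_left_mono[OF w_ge(2)[of ?t], of "norm \<xi>"] by simp
        have "C / (2 * L) * (2 * L * \<bar>?t - T\<bar>) \<le> C / (2 * L) * w ?t"
          using \<open>0 \<le> C\<close> \<open>0 < L\<close> by (intro mult_left_mono w_ge) auto
        then show "C * \<bar>?t - T\<bar> \<le> C / (2 * L) * w ?t" using \<open>0 < L\<close> by simp
      qed
      finally have "norm (\<xi> + I u ?t - I u T) \<le> (norm \<xi> + C / (2 * L)) * w ?t"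
        by (simp add: algebra_simps)
      moreover have "0 < w ?t" by (simp add: w_def)
      ultimately show ?thesis by (simp add: F_def divide_simps)
    qed
    ultimately show ?thesis by (auto simp: bcontfun_def bounded_iff)
  qed
  have F_apply: "apply_bcontfun (Bcontfun (F u)) = F u" for u
    by (rule Bcontfun_inverse[OF F_bcontfun])
  have "dist (Bcontfun (F u)) (Bcontfun (F v)) \<le> 1/2 * dist u v" for u v
  proof (rule dist_bound)
    fix t :: real
    let ?t = "max 0 t"
    have "0 < w ?t" by (simp add: w_def)
    have "F u t - F v t = (1 / w ?t) *\<^sub>R ((I u ?t - I u T) - (I v ?t - I v T))"
      by (simp add: F_def flip: scaleR_diff_right)
    then have "norm (F u t - F v t) = norm ((I u ?t - I u T) - (I v ?t - I v T)) / w ?t"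
      using \<open>0 < w ?t\<close> by simp
    also have "\<dots> \<le> 1/2 * dist u v"
      using I_lip[of ?t u v] \<open>0 < w ?t\<close> by (simp add: divide_simps)
    finally show "dist (apply_bcontfun (Bcontfun (F u)) t) (apply_bcontfun (Bcontfun (F v)) t)
        \<le> 1/2 * dist u v"
      by (simp add: F_apply dist_norm)
  qed
  then obtain u where u: "Bcontfun (F u) = u"
    using banach_fix_type[of "1/2" "\<lambda>u. Bcontfun (F u)"] by auto
  define x where "x t = w t *\<^sub>R apply_bcontfun u t" for t
  have x_eq: "x t = \<xi> + I u t - I u T" if "0 \<le> t" for t
  proof -
    have "w t \<noteq> 0" by (simp add: w_def)
    have "x t = w t *\<^sub>R F u t" by (metis F_apply u x_def)
    then show ?thesis using that \<open>w t \<noteq> 0\<close> by (simp add: F_def)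
  qed
  have "(x has_vector_derivative G t (x t)) (at t within {0..})" if "0 \<le> t" for t
  proof -
    have "((\<lambda>t. \<xi> + I u t - I u T) has_vector_derivative g u t) (at t within {0..})"
      using I_deriv[OF that] by (auto intro!: derivative_eq_intros)
    moreover have "g u t = G t (x t)" by (simp add: g_def x_def)
    ultimately show ?thesis
      using has_vector_derivative_transform[of t "{0..}" x "\<lambda>t. \<xi> + I u t - I u T"] x_eq that
      by auto
  qed
  moreover have "x T = \<xi>" using x_eq[OF \<open>0 \<le> T\<close>] by simp
  ultimately show ?thesis by blast
qed

section \<open>Self-adjoint maps\<close>

text \<open>On the orthogonal complement of the kernel \<open>f\<close> is injective, hence bounded
  below by some \<open>c\<close>. The kernel component of \<open>x\<close> affects neither
  \<open>f x\<close> nor, by self-adjointness, \<open>x \<bullet> f x\<close>, so \<open>c\<close>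
  serves for all \<open>x\<close>.\<close>

lemma selfadjoint_gap:
  fixes f :: "'a::euclidean_space \<Rightarrow> 'a"
  assumes "linear f" and sa: "\<And>x y. f x \<bullet> y = x \<bullet> f y"
  shows "\<exists>g>0. \<forall>x. g * \<bar>x \<bullet> f x\<bar> \<le> (norm (f x))\<^sup>2"
proof -
  interpret linear f by fact
  define K where "K = {x. f x = 0}"
  have K: "subspace K" unfolding K_def by (rule linear_subspace_kernel[OF assms(1)])
  define P where "P = {y. \<forall>x\<in>K. orthogonal x y}"
  have P: "subspace P" unfolding P_def by (rule subspace_orthogonal_to_vectors)
  have inj: "\<forall>x\<in>P. f x = 0 \<longrightarrow> x = 0"
    by (auto simp: P_def K_def orthogonal_self)
  have "bounded_linear f" using assms(1) linear_conv_bounded_linear by blast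
  then obtain c where c: "c > 0" "\<And>x. x \<in> P \<Longrightarrow> c * norm x \<le> norm (f x)"
    using injective_imp_isometric[OF closed_subspace[OF P] P _ inj] by auto
  have "c * \<bar>x \<bullet> f x\<bar> \<le> (norm (f x))\<^sup>2" for x
  proof -
    obtain k r where kr: "k \<in> span K" "\<And>w. w \<in> span K \<Longrightarrow> orthogonal r w" "x = k + r"
      using orthogonal_subspace_decomp_exists[of K x] by blast
    have "f k = 0" using kr(1) K by (simp add: span_eq_iff[THEN iffD2] K_def)
    have "r \<in> P"
      using kr(2) K by (simp add: P_def span_eq_iff[THEN iffD2] orthogonal_commute)
    have fx: "f x = f r" by (simp add: kr(3) add \<open>f k = 0\<close>)
    have "x \<bullet> f x = r \<bullet> f r"
      using sa[of k r] by (simp add: fx) (simp add: kr(3) inner_add_left \<open>f k = 0\<close>)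
    then have "c * \<bar>x \<bullet> f x\<bar> \<le> c * (norm r * norm (f r))"
      using c(1) Cauchy_Schwarz_ineq2[of r "f r"] by simp
    also have "\<dots> \<le> norm (f r) * norm (f r)"
      using c(2)[OF \<open>r \<in> P\<close>] by (simp add: mult_right_mono flip: mult.assoc)
    finally show ?thesis by (simp add: fx power2_eq_square)
  qed
  with c(1) show ?thesis by blast
qed

text \<open>The first-order condition at a minimum, in algebraic form.\<close>

lemma quadratic_nonneg_imp_linear_coeff_zero:
  fixes a b :: real
  assumes "\<And>t. 0 \<le> 2 * t * a + t\<^sup>2 * b"
  shows "a = 0"
proof (rule ccontr)
  assume "a \<noteq> 0"
  \<comment> \<open>With the step \<open>- a / c\<close> the quadratic term is at most half the size
    of the linear one, because \<open>b / c \<le> 1\<close>.\<close>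
  define c where "c = \<bar>b\<bar> + 1"
  have "c > 0" by (simp add: c_def)
  have "0 \<le> 2 * (- a / c) * a + (- a / c)\<^sup>2 * b" by (rule assms)
  also have "\<dots> = (a\<^sup>2 / c) * (b / c - 2)"
    using \<open>c > 0\<close> by (simp add: field_simps power2_eq_square)
  also have "\<dots> < 0"
  proof (rule mult_pos_neg)
    have "b / c \<le> 1" using \<open>c > 0\<close> by (simp add: c_def)
    then show "b / c - 2 < 0" by simp
  qed (use \<open>a \<noteq> 0\<close> \<open>c > 0\<close> in auto)
  finally show False by simp
qed

text \<open>A minimizer of the Rayleigh quotient on the compact unit sphere is an eigenvector: the
  form minus \<open>l\<close> times the squared norm is nonnegative and vanishes at
  \<open>v\<close>, so its first variation there is zero in every direction.\<close>

lemma selfadjoint_min_eigenvector: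
  fixes f :: "'a::euclidean_space \<Rightarrow> 'a"
  assumes "linear f" and sa: "\<And>x y. f x \<bullet> y = x \<bullet> f y"
  shows "\<exists>v l. norm v = 1 \<and> f v = l *\<^sub>R v \<and> (\<forall>x. l * (norm x)\<^sup>2 \<le> x \<bullet> f x)"
proof -
  interpret linear f by fact
  have "continuous_on (sphere 0 1) (\<lambda>x. x \<bullet> f x)"
    by (intro continuous_intros linear_continuous_on) (simp add: assms(1) flip: linear_conv_bounded_linear)
  moreover have "sphere (0::'a) 1 \<noteq> {}" by simp
  ultimately obtain v where v: "norm v = 1" "\<And>x. norm x = 1 \<Longrightarrow> v \<bullet> f v \<le> x \<bullet> f x"
    using continuous_attains_inf[of "sphere 0 1" "\<lambda>x. x \<bullet> f x"] by auto
  define l where "l = v \<bullet> f v"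
  have min: "l * (norm x)\<^sup>2 \<le> x \<bullet> f x" for x
  proof (cases "x = 0")
    case False
    have "l \<le> (x /\<^sub>R norm x) \<bullet> f (x /\<^sub>R norm x)"
      unfolding l_def using False by (intro v(2)) simp
    also have "\<dots> = (x \<bullet> f x) / (norm x)\<^sup>2"
      by (simp add: scale power2_eq_square divide_simps)
    finally show ?thesis using False by (simp add: field_simps)
  qed (simp add: zero)
  have "y \<bullet> (f v - l *\<^sub>R v) = 0" for y
  proof (rule quadratic_nonneg_imp_linear_coeff_zero)
    fix t :: real
    have "l * (norm (v + t *\<^sub>R y))\<^sup>2 \<le> (v + t *\<^sub>R y) \<bullet> f (v + t *\<^sub>R y)" by (rule min)
    moreover have "v \<bullet> v = 1" using v(1) by (simp add: norm_eq_1)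
    moreover have "v \<bullet> f y = y \<bullet> f v" "v \<bullet> y = y \<bullet> v"
      using sa[of v y] by (simp_all add: inner_commute)
    ultimately show "0 \<le> 2 * t * (y \<bullet> (f v - l *\<^sub>R v)) + t\<^sup>2 * (y \<bullet> f y - l * (y \<bullet> y))"
      unfolding power2_norm_eq_inner
      by (simp add: add scale inner_add_left inner_add_right inner_diff_right l_def[symmetric]
          distrib_left distrib_right right_diff_distrib power2_eq_square mult.assoc mult.left_commute)
  qed
  from this[of "f v - l *\<^sub>R v"] have "f v = l *\<^sub>R v" by simp
  with v(1) min show ?thesis by blast
qed

lemma selfadjoint_eigenvectors_orthogonal:
  fixes f :: "'a::real_inner \<Rightarrow> 'a"
  assumes sa: "\<And>x y. f x \<bullet> y = x \<bullet> f y"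
    and "f v = a *\<^sub>R v" "f w = b *\<^sub>R w" "a \<noteq> b"
  shows "v \<bullet> w = 0"
  using sa[of v w] assms(2-4) by simp

text \<open>One eigenvector chosen per eigenvalue gives an orthogonal, hence independent, family.
  Finiteness is what provides a lowest limit level later on.\<close>

lemma selfadjoint_finite_eigenvalues:
  fixes f :: "'a::euclidean_space \<Rightarrow> 'a"
  assumes sa: "\<And>x y. f x \<bullet> y = x \<bullet> f y"
  shows "finite {l. \<exists>v. v \<noteq> 0 \<and> f v = l *\<^sub>R v}"
proof -
  define E where "E = {l. \<exists>v. v \<noteq> 0 \<and> f v = l *\<^sub>R v}"
  obtain u where u: "\<And>l. l \<in> E \<Longrightarrow> u l \<noteq> 0 \<and> f (u l) = l *\<^sub>R u l"
    using bchoice[of E "\<lambda>l v. v \<noteq> 0 \<and> f v = l *\<^sub>R v"] unfolding E_def by blast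
  have orth: "u a \<bullet> u b = 0" if "a \<in> E" "b \<in> E" "a \<noteq> b" for a b
    using selfadjoint_eigenvectors_orthogonal[OF sa, of "u a" a "u b" b] u that by blast
  have "inj_on u E"
    by (rule inj_onI) (metis orth u inner_eq_zero_iff)
  moreover have "pairwise orthogonal (u ` E)"
    by (auto simp: pairwise_def orthogonal_def intro: orth)
  then have "independent (u ` E)"
    using u by (intro pairwise_orthogonal_independent) auto
  then have "finite (u ` E)" using independent_imp_finite by blast
  ultimately show ?thesis unfolding E_def by (rule finite_imageD[rotated])
qed

lemma selfadjoint_form_has_real_derivative:
  fixes f :: "'a::euclidean_space \<Rightarrow> 'a"
  assumes "linear f" and sa: "\<And>x y. f x \<bullet> y = x \<bullet> f y"
    and Q: "(Q has_vector_derivative Q') (at t within S)"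
  shows "((\<lambda>t. Q t \<bullet> f (Q t)) has_real_derivative 2 * (Q' \<bullet> f (Q t))) (at t within S)"
proof -
  have "((\<lambda>t. f (Q t)) has_vector_derivative f Q') (at t within S)"
    using assms(1) by (intro bounded_linear.has_vector_derivative[OF _ Q]) (simp add: linear_conv_bounded_linear)
  from bounded_bilinear.has_vector_derivative[OF bounded_bilinear_inner Q this]
  have "((\<lambda>t. Q t \<bullet> f (Q t)) has_vector_derivative Q t \<bullet> f Q' + Q' \<bullet> f (Q t)) (at t within S)" .
  moreover have "Q t \<bullet> f Q' + Q' \<bullet> f (Q t) = 2 * (Q' \<bullet> f (Q t))"
    by (metis sa inner_commute mult_2)
  ultimately show ?thesis
    unfolding has_real_derivative_iff_has_vector_derivative by (simp only:)
qed

text \<open>Three orthonormal vectors span the space, so \<open>x\<close> is orthogonal to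
  itself.\<close>

lemma orthonormal3_eqI:
  fixes v :: "3 \<Rightarrow> real^3"
  assumes "\<And>i j. v i \<bullet> v j = (if i = j then 1 else 0)" "\<And>j. x \<bullet> v j = 0"
  shows "x = 0"
proof -
  have "inj v"
  proof (rule injI)
    fix i j assume "v i = v j"
    then have "v i \<bullet> v j = v i \<bullet> v i" by simp
    then show "i = j" by (simp add: assms(1) split: if_splits)
  qed
  have "v j \<noteq> 0" for j using assms(1)[of j j] by auto
  then have "0 \<notin> range v" by auto
  moreover have "pairwise orthogonal (range v)"
    by (auto simp: pairwise_def orthogonal_def assms(1))
  ultimately have "independent (range v)"
    by (intro pairwise_orthogonal_independent)
  moreover have "card (range v) = 3" using card_image[OF \<open>inj v\<close>] by simp
  ultimately have "UNIV \<subseteq> span (range v)"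
    by (intro card_ge_dim_independent) simp_all
  then have "x \<in> span (range v)" by (rule subsetD) simp
  moreover have "orthogonal x y" if "y \<in> range v" for y
    using that assms(2) by (auto simp: orthogonal_def)
  ultimately have "orthogonal x x" by (rule orthogonal_to_span)
  then show ?thesis unfolding orthogonal_self .
qed

section \<open>The attitude system in quaternion form\<close>

lemma norm_cross3_le: "norm (cross3 x y) \<le> norm x * norm y"
proof (rule power2_le_imp_le)
  show "(norm (cross3 x y))\<^sup>2 \<le> (norm x * norm y)\<^sup>2"
    using norm_cross_dot[of x y] by (smt (verit) zero_le_power2)
qed simp

section \<open>Quaternion algebra and elementary bounds\<close>

type_synonym quat = "real \<times> (real^3)"

text \<open>This is the negative of the quaternion product of \<open>Q\<close> with the pure
  quaternion \<open>(0, w)\<close>. For a unit \<open>Q\<close> it maps \<open>real^3\<close>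
  isometrically onto the tangent space of the sphere at \<open>Q\<close>; it is the L(Q) of the
  overview.\<close>

definition qmap :: "quat \<Rightarrow> real^3 \<Rightarrow> quat" where
  "qmap Q w = (snd Q \<bullet> w, - (fst Q *\<^sub>R w + cross3 (snd Q) w))"

text \<open>The adjoint of \<open>qmap Q\<close>, equal to minus the vector part of the product of
  the conjugate of \<open>Q\<close> with \<open>Y\<close>.\<close>

definition qadj :: "quat \<Rightarrow> quat \<Rightarrow> real^3" where
  "qadj Q Y = fst Y *\<^sub>R snd Q - fst Q *\<^sub>R snd Y + cross3 (snd Q) (snd Y)"

text \<open>For a unit quaternion this is the transposed rotation matrix applied to
  \<open>z\<close>. The formula is also used inside the unit ball, where it is no isometry and only
  the cruder bounds below are available.\<close>

definition qrot :: "quat \<Rightarrow> real^3 \<Rightarrow> real^3" where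
  "qrot Q z = z - (2 * fst Q) *\<^sub>R cross3 (snd Q) z + 2 *\<^sub>R cross3 (snd Q) (cross3 (snd Q) z)"

lemma inner_qmap: "Y \<bullet> qmap Q w = qadj Q Y \<bullet> w"
  by (cases Y; cases Q) (simp add: qmap_def qadj_def cross3_simps)

lemma norm_qmap: "norm (qmap Q w) = norm Q * norm w"
proof -
  have "(norm (qmap Q w))\<^sup>2 = (norm Q * norm w)\<^sup>2"
    unfolding power_mult_distrib power2_norm_eq_inner
    by (cases Q) (simp add: qmap_def cross3_simps)
  then show ?thesis by (simp add: power2_eq_iff_nonneg)
qed

lemma qadj_self [simp]: "qadj Q Q = 0"
  by (simp add: qadj_def)

lemma inner_qmap_self [simp]: "Q \<bullet> qmap Q w = 0"
  by (simp add: inner_qmap)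

text \<open>The quaternion norm is multiplicative, and the scalar part of the product of the
  conjugate of \<open>Q\<close> with \<open>Y\<close> is \<open>Q \<bullet> Y\<close>; what remains
  is the vector part.\<close>

lemma norm_qadj: "(norm (qadj Q Y))\<^sup>2 = (norm Q)\<^sup>2 * (norm Y)\<^sup>2 - (Q \<bullet> Y)\<^sup>2"
  unfolding power2_norm_eq_inner
  by (cases Q; cases Y) (simp add: qadj_def cross3_simps power2_eq_square)

lemma norm_qadj_le: "norm (qadj Q Y) \<le> norm Q * norm Y"
  by (rule power2_le_imp_le) (simp_all add: norm_qadj power_mult_distrib)

lemma qmap_diff: "qmap (P - Q) w = qmap P w - qmap Q w" "qmap P (w - w') = qmap P w - qmap P w'"
  by (simp_all add: qmap_def inner_diff_left inner_diff_right Cross3.left_diff_distrib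
      Cross3.right_diff_distrib algebra_simps)

lemma qadj_diff: "qadj (P - Q) Y = qadj P Y - qadj Q Y" "qadj P (Y - Y') = qadj P Y - qadj P Y'"
  by (simp_all add: qadj_def Cross3.left_diff_distrib Cross3.right_diff_distrib algebra_simps)

lemma qadj_scaleR: "qadj P (c *\<^sub>R Y) = c *\<^sub>R qadj P Y"
  by (simp add: qadj_def cross_mult_right algebra_simps)

lemma qrot_diff: "qrot Q (z - z') = qrot Q z - qrot Q z'"
  by (simp add: qrot_def Cross3.right_diff_distrib algebra_simps)

text \<open>With \<open>c = q \<times> z\<close> and \<open>d = q \<times> c\<close> the expansion
  leaves \<open>4 * (q0\<^sup>2 + q \<bullet> q - 1) * (c \<bullet> c)\<close> besides
  \<open>z \<bullet> z\<close>, and the bracket vanishes on the sphere.\<close>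

lemma norm_qrot:
  assumes "norm Q = 1" shows "norm (qrot Q z) = norm z"
proof -
  obtain q0 q where Q: "Q = (q0, q)" by (cases Q)
  have 1: "q0\<^sup>2 = 1 - q \<bullet> q"
    using assms by (simp add: Q norm_eq_1 power2_eq_square)
  define c where "c = cross3 q z"
  define d where "d = cross3 q c"
  have "q \<bullet> c = 0" by (simp add: c_def dot_cross_self)
  have zc: "z \<bullet> c = 0" "c \<bullet> z = 0" by (simp_all add: c_def dot_cross_self)
  have cd: "c \<bullet> d = 0" "d \<bullet> c = 0" by (simp_all add: d_def dot_cross_self)
  have zd: "z \<bullet> d = - (c \<bullet> c)" "d \<bullet> z = - (c \<bullet> c)"
    by (simp_all add: c_def d_def cross3_simps)
  have dd: "d \<bullet> d = (q \<bullet> q) * (c \<bullet> c)"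
    by (simp add: d_def dot_cross \<open>q \<bullet> c = 0\<close>)
  have "qrot Q z = z - (2 * q0) *\<^sub>R c + 2 *\<^sub>R d"
    by (simp add: qrot_def Q c_def d_def)
  then have "qrot Q z \<bullet> qrot Q z = z \<bullet> z + 4 * q0\<^sup>2 * (c \<bullet> c) + 4 * (d \<bullet> d) - 4 * (c \<bullet> c)"
    by (simp add: inner_add_left inner_add_right inner_diff_left inner_diff_right zc cd zd
        power2_eq_square)
  also have "\<dots> = z \<bullet> z" unfolding dd 1 by (simp add: algebra_simps)
  finally show ?thesis by (simp add: norm_eq_sqrt_inner)
qed

lemma norm_fst_snd_le: "\<bar>fst Q\<bar> \<le> norm Q" "norm (snd Q) \<le> norm Q" for Q :: "quat"
  using norm_fst_le[of "fst Q" "snd Q"] norm_snd_le[of "snd Q" "fst Q"] by simp_all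

lemma norm_qrot_le:
  assumes "norm Q \<le> 1" shows "norm (qrot Q z) \<le> 5 * norm z"
proof -
  note le = norm_fst_snd_le[of Q] assms
  have c: "norm (cross3 (snd Q) y) \<le> norm y" for y
    using norm_cross3_le[of "snd Q" y] mult_right_mono[of "norm (snd Q)" 1 "norm y"] le by simp
  have "\<bar>fst Q\<bar> * norm (cross3 (snd Q) z) \<le> 1 * norm z"
    using le c by (intro mult_mono) auto
  moreover have "norm (cross3 (snd Q) (cross3 (snd Q) z)) \<le> norm z"
    using c order_trans by blast
  moreover have "norm (qrot Q z) \<le> norm z + norm ((2 * fst Q) *\<^sub>R cross3 (snd Q) z)
      + norm (2 *\<^sub>R cross3 (snd Q) (cross3 (snd Q) z))"
    unfolding qrot_def by (meson norm_triangle_le norm_triangle_ineq4 add_right_mono order_trans)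
  ultimately show ?thesis by (simp add: abs_mult)
qed

text \<open>Telescoping the terms of \<open>qrot\<close> that depend on the quaternion gives four
  products, each at most \<open>norm (P - Q) * norm z\<close> on the unit ball and each with a
  factor 2.\<close>

lemma norm_qrot_diff_le:
  assumes "norm P \<le> 1" "norm Q \<le> 1"
  shows "norm (qrot P z - qrot Q z) \<le> 8 * norm (P - Q) * norm z"
proof -
  define d where "d = snd P - snd Q"
  define d0 where "d0 = fst P - fst Q"
  have le: "\<bar>fst P\<bar> \<le> 1" "norm (snd P) \<le> 1" "\<bar>fst Q\<bar> \<le> 1" "norm (snd Q) \<le> 1"
    using norm_fst_snd_le[of Q] norm_fst_snd_le[of P] assms by linarith+
  have d: "\<bar>d0\<bar> \<le> norm (P - Q)" "norm d \<le> norm (P - Q)"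
    using norm_fst_snd_le[of "P - Q"] by (simp_all add: d_def d0_def)
  let ?n = "norm (P - Q) * norm z"
  have mono3: "a * (b * c) \<le> norm (P - Q) * (1 * norm z)"
    if "0 \<le> a" "a \<le> norm (P - Q)" "0 \<le> b" "b \<le> 1" "0 \<le> c" "c \<le> norm z" for a b c :: real
    using that by (intro mult_mono) auto
  have c: "norm (cross3 x y) \<le> norm x * norm y" for x y by (rule norm_cross3_le)
  have 1: "norm (d0 *\<^sub>R cross3 (snd P) z) \<le> ?n"
    using mono3[of "\<bar>d0\<bar>" "norm (snd P)" "norm z"] mult_left_mono[OF c[of "snd P" z], of "\<bar>d0\<bar>"] d le by simp
  have 2: "norm (fst Q *\<^sub>R cross3 d z) \<le> ?n"
    using mono3[of "norm d" "\<bar>fst Q\<bar>" "norm z"] mult_left_mono[OF c[of d z], of "\<bar>fst Q\<bar>"] d le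
    by (simp add: mult.left_commute)
  have 3: "norm (cross3 d (cross3 (snd P) z)) \<le> ?n"
    using mono3[of "norm d" "norm (snd P)" "norm z"] c[of d "cross3 (snd P) z"]
      mult_left_mono[OF c[of "snd P" z], of "norm d"] d le by simp
  have 4: "norm (cross3 (snd Q) (cross3 d z)) \<le> ?n"
    using mono3[of "norm d" "norm (snd Q)" "norm z"] c[of "snd Q" "cross3 d z"]
      mult_left_mono[OF c[of d z], of "norm (snd Q)"] d le by (simp add: mult.left_commute)
  let ?x = "cross3 d (cross3 (snd P) z)" and ?y = "cross3 (snd Q) (cross3 d z)"
  let ?u = "d0 *\<^sub>R cross3 (snd P) z" and ?v = "fst Q *\<^sub>R cross3 d z"
  have "qrot P z - qrot Q z = 2 *\<^sub>R ((?x + ?y) - (?u + ?v))"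
    by (simp add: qrot_def d_def d0_def Cross3.left_diff_distrib Cross3.right_diff_distrib algebra_simps)
  then have "norm (qrot P z - qrot Q z) = 2 * norm ((?x + ?y) - (?u + ?v))"
    by simp
  then show ?thesis
    using 1 2 3 4 norm_triangle_ineq4[of "?x + ?y" "?u + ?v"]
      norm_triangle_ineq[of ?x ?y] norm_triangle_ineq[of ?u ?v] by linarith
qed

section \<open>The system in quaternion form and its Lipschitz bounds\<close>

locale attitude_system =
  fixes \<alpha>1 \<rho>1 \<rho>2 \<mu> :: real and e m :: "real^3"
  assumes pos: "\<alpha>1 > 0" "\<rho>1 > 0" "\<rho>2 > 0" "\<mu> > 0"
    and unit: "norm e = 1" "norm m = 1" and noncollinear: "\<not> collinear {0, e, m}"
begin

definition W :: "real^3 \<Rightarrow> real^3" where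
  "W x = W_rho \<rho>1 \<rho>2 e m *v x"

definition M :: "quat \<Rightarrow> quat" where
  "M Q = (0, W (snd Q))"

definition A :: "real^3 \<Rightarrow> real^3" where
  "A w = w + (\<mu> / \<rho>2 * (e \<bullet> w)) *\<^sub>R e"

definition drive :: "quat \<Rightarrow> real^3 \<Rightarrow> real^3" where
  "drive Q z = (\<rho>1 / 2) *\<^sub>R cross3 e (qrot Q z)"

text \<open>The positive semidefinite map L(Q) A L(Q)^T, whose kernel contains \<open>Q\<close>. The
  argument \<open>Y\<close> is kept apart from \<open>Q\<close> so that the base point and the
  argument can be varied separately in estimates.\<close>

definition K :: "quat \<Rightarrow> quat \<Rightarrow> quat" where
  "K Q Y = qmap Q (A (qadj Q Y))"

definition field :: "real^3 \<Rightarrow> quat \<Rightarrow> quat" where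
  "field z Q = qmap Q (drive Q z) - K Q (M Q)"

abbreviation "f \<equiv> vector_field \<alpha>1 \<rho>1 \<rho>2 \<mu> e m"
abbreviation "V \<equiv> V_fun \<alpha>1 \<rho>1 \<rho>2 e m"
text \<open>The largest eigenvalue of the symmetric map \<open>A\<close>, attained along
  \<open>e\<close>.\<close>

abbreviation "a \<equiv> 1 + \<mu> / \<rho>2"

lemma W_linear: "linear W"
  unfolding W_def by simp

lemma M_linear: "linear M"
  using W_linear by (auto simp: M_def linear_iff)

lemma W_selfadjoint: "W x \<bullet> y = x \<bullet> W y"
  unfolding W_def by (metis W_rho_symmetric dot_lmul_matrix transpose_matrix_vector)

lemma M_selfadjoint: "M x \<bullet> y = x \<bullet> M y"
  by (cases x; cases y) (simp add: M_def W_selfadjoint)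

lemma W_pos: "x \<noteq> 0 \<Longrightarrow> 0 < x \<bullet> W x"
  unfolding W_def by (rule W_rho_positive_definite) (use pos noncollinear in auto)

lemma norm_A_le: "norm (A w) \<le> a * norm w"
proof -
  have "norm (A w) \<le> norm w + \<mu> / \<rho>2 * \<bar>e \<bullet> w\<bar> * norm e"
    unfolding A_def using pos by (intro norm_triangle_le) (simp add: abs_mult)
  also have "\<bar>e \<bullet> w\<bar> \<le> norm w"
    using Cauchy_Schwarz_ineq2[of e w] unit by simp
  finally show ?thesis using pos unit by (simp add: algebra_simps divide_right_mono mult_left_mono)
qed

lemma inner_A_ge: "(norm w)\<^sup>2 \<le> w \<bullet> A w"
proof -
  have "w \<bullet> A w = (norm w)\<^sup>2 + \<mu> / \<rho>2 * (e \<bullet> w)\<^sup>2"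
    by (simp add: A_def inner_add_right power2_norm_eq_inner inner_commute[of w e])
      (simp add: power2_eq_square)
  then show ?thesis using pos by simp
qed

lemma A_diff: "A (w - w') = A w - A w'"
  by (simp add: A_def inner_diff_right algebra_simps diff_divide_distrib)

text \<open>The bridge between the matrix form of the equations and the quaternion maps.
  \<open>varpi\<close> equals minus \<open>qadj Q (M Q)\<close>, which produces the sign of the
  descent term in \<open>field\<close>.\<close>

lemma vector_field_eq: "f (z, Q) = (- (\<alpha>1 *\<^sub>R z), field z Q)"
proof -
  obtain q0 q where Q: "Q = (q0, q)" by (cases Q)
  have sc: "(c *\<^sub>R B) *v x = c *\<^sub>R (B *v x)" for c and B :: "real^3^3" and x
    by (simp add: scaleR_matrix_vector_assoc)
  have out: "outer e e *v x = (e \<bullet> x) *\<^sub>R e" for x :: "real^3"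
    by (simp add: vec_eq_iff outer_def matrix_vector_mult_def inner_vec_def sum_distrib_right sum_distrib_left mult_ac)
  define p where "p = qadj Q (M Q)"
  have vp: "varpi \<rho>1 \<rho>2 e m (q0, q) = - p"
    by (simp add: p_def qadj_def Q M_def W_def matrix_vector_mult_diff_rdistrib sc skew_vector_mult
        flip: matrix_vector_mul_assoc)
  have Am: "(mat 1 + (\<mu> / \<rho>2) *\<^sub>R outer e e) *v x = A x" for x
    by (simp add: A_def matrix_vector_mult_add_rdistrib sc out)
  have Bm: "(mat 1 - (2 * q0) *\<^sub>R skew q + 2 *\<^sub>R skew2 q) *v x = qrot Q x" for x
    by (simp add: qrot_def Q matrix_vector_mult_add_rdistrib matrix_vector_mult_diff_rdistrib sc
        skew_vector_mult flip: matrix_vector_mul_assoc)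
  have Tm: "(q0 *\<^sub>R mat 1 + skew q) *v x = q0 *\<^sub>R x + cross3 q x" for x
    by (simp add: matrix_vector_mult_add_rdistrib sc skew_vector_mult)
  have Aneg: "A (- p) = - A p" by (simp add: A_def)
  show ?thesis
    unfolding Q vector_field.simps Let_def vp matrix_vector_mul_assoc[symmetric] Am Bm Tm
      skew_vector_mult Aneg
    by (simp add: field_def K_def flip: p_def[unfolded Q])
      (simp add: qmap_def drive_def Q cross_mult_right algebra_simps)
qed

lemma V_eq: "V (z, Q) = \<rho>1\<^sup>2 / \<alpha>1 * (norm z)\<^sup>2 + 2 * (Q \<bullet> M Q)"
  by (cases Q) (simp add: M_def W_def)

lemma state_manifold_iff: "(z, Q) \<in> state_manifold \<longleftrightarrow> norm Q = 1"
  by (cases Q) (simp add: state_manifold_def norm_Pair real_sqrt_eq_1_iff)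

lemma norm_drive_le: "norm (drive Q z) \<le> \<rho>1 / 2 * norm (qrot Q z)"
  unfolding drive_def using norm_cross3_le[of e "qrot Q z"] unit pos by simp

lemma norm_K_le: "norm (K Q Y) \<le> a * (norm Q)\<^sup>2 * norm Y"
proof -
  have "norm (K Q Y) \<le> norm Q * (a * (norm Q * norm Y))"
    unfolding K_def norm_qmap using pos
    by (intro mult_left_mono order_trans[OF norm_A_le] norm_qadj_le) auto
  then show ?thesis by (simp add: power2_eq_square mult_ac)
qed

lemma K_diff: "K Q (Y - Y') = K Q Y - K Q Y'"
  by (simp add: K_def qadj_diff A_diff qmap_diff)

text \<open>\<open>Q\<close> occurs twice in \<open>K Q Y\<close>; changing one occurrence at a time
  costs \<open>a * norm (P - Q) * norm Y\<close> for each.\<close>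

lemma K_diff_le:
  assumes "norm P \<le> 1" "norm Q \<le> 1"
  shows "norm (K P Y - K Q Y) \<le> 2 * a * norm (P - Q) * norm Y"
proof -
  have a0: "0 \<le> a" using pos by simp
  have le: "norm (qmap P' (A (qadj Q' Y))) \<le> norm P' * (a * (norm Q' * norm Y))" for P' Q'
    unfolding norm_qmap using a0
    by (intro mult_left_mono order_trans[OF norm_A_le] norm_qadj_le) auto
  have "norm (qmap (P - Q) (A (qadj P Y))) \<le> a * norm (P - Q) * norm Y"
  proof (rule order_trans[OF le])
    have "norm P * (norm (P - Q) * (a * norm Y)) \<le> 1 * (norm (P - Q) * (a * norm Y))"
      using assms a0 by (intro mult_right_mono) auto
    then show "norm (P - Q) * (a * (norm P * norm Y)) \<le> a * norm (P - Q) * norm Y"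
      by (simp only: mult_ac mult_1)
  qed
  moreover have "norm (qmap Q (A (qadj (P - Q) Y))) \<le> a * norm (P - Q) * norm Y"
  proof (rule order_trans[OF le])
    have "norm Q * (norm (P - Q) * (a * norm Y)) \<le> 1 * (norm (P - Q) * (a * norm Y))"
      using assms a0 by (intro mult_right_mono) auto
    then show "norm Q * (a * (norm (P - Q) * norm Y)) \<le> a * norm (P - Q) * norm Y"
      by (simp only: mult_ac mult_1)
  qed
  moreover have "K P Y - K Q Y = qmap (P - Q) (A (qadj P Y)) + qmap Q (A (qadj (P - Q) Y))"
    by (simp add: K_def qmap_diff qadj_diff A_diff)
  ultimately have "norm (K P Y - K Q Y) \<le> a * norm (P - Q) * norm Y + a * norm (P - Q) * norm Y"
    by (simp only: norm_triangle_mono)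
  also have "\<dots> = 2 * a * norm (P - Q) * norm Y"
    by (simp only: mult_2 distrib_right)
  finally show ?thesis .
qed

text \<open>Changing the outer occurrence of the quaternion costs 5/2 and the inner one 8/2 times
  \<open>\<rho>1 * norm (P - Q) * norm z\<close>; the sum 13/2 is rounded up to 7.\<close>

lemma drive_diff_le:
  assumes "norm P \<le> 1" "norm Q \<le> 1"
  shows "norm (qmap P (drive P z) - qmap Q (drive Q z)) \<le> 7 * \<rho>1 * norm (P - Q) * norm z"
proof -
  have "norm (qmap (P - Q) (drive P z)) \<le> norm (P - Q) * (\<rho>1 / 2 * (5 * norm z))"
    unfolding norm_qmap using norm_qrot_le[OF assms(1), of z] pos
    by (intro mult_left_mono order_trans[OF norm_drive_le]) auto
  moreover have "norm (qmap Q (drive P z - drive Q z)) \<le> 1 * (\<rho>1 / 2 * (8 * norm (P - Q) * norm z))"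
    unfolding norm_qmap
  proof (rule mult_mono)
    have "drive P z - drive Q z = (\<rho>1 / 2) *\<^sub>R cross3 e (qrot P z - qrot Q z)"
      by (simp add: drive_def Cross3.right_diff_distrib algebra_simps)
    then have "norm (drive P z - drive Q z) \<le> \<rho>1 / 2 * norm (qrot P z - qrot Q z)"
      using norm_cross3_le[of e "qrot P z - qrot Q z"] unit pos by simp
    also have "\<dots> \<le> \<rho>1 / 2 * (8 * norm (P - Q) * norm z)"
      using norm_qrot_diff_le[OF assms] pos by (intro mult_left_mono) auto
    finally show "norm (drive P z - drive Q z) \<le> \<rho>1 / 2 * (8 * norm (P - Q) * norm z)" .
  qed (use assms in auto)
  moreover have "qmap P (drive P z) - qmap Q (drive Q z)
      = qmap (P - Q) (drive P z) + qmap Q (drive P z - drive Q z)"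
    by (simp add: qmap_diff)
  moreover have "0 \<le> \<rho>1 * (norm (P - Q) * norm z)" using pos by simp
  ultimately show ?thesis
    using norm_triangle_ineq[of "qmap (P - Q) (drive P z)" "qmap Q (drive P z - drive Q z)"]
    by (simp add: algebra_simps)
qed


lemma norm_M_le: "norm (M Q) \<le> onorm M * norm Q"
  by (rule onorm) (simp add: M_linear flip: linear_conv_bounded_linear)

lemma onorm_M_nonneg: "0 \<le> onorm M"
  by (rule onorm_pos_le) (simp add: M_linear flip: linear_conv_bounded_linear)

lemma M_diff: "M (P - Q) = M P - M Q"
  by (rule linear_diff[OF M_linear])

lemma a_pos: "0 < a"
  using pos by (simp add: add_pos_pos)

lemma inner_field_self [simp]: "Q \<bullet> field z Q = 0"
  by (simp add: field_def K_def inner_diff_right)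

lemma norm_qmap_drive_le:
  assumes "norm Q \<le> 1" shows "norm (qmap Q (drive Q z)) \<le> 3 * \<rho>1 * norm z"
proof -
  have "norm Q * norm (drive Q z) \<le> 1 * (\<rho>1 / 2 * (5 * norm z))"
    using assms norm_qrot_le[OF assms, of z] pos
    by (intro mult_mono order_trans[OF norm_drive_le] mult_left_mono) auto
  also have "\<dots> \<le> 3 * \<rho>1 * norm z" using pos by (simp add: mult_nonneg_nonneg)
  finally show ?thesis by (simp add: norm_qmap)
qed

lemma norm_K_le': "norm Q \<le> 1 \<Longrightarrow> norm (K Q Y) \<le> a * norm Y"
proof -
  assume "norm Q \<le> 1"
  then have "(norm Q)\<^sup>2 \<le> 1" by (simp add: power_le_one)
  then have "a * norm Y * (norm Q)\<^sup>2 \<le> a * norm Y * 1"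
    using a_pos by (intro mult_left_mono mult_nonneg_nonneg) auto
  then show ?thesis using norm_K_le[of Q Y] by (simp only: mult_ac mult_1)
qed

text \<open>The difference of the descent terms splits into \<open>K P (M (P - Q))\<close> and the
  change of base point applied to \<open>M Q\<close>. These contribute one and two multiples of
  \<open>a * onorm M\<close>.\<close>

lemma field_diff_le:
  assumes "norm P \<le> 1" "norm Q \<le> 1"
  shows "norm (field z P - field z Q) \<le> (7 * \<rho>1 * norm z + 3 * (a * onorm M)) * norm (P - Q)"
proof -
  let ?d = "norm (P - Q)"
  have 1: "norm (K P (M (P - Q))) \<le> a * onorm M * ?d"
    using order_trans[OF norm_K_le'[OF assms(1), of "M (P - Q)"] mult_left_mono[OF norm_M_le[of "P - Q"], of a]]
      a_pos by (simp only: mult.assoc less_imp_le)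
  have "norm (M Q) \<le> onorm M"
    using norm_M_le[of Q] mult_left_mono[OF assms(2) onorm_M_nonneg] by simp
  then have "2 * a * ?d * norm (M Q) \<le> 2 * a * ?d * onorm M"
    using a_pos by (intro mult_left_mono mult_nonneg_nonneg) auto
  then have 2: "norm (K P (M Q) - K Q (M Q)) \<le> 2 * (a * onorm M * ?d)"
    using K_diff_le[OF assms, of "M Q"] by (simp only: mult_ac)
  let ?X = "qmap P (drive P z) - qmap Q (drive Q z)" and ?Y = "K P (M (P - Q))"
    and ?Z = "K P (M Q) - K Q (M Q)"
  have eq: "field z P - field z Q = ?X - (?Y + ?Z)"
    by (simp add: field_def M_diff K_diff)
  have "norm (field z P - field z Q) \<le> norm ?X + (norm ?Y + norm ?Z)"
    unfolding eq using norm_triangle_ineq4[of ?X "?Y + ?Z"] norm_triangle_ineq[of ?Y ?Z] by linarith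
  also have "\<dots> \<le> 7 * \<rho>1 * ?d * norm z + (a * onorm M * ?d + 2 * (a * onorm M * ?d))"
    by (intro add_mono 1 2 drive_diff_le assms)
  finally show ?thesis by (simp add: algebra_simps)
qed

lemma field_diff_left_le:
  assumes "norm Q \<le> 1"
  shows "norm (field z Q - field z' Q) \<le> 3 * \<rho>1 * norm (z - z')"
proof -
  have "field z Q - field z' Q = qmap Q (drive Q (z - z'))"
    by (simp add: field_def drive_def qrot_diff qmap_diff Cross3.right_diff_distrib scaleR_diff_right)
  then show ?thesis using norm_qmap_drive_le[OF assms] by simp
qed

lemma norm_field_le:
  assumes "norm Q \<le> 1"
  shows "norm (field z Q) \<le> 3 * \<rho>1 * norm z + a * onorm M"
proof -
  have "norm (M Q) \<le> onorm M"
    using norm_M_le[of Q] mult_left_mono[OF assms onorm_M_nonneg] by simp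
  then have "a * norm (M Q) \<le> a * onorm M" using a_pos by (intro mult_left_mono) auto
  then have "norm (K Q (M Q)) \<le> a * onorm M"
    using norm_K_le'[OF assms, of "M Q"] by linarith
  then show ?thesis
    unfolding field_def using norm_qmap_drive_le[OF assms, of z]
      norm_triangle_ineq4[of "qmap Q (drive Q z)" "K Q (M Q)"] by linarith
qed

lemma continuous_on_M: "continuous_on S Q \<Longrightarrow> continuous_on S (\<lambda>t. M (Q t))"
  by (rule bounded_linear.continuous_on) (simp_all add: M_linear flip: linear_conv_bounded_linear)

lemma continuous_on_pf:
  fixes S :: "'a::t2_space set"
  shows "continuous_on S Q \<Longrightarrow> continuous_on S (\<lambda>t. qadj (Q t) (M (Q t)))"
  unfolding qadj_def by (intro continuous_intros continuous_on_M continuous_on_cross)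

lemma continuous_on_field:
  fixes S :: "'a::t2_space set"
  shows "continuous_on S z \<Longrightarrow> continuous_on S Q \<Longrightarrow> continuous_on S (\<lambda>t. field (z t) (Q t))"
  unfolding field_def K_def A_def drive_def qrot_def qmap_def
  by (intro continuous_intros continuous_on_pf continuous_on_cross)

end

text \<open>The nearest-point retraction to the ball is nonexpansive and only rescales. A vector
  orthogonal to the retracted point is therefore orthogonal to the point itself, which is what
  conserves the norm in the modified equation.\<close>

lemma closest_point_unit_cball:
  fixes x :: "'a::euclidean_space"
  shows "x = max 1 (norm x) *\<^sub>R closest_point (cball 0 1) x"
proof (cases "norm x \<le> 1")
  case True
  then show ?thesis by (simp add: closest_point_self)
next
  case False
  then have "x \<noteq> 0" by auto
  have cp: "x /\<^sub>R norm x = closest_point (cball 0 1) x"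
  proof (rule closest_point_unique)
    show "\<forall>z\<in>cball 0 1. dist x (x /\<^sub>R norm x) \<le> dist x z"
    proof
      fix z :: 'a assume "z \<in> cball 0 1"
      have "x - x /\<^sub>R norm x = (1 - 1 / norm x) *\<^sub>R x"
        by (simp add: algebra_simps divide_inverse)
      then have "dist x (x /\<^sub>R norm x) = norm ((1 - 1 / norm x) *\<^sub>R x)"
        by (simp only: dist_norm)
      also have "\<dots> = norm x - 1"
        unfolding norm_scaleR using False \<open>x \<noteq> 0\<close> by (simp add: abs_if field_simps)
      also have "\<dots> \<le> dist x z"
        using \<open>z \<in> cball 0 1\<close> norm_triangle_ineq2[of x z] by (simp add: dist_norm)
      finally show "dist x (x /\<^sub>R norm x) \<le> dist x z" .
    qed
  qed (use False in \<open>auto simp: field_simps\<close>)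
  then show ?thesis using False \<open>x \<noteq> 0\<close> by (simp add: max_def flip: cp)
qed

context attitude_system
begin

section \<open>Existence, uniqueness and dependence on the initial state\<close>

lemma trajectory_iff:
  "trajectory f state_manifold x \<longleftrightarrow> (\<forall>t\<ge>0. norm (snd (x t)) = 1 \<and>
     (x has_vector_derivative (- (\<alpha>1 *\<^sub>R fst (x t)), field (fst (x t)) (snd (x t)))) (at t within {0..}))"
  unfolding trajectory_def
  by (metis prod.collapse state_manifold_iff vector_field_eq)

lemma trajectoryD:
  assumes "trajectory f state_manifold x" "0 \<le> t"
  shows "norm (snd (x t)) = 1"
    and "((\<lambda>t. fst (x t)) has_vector_derivative - (\<alpha>1 *\<^sub>R fst (x t))) (at t within {0..})"
    and "((\<lambda>t. snd (x t)) has_vector_derivative field (fst (x t)) (snd (x t))) (at t within {0..})"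
    and "(x has_vector_derivative f (x t)) (at t within {0..})"
proof -
  have *: "norm (snd (x t)) = 1"
    "(x has_vector_derivative (- (\<alpha>1 *\<^sub>R fst (x t)), field (fst (x t)) (snd (x t)))) (at t within {0..})"
    using assms by (auto simp: trajectory_iff)
  show "norm (snd (x t)) = 1" by fact
  show "((\<lambda>t. fst (x t)) has_vector_derivative - (\<alpha>1 *\<^sub>R fst (x t))) (at t within {0..})"
    using bounded_linear.has_vector_derivative[OF bounded_linear_fst *(2)] by simp
  show "((\<lambda>t. snd (x t)) has_vector_derivative field (fst (x t)) (snd (x t))) (at t within {0..})"
    using bounded_linear.has_vector_derivative[OF bounded_linear_snd *(2)] by simp
  show "(x has_vector_derivative f (x t)) (at t within {0..})"
    using assms by (simp add: trajectory_def)
qed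

text \<open>Multiplication by the integrating factor \<open>exp (\<alpha>1 * t)\<close> gives a
  function with zero derivative.\<close>

lemma trajectory_fst:
  assumes "trajectory f state_manifold x" "0 \<le> t"
  shows "fst (x t) = exp (- \<alpha>1 * t) *\<^sub>R fst (x 0)"
proof -
  have "norm (exp (\<alpha>1 * t) *\<^sub>R fst (x t) - exp (\<alpha>1 * 0) *\<^sub>R fst (x 0)) \<le> 0 - (0::real)"
  proof (rule norm_increment_le[OF assms(2), where S = "{0..}"])
    fix s assume s: "s \<in> {0..t}"
    have e: "((\<lambda>t. exp (\<alpha>1 * t)) has_real_derivative \<alpha>1 * exp (\<alpha>1 * s)) (at s within {0..})"
      by (rule derivative_eq_intros refl | simp)+
    show "((\<lambda>t. exp (\<alpha>1 * t) *\<^sub>R fst (x t)) has_vector_derivative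
        exp (\<alpha>1 * s) *\<^sub>R (- (\<alpha>1 *\<^sub>R fst (x s))) + (\<alpha>1 * exp (\<alpha>1 * s)) *\<^sub>R fst (x s)) (at s within {0..})"
      by (rule has_vector_derivative_scaleR[OF e trajectoryD(2)[OF assms(1)]]) (use s in simp)
    show "((\<lambda>_. 0) has_real_derivative 0) (at s within {0..})" by simp
    show "norm (exp (\<alpha>1 * s) *\<^sub>R (- (\<alpha>1 *\<^sub>R fst (x s))) + (\<alpha>1 * exp (\<alpha>1 * s)) *\<^sub>R fst (x s)) \<le> 0"
      by (simp add: mult.commute)
  qed simp
  then have "exp (\<alpha>1 * t) *\<^sub>R fst (x t) = fst (x 0)" by simp
  then have "exp (- \<alpha>1 * t) *\<^sub>R (exp (\<alpha>1 * t) *\<^sub>R fst (x t)) = exp (- \<alpha>1 * t) *\<^sub>R fst (x 0)"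
    by simp
  then show ?thesis by (simp flip: exp_add)
qed

text \<open>The radial retraction of the quaternion to the unit ball makes the right-hand side bounded and
  globally Lipschitz. It keeps the right-hand side orthogonal to the quaternion, so the norm of the
  quaternion is still conserved and the retraction is the identity along the solution.\<close>

lemma trajectory_exists:
  assumes "norm Q0 = 1" "0 \<le> T"
  shows "\<exists>x. trajectory f state_manifold x \<and> fst (x 0) = z0 \<and> snd (x T) = Q0"
proof -
  \<comment> \<open>The first component is solved in closed form, so only a nonautonomous equation
    for the quaternion remains. This allows the mixed conditions: the first component at time 0, the
    quaternion at time \<open>T\<close>.\<close>
  define \<zeta> where "\<zeta> t = exp (- \<alpha>1 * t) *\<^sub>R z0" for t
  define r where "r = closest_point (cball (0::quat) 1)"
  have r: "norm (r Q) \<le> 1" for Q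
    using closest_point_in_set[of "cball (0::quat) 1" Q] by (simp add: r_def)
  have r_lip: "norm (r P - r Q) \<le> norm (P - Q)" for P Q
    using closest_point_lipschitz[of "cball (0::quat) 1" P Q] by (simp add: r_def dist_norm)
  have r_cont: "continuous_on S r" for S
    using continuous_on_closest_point[of "cball (0::quat) 1"] by (simp add: r_def)
  have \<zeta>: "norm (\<zeta> t) \<le> norm z0" if "0 \<le> t" for t
    using that pos mult_right_mono[of "exp (- (\<alpha>1 * t))" 1 "norm z0"] by (simp add: \<zeta>_def)
  have \<zeta>_cont: "continuous_on S \<zeta>" for S
    unfolding \<zeta>_def by (intro continuous_intros)
  define L where "L = 7 * \<rho>1 * norm z0 + 3 * (a * onorm M) + 1"
  have a0: "0 \<le> a * onorm M" using a_pos onorm_M_nonneg by simp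
  have "\<exists>Q. Q T = Q0 \<and> (\<forall>t\<ge>0. (Q has_vector_derivative field (\<zeta> t) (r (Q t))) (at t within {0..}))"
  proof (rule global_solution_exists)
    show "continuous_on ({0..} \<times> UNIV) (\<lambda>(t, Q). field (\<zeta> t) (r Q))"
      unfolding case_prod_unfold
      by (intro continuous_on_field continuous_on_compose2[OF \<zeta>_cont[of UNIV]]
          continuous_on_compose2[OF r_cont[of UNIV]] continuous_intros) auto
    show "norm (field (\<zeta> t) (r P) - field (\<zeta> t) (r Q)) \<le> L * norm (P - Q)" if "0 \<le> t" for t P Q
    proof -
      have "7 * \<rho>1 * norm (\<zeta> t) + 3 * (a * onorm M) \<le> L"
        using mult_left_mono[OF \<zeta>[OF that], of "7 * \<rho>1"] pos unfolding L_def by linarith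
      then have "(7 * \<rho>1 * norm (\<zeta> t) + 3 * (a * onorm M)) * norm (r P - r Q) \<le> L * norm (P - Q)"
        using r_lip pos a0 by (intro mult_mono) (auto simp: L_def)
      then show ?thesis using field_diff_le[OF r r] order_trans by blast
    qed
    show "norm (field (\<zeta> t) (r Q)) \<le> 3 * \<rho>1 * norm z0 + a * onorm M" if "0 \<le> t" for t Q
    proof -
      have "3 * \<rho>1 * norm (\<zeta> t) \<le> 3 * \<rho>1 * norm z0"
        using \<zeta>[OF that] pos by simp
      then show ?thesis using norm_field_le[OF r, of "\<zeta> t" Q] by linarith
    qed
    show "0 < L" using pos a0 by (simp add: L_def add_nonneg_pos)
  qed fact
  then obtain Q where Q: "Q T = Q0"
    "\<And>t. 0 \<le> t \<Longrightarrow> (Q has_vector_derivative field (\<zeta> t) (r (Q t))) (at t within {0..})"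
    by blast
  have orth: "Q t \<bullet> field (\<zeta> t) (r (Q t)) = 0" for t
  proof -
    have "Q t = max 1 (norm (Q t)) *\<^sub>R r (Q t)"
      unfolding r_def by (rule closest_point_unit_cball)
    then have "Q t \<bullet> field (\<zeta> t) (r (Q t)) = max 1 (norm (Q t)) * (r (Q t) \<bullet> field (\<zeta> t) (r (Q t)))"
      by (metis inner_scaleR_left)
    then show ?thesis by simp
  qed
  have const: "norm ((norm (Q t))\<^sup>2 - (norm (Q s))\<^sup>2) \<le> 0 - (0::real)" if "0 \<le> s" "s \<le> t" for s t
  proof (rule norm_increment_le[OF that(2), where S = "{0..}"])
    fix u assume u: "u \<in> {s..t}"
    have "((\<lambda>t. (norm (Q t))\<^sup>2) has_real_derivative 2 * (Q u \<bullet> field (\<zeta> u) (r (Q u)))) (at u within {0..})"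
      by (rule has_real_derivative_norm_power2[OF Q(2)]) (use u that in auto)
    then show "((\<lambda>t. (norm (Q t))\<^sup>2) has_vector_derivative 0) (at u within {0..})"
      by (simp add: orth has_real_derivative_iff_has_vector_derivative)
    show "((\<lambda>_. 0) has_real_derivative 0) (at u within {0..})" by simp
  qed (use that in auto)
  have unit: "norm (Q t) = 1" if "0 \<le> t" for t
  proof -
    have "(norm (Q t))\<^sup>2 = (norm (Q T))\<^sup>2"
      using const[of t T] const[of T t] that assms(2) by (cases "t \<le> T") auto
    then show ?thesis using assms(1) Q(1) by (simp add: power2_eq_1_iff) (smt (verit) norm_ge_zero)
  qed
  have "r (Q t) = Q t" if "0 \<le> t" for t
    unfolding r_def using unit[OF that] by (simp add: closest_point_self)
  then have Q': "(Q has_vector_derivative field (\<zeta> t) (Q t)) (at t within {0..})" if "0 \<le> t" for t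
    using Q(2)[OF that] that by simp
  have \<zeta>': "(\<zeta> has_vector_derivative - (\<alpha>1 *\<^sub>R \<zeta> t)) (at t within {0..})" for t
    unfolding \<zeta>_def by (rule derivative_eq_intros refl | simp)+
  define x where "x t = (\<zeta> t, Q t)" for t
  have "trajectory f state_manifold x"
    unfolding trajectory_iff x_def using has_vector_derivative_Pair[OF \<zeta>' Q'] unit by simp
  moreover have "fst (x 0) = z0" "snd (x T) = Q0"
    by (simp_all add: x_def \<zeta>_def Q(1))
  ultimately show ?thesis by blast
qed

definition lip :: "real \<Rightarrow> real" where
  "lip R = \<alpha>1 + 3 * \<rho>1 + 7 * \<rho>1 * R + 3 * (a * onorm M)"

text \<open>The quaternion is changed first, with the first component of \<open>x\<close> held
  fixed, which stays within \<open>R\<close> because it decays. The change of the first component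
  then enters linearly. Both time directions of the comparison are needed.\<close>

lemma trajectory_dist_le:
  assumes x: "trajectory f state_manifold x" and y: "trajectory f state_manifold y"
    and R: "norm (fst (x 0)) \<le> R" and "0 \<le> t"
  shows "norm (x t - y t) \<le> norm (x 0 - y 0) * exp (lip R * t)"
    and "norm (x 0 - y 0) \<le> norm (x t - y t) * exp (lip R * t)"
proof -
  have le: "norm (f (x s) - f (y s)) \<le> lip R * norm (x s - y s)" if "0 \<le> s" for s
  proof -
    obtain z Q z' Q' where xy: "x s = (z, Q)" "y s = (z', Q')" by (cases "x s", cases "y s")
    have Q: "norm Q \<le> 1" "norm Q' \<le> 1"
      using trajectoryD(1)[OF x that] trajectoryD(1)[OF y that] by (simp_all add: xy)
    have "norm z = exp (- \<alpha>1 * s) * norm (fst (x 0))"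
      using trajectory_fst[OF x that] by (simp add: xy)
    also have "\<dots> \<le> 1 * R"
      using R that pos by (intro mult_mono) auto
    finally have z: "norm z \<le> R" by simp
    let ?d = "norm (x s - y s)"
    have d: "norm (z - z') \<le> ?d" "norm (Q - Q') \<le> ?d"
      using norm_fst_le[of "z - z'" "Q - Q'"] norm_snd_le[of "Q - Q'" "z - z'"] by (simp_all add: xy)
    have c: "0 \<le> 7 * \<rho>1 * norm z + 3 * (a * onorm M)"
      using pos a_pos onorm_M_nonneg by (intro add_nonneg_nonneg mult_nonneg_nonneg) auto
    have "norm (f (x s) - f (y s)) \<le> norm (\<alpha>1 *\<^sub>R (z' - z)) + norm (field z Q - field z' Q')"
      unfolding xy vector_field_eq using norm_Pair_le by (simp add: scaleR_diff_right)
    also have "norm (field z Q - field z' Q') \<le> norm (field z Q - field z Q') + norm (field z Q' - field z' Q')"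
      using norm_triangle_ineq[of "field z Q - field z Q'" "field z Q' - field z' Q'"] by simp
    also have "norm (field z Q - field z Q') \<le> (7 * \<rho>1 * R + 3 * (a * onorm M)) * ?d"
    proof (rule order_trans[OF field_diff_le[OF Q] mult_mono])
      show le: "7 * \<rho>1 * norm z + 3 * (a * onorm M) \<le> 7 * \<rho>1 * R + 3 * (a * onorm M)"
        using mult_left_mono[OF z, of "7 * \<rho>1"] pos by (intro add_right_mono) simp
      show "0 \<le> 7 * \<rho>1 * R + 3 * (a * onorm M)" using le c by linarith
    qed (use d in auto)
    also have "norm (field z Q' - field z' Q') \<le> 3 * \<rho>1 * ?d"
      using d pos by (intro order_trans[OF field_diff_left_le[OF Q(2)]]) auto
    also have "norm (\<alpha>1 *\<^sub>R (z' - z)) \<le> \<alpha>1 * ?d"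
      using d pos by (simp add: norm_minus_commute)
    finally show ?thesis by (simp add: lip_def algebra_simps)
  qed
  show "norm (x t - y t) \<le> norm (x 0 - y 0) * exp (lip R * t)"
    "norm (x 0 - y 0) \<le> norm (x t - y t) * exp (lip R * t)"
    using solution_dist_le[of 0 t "{0..}" x "\<lambda>t. f (x t)" y "\<lambda>t. f (y t)" "lip R"] \<open>0 \<le> t\<close> le
      trajectoryD(4)[OF x] trajectoryD(4)[OF y] by auto
qed

lemma trajectory_unique:
  assumes "trajectory f state_manifold x" "trajectory f state_manifold y" "x 0 = y 0" "0 \<le> t"
  shows "x t = y t"
  using trajectory_dist_le(1)[OF assms(1,2) order_refl assms(4)] assms(3) by simp

section \<open>Dissipation of the Lyapunov function\<close>

definition \<psi> :: "state \<Rightarrow> real" where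
  "\<psi> \<xi> = \<rho>1\<^sup>2 * (norm (fst \<xi>))\<^sup>2 + (norm (qadj (snd \<xi>) (M (snd \<xi>))))\<^sup>2"

definition Vdot :: "state \<Rightarrow> real" where
  "Vdot \<xi> = - (2 * \<rho>1\<^sup>2 * (norm (fst \<xi>))\<^sup>2) + 4 * (field (fst \<xi>) (snd \<xi>) \<bullet> M (snd \<xi>))"

lemma \<psi>_nonneg: "0 \<le> \<psi> \<xi>"
  by (simp add: \<psi>_def)

lemma V_deriv:
  assumes "trajectory f state_manifold x" "0 \<le> t"
  shows "((\<lambda>t. V (x t)) has_real_derivative Vdot (x t)) (at t within {0..})"
proof -
  note D = trajectoryD[OF assms]
  have "((\<lambda>t. \<rho>1\<^sup>2 / \<alpha>1 * (norm (fst (x t)))\<^sup>2 + 2 * (snd (x t) \<bullet> M (snd (x t)))) has_real_derivative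
      \<rho>1\<^sup>2 / \<alpha>1 * (2 * (fst (x t) \<bullet> - (\<alpha>1 *\<^sub>R fst (x t))))
      + 2 * (2 * (field (fst (x t)) (snd (x t)) \<bullet> M (snd (x t))))) (at t within {0..})"
    by (intro DERIV_add DERIV_cmult has_real_derivative_norm_power2[OF D(2)]
        selfadjoint_form_has_real_derivative[OF M_linear M_selfadjoint D(3)])
  moreover have "(\<lambda>t. V (x t)) = (\<lambda>t. \<rho>1\<^sup>2 / \<alpha>1 * (norm (fst (x t)))\<^sup>2 + 2 * (snd (x t) \<bullet> M (snd (x t))))"
    by (metis V_eq prod.collapse)
  moreover have "\<rho>1\<^sup>2 / \<alpha>1 * (2 * (fst (x t) \<bullet> - (\<alpha>1 *\<^sub>R fst (x t))))
      + 2 * (2 * (field (fst (x t)) (snd (x t)) \<bullet> M (snd (x t)))) = Vdot (x t)"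
    using pos by (simp add: Vdot_def power2_norm_eq_inner)
  ultimately show ?thesis by simp
qed

text \<open>The weight of \<open>z\<close> in \<open>V\<close> makes it contribute
  \<open>- 2 * \<rho>1\<^sup>2 * (norm z)\<^sup>2\<close>. By Young's inequality the input costs
  half of this plus the squared length of \<open>p\<close>, while \<open>inner_A_ge\<close> supplies
  four times that squared length.\<close>

lemma Vdot_le:
  assumes "norm (snd \<xi>) = 1"
  shows "Vdot \<xi> \<le> - \<psi> \<xi>"
proof -
  obtain z Q where \<xi>: "\<xi> = (z, Q)" by (cases \<xi>)
  have Q: "norm Q = 1" using assms by (simp add: \<xi>)
  define p where "p = qadj Q (M Q)"
  have "M Q \<bullet> field z Q = p \<bullet> drive Q z - p \<bullet> A p"
    by (simp add: field_def K_def inner_diff_right inner_qmap p_def)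
  then have eq: "field z Q \<bullet> M Q = p \<bullet> drive Q z - p \<bullet> A p"
    by (simp only: inner_commute)
  have "norm (drive Q z) \<le> \<rho>1 / 2 * norm z"
    using norm_drive_le[of Q z] by (simp only: norm_qrot[OF Q])
  then have drive: "p \<bullet> drive Q z \<le> norm p * (\<rho>1 / 2 * norm z)"
    by (rule order_trans[OF norm_cauchy_schwarz mult_left_mono]) simp
  define U where "U = \<rho>1\<^sup>2 * (norm z)\<^sup>2"
  have "4 * (norm p * (\<rho>1 / 2 * norm z)) = 2 * (\<rho>1 * norm z) * norm p" by simp
  also have "\<dots> \<le> U + (norm p)\<^sup>2"
    using sum_squares_bound[of "\<rho>1 * norm z" "norm p"] by (simp only: U_def power_mult_distrib)
  finally have "4 * (p \<bullet> drive Q z) \<le> U + (norm p)\<^sup>2" using drive by linarith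
  then have "- (2 * U) + 4 * (p \<bullet> drive Q z - p \<bullet> A p) \<le> - (U + (norm p)\<^sup>2)"
    using inner_A_ge[of p] zero_le_power2[of "norm p"] unfolding right_diff_distrib by linarith
  then show ?thesis
    unfolding Vdot_def \<psi>_def \<xi> fst_conv snd_conv p_def[symmetric] eq mult.assoc U_def .
qed

definition speed :: real where
  "speed = (\<alpha>1 + \<rho>1 / 2) / \<rho>1 + a"

text \<open>Speed is controlled by the square root of the dissipation, so a Lojasiewicz inequality
  for \<open>V\<close> bounds the length of trajectories. The bound also shows that zeros of
  \<open>\<psi>\<close> on the manifold are equilibria.\<close>

lemma norm_f_le:
  assumes "norm (snd \<xi>) = 1"
  shows "norm (f \<xi>) \<le> speed * sqrt (\<psi> \<xi>)"
proof -
  obtain z Q where \<xi>: "\<xi> = (z, Q)" by (cases \<xi>)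
  have Q: "norm Q = 1" using assms by (simp add: \<xi>)
  define p where "p = qadj Q (M Q)"
  have "\<rho>1 * norm z \<le> sqrt (\<psi> \<xi>)" "norm p \<le> sqrt (\<psi> \<xi>)"
    using pos by (auto intro!: real_le_rsqrt simp: \<psi>_def \<xi> p_def power_mult_distrib)
  then have le: "norm z \<le> sqrt (\<psi> \<xi>) / \<rho>1" "norm p \<le> sqrt (\<psi> \<xi>)"
    using pos by (simp_all add: field_simps)
  have "norm (f \<xi>) \<le> norm (- (\<alpha>1 *\<^sub>R z)) + norm (field z Q)"
    unfolding \<xi> vector_field_eq by (rule norm_Pair_le)
  also have "norm (field z Q) \<le> norm (qmap Q (drive Q z)) + norm (K Q (M Q))"
    unfolding field_def by (rule norm_triangle_ineq4)
  also have "norm (qmap Q (drive Q z)) \<le> \<rho>1 / 2 * norm z"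
    using norm_drive_le[of Q z] by (simp add: norm_qmap Q norm_qrot[OF Q])
  also have "norm (K Q (M Q)) \<le> a * norm p"
    using norm_A_le[of p] by (simp add: K_def norm_qmap Q p_def)
  finally have "norm (f \<xi>) \<le> (\<alpha>1 + \<rho>1 / 2) * norm z + a * norm p"
    using pos by (simp add: algebra_simps)
  also have "\<dots> \<le> (\<alpha>1 + \<rho>1 / 2) * (sqrt (\<psi> \<xi>) / \<rho>1) + a * sqrt (\<psi> \<xi>)"
    using le pos a_pos by (intro add_mono mult_left_mono) auto
  finally show ?thesis by (simp add: speed_def algebra_simps)
qed

lemma V_antimono:
  assumes "trajectory f state_manifold x" "0 \<le> s" "s \<le> t"
  shows "V (x t) \<le> V (x s)"
proof -
  have "- V (x s) \<le> - V (x t)"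
  proof (rule deriv_nonneg_mono[OF assms(3), where S = "{0..}"])
    fix r assume r: "r \<in> {s..t}"
    then have "0 \<le> r" using assms(2) by simp
    show "((\<lambda>t. - V (x t)) has_real_derivative - Vdot (x r)) (at r within {0..})"
      by (intro DERIV_minus V_deriv[OF assms(1) \<open>0 \<le> r\<close>])
    show "0 \<le> - Vdot (x r)"
      using Vdot_le[OF trajectoryD(1)[OF assms(1) \<open>0 \<le> r\<close>]] \<psi>_nonneg[of "x r"] by linarith
  qed (use assms(2) in auto)
  then show ?thesis by simp
qed

end

section \<open>Convergence of trajectories\<close>

lemma exp_decay_tendsto_zero:
  assumes "0 < (k::real)"
  shows "((\<lambda>s. C * exp (- (k * (s - T)))) \<longlongrightarrow> 0) at_top"
proof -
  have "filterlim (\<lambda>s. k * (s - T)) at_top at_top"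
    using assms by (intro filterlim_tendsto_pos_mult_at_top[OF tendsto_const]
        filterlim_tendsto_add_at_top[of "\<lambda>_. - T", OF tendsto_const, simplified] filterlim_ident) auto
  then have "((\<lambda>s. exp (- (k * (s - T)))) \<longlongrightarrow> 0) at_top"
    by (intro filterlim_compose[OF exp_at_bot] filterlim_compose[OF filterlim_uminus_at_bot_at_top])
  then show ?thesis by (rule tendsto_mult_right_zero)
qed

text \<open>The sequence sampled at \<open>T + n\<close> is Cauchy; letting the later time tend to
  infinity along it turns the increment bound into a bound on the distance to the limit at every
  time.\<close>

lemma exponential_cauchy_convergent:
  fixes x :: "real \<Rightarrow> 'a::banach"
  assumes "0 < k" and bound: "\<And>s t. T \<le> s \<Longrightarrow> s \<le> t \<Longrightarrow> norm (x t - x s) \<le> C * exp (- (k * (s - T)))"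
  shows "\<exists>p. (x \<longlongrightarrow> p) at_top"
proof -
  define X where "X n = x (T + real n)" for n
  have lim0: "((\<lambda>s. C * exp (- (k * (s - T)))) \<longlongrightarrow> 0) at_top"
    by (rule exp_decay_tendsto_zero[OF assms(1)])
  have "Cauchy X"
  proof (rule CauchyI')
    fix \<epsilon> :: real assume "0 < \<epsilon>"
    then obtain N where N: "\<And>s. N \<le> s \<Longrightarrow> C * exp (- (k * (s - T))) < \<epsilon>"
      using order_tendstoD(2)[OF lim0] by (auto simp: eventually_at_top_linorder)
    obtain M :: nat where M: "N - T \<le> real M" using real_arch_simple by blast
    have "dist (X m) (X n) < \<epsilon>" if "M \<le> m" "m < n" for m n
      using bound[of "T + real m" "T + real n"] N[of "T + real m"] that M
      by (simp add: X_def dist_norm norm_minus_commute)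
    then show "\<exists>M. \<forall>m\<ge>M. \<forall>n>m. dist (X m) (X n) < \<epsilon>" by blast
  qed
  then obtain p where p: "X \<longlonglongrightarrow> p" using Cauchy_convergent convergent_def by blast
  have "norm (x s - p) \<le> C * exp (- (k * (s - T)))" if "T \<le> s" for s
  proof -
    have "(\<lambda>n. norm (X n - x s)) \<longlonglongrightarrow> norm (p - x s)" by (intro tendsto_intros p)
    moreover obtain N :: nat where "s - T \<le> real N" using real_arch_simple by blast
    then have "norm (X n - x s) \<le> C * exp (- (k * (s - T)))" if "N \<le> n" for n
      using bound[OF \<open>T \<le> s\<close>, of "T + real n"] that by (simp add: X_def)
    ultimately show ?thesis
      by (subst norm_minus_commute) (rule LIMSEQ_le_const2, auto)
  qed
  then have "((\<lambda>s. x s - p) \<longlongrightarrow> 0) at_top"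
    by (intro Lim_null_comparison[OF _ lim0]) (auto simp: eventually_at_top_linorder)
  then show ?thesis using LIM_zero_cancel by blast
qed

text \<open>AM-GM with a free weight, which is later made time-dependent.\<close>

lemma two_sqrt_le:
  assumes "0 < (b::real)" "0 \<le> y"
  shows "2 * sqrt y \<le> b * y + inverse b"
proof -
  have "0 \<le> (b * sqrt y - 1)\<^sup>2 / b" using assms(1) by simp
  also have "\<dots> = b * (sqrt y)\<^sup>2 - 2 * sqrt y + inverse b"
    using assms(1) by (simp add: power2_eq_square field_simps)
  finally show ?thesis using assms(2) by simp
qed

context attitude_system
begin

lemma inner_M_nonneg: "0 \<le> Q \<bullet> M Q"
proof -
  have "0 \<le> snd Q \<bullet> W (snd Q)"
    using W_pos[of "snd Q"] by (cases "snd Q = 0") auto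
  then show ?thesis by (cases Q) (simp add: M_def)
qed

lemma V_eq': "V \<xi> = \<rho>1\<^sup>2 / \<alpha>1 * (norm (fst \<xi>))\<^sup>2 + 2 * (snd \<xi> \<bullet> M (snd \<xi>))"
  by (metis V_eq prod.collapse)

lemma V_nonneg: "0 \<le> V \<xi>"
  using pos inner_M_nonneg by (simp add: V_eq')

lemma continuous_on_V: "continuous_on S V"
  unfolding V_eq'[abs_def] by (intro continuous_intros continuous_on_M)

lemma continuous_on_\<psi>: "continuous_on S \<psi>"
  unfolding \<psi>_def[abs_def] by (intro continuous_intros continuous_on_pf)

text \<open>Pythagoras: \<open>M Q - l *\<^sub>R Q\<close> has the component
  \<open>Q \<bullet> M Q - l\<close> along \<open>Q\<close> and a tangential part as long as
  \<open>qadj Q (M Q)\<close>.\<close>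

lemma norm_M_shift:
  assumes "norm Q = 1"
  shows "(norm (M Q - l *\<^sub>R Q))\<^sup>2 = (norm (qadj Q (M Q)))\<^sup>2 + (Q \<bullet> M Q - l)\<^sup>2"
proof -
  have "(norm (M Q - l *\<^sub>R Q))\<^sup>2 = (norm (M Q))\<^sup>2 - 2 * l * (Q \<bullet> M Q) + l\<^sup>2"
    using assms unfolding power2_norm_eq_inner
    by (simp add: inner_diff_left inner_diff_right inner_commute[of "M Q" Q] norm_eq_1 power2_eq_square
        algebra_simps)
  then show ?thesis
    using assms by (simp add: norm_qadj power2_diff)
qed

lemma shift_linear: "linear (\<lambda>Q. M Q - l *\<^sub>R Q)"
  by (intro linear_compose_sub M_linear) (simp add: linear_iff scaleR_add_right)

lemma shift_selfadjoint: "(M x - l *\<^sub>R x) \<bullet> y = x \<bullet> (M y - l *\<^sub>R y)"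
  by (simp add: inner_diff_left inner_diff_right M_selfadjoint)

text \<open>Let d be the excess \<open>Q \<bullet> M Q - l\<close> and y the tangential part of
  \<open>\<psi>\<close>. The gap of \<open>M - l\<close> gives
  \<open>g * d \<le> y + d\<^sup>2\<close>. Only positive d matters, and there
  \<open>2 * d \<le> g\<close> absorbs the square into half of the left side. The argument works at
  every real level, critical or not.\<close>

lemma V_gap:
  "\<exists>g>0. \<exists>c>0. \<forall>\<xi>. norm (snd \<xi>) = 1 \<longrightarrow> V \<xi> - 2 * l \<le> g \<longrightarrow> V \<xi> - 2 * l \<le> c * \<psi> \<xi>"
proof -
  obtain g where "g > 0"
    and g: "\<And>Q. g * \<bar>Q \<bullet> (M Q - l *\<^sub>R Q)\<bar> \<le> (norm (M Q - l *\<^sub>R Q))\<^sup>2"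
    using selfadjoint_gap[OF shift_linear shift_selfadjoint] by blast
  have "V \<xi> - 2 * l \<le> (1 / \<alpha>1 + 4 / g) * \<psi> \<xi>"
    if "norm (snd \<xi>) = 1" "V \<xi> - 2 * l \<le> g" for \<xi>
  proof -
    define z where "z = fst \<xi>"
    define Q where "Q = snd \<xi>"
    define d where "d = Q \<bullet> M Q - l"
    define y where "y = (norm (qadj Q (M Q)))\<^sup>2"
    have "norm Q = 1" using that(1) by (simp add: Q_def)
    have V: "V \<xi> - 2 * l = \<rho>1\<^sup>2 * (norm z)\<^sup>2 / \<alpha>1 + 2 * d"
      by (simp add: V_eq' z_def Q_def d_def)
    have \<psi>: "\<psi> \<xi> = \<rho>1\<^sup>2 * (norm z)\<^sup>2 + y"
      by (simp add: \<psi>_def z_def Q_def y_def)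
    have "y \<ge> 0" by (simp add: y_def)
    have zz: "0 \<le> \<rho>1\<^sup>2 * (norm z)\<^sup>2" by simp
    have "2 * d \<le> 4 / g * y"
    proof (cases "d \<le> 0")
      case True
      have "0 \<le> 4 / g * y" using \<open>y \<ge> 0\<close> \<open>g > 0\<close> by simp
      then show ?thesis using True by linarith
    next
      case False
      have "0 \<le> \<rho>1\<^sup>2 * (norm z)\<^sup>2 / \<alpha>1" using zz pos by simp
      then have "2 * d \<le> g" using that(2) V by linarith
      have "Q \<bullet> (M Q - l *\<^sub>R Q) = d"
        using \<open>norm Q = 1\<close> by (simp add: d_def inner_diff_right norm_eq_1)
      then have "g * d \<le> y + d\<^sup>2"
        using g[of Q] norm_M_shift[OF \<open>norm Q = 1\<close>, of l] False by (simp add: y_def d_def)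
      moreover have "d * (2 * d) \<le> d * g"
        using False \<open>2 * d \<le> g\<close> by (intro mult_left_mono) auto
      ultimately have "g * (2 * d) \<le> 4 * y"
        by (simp add: power2_eq_square algebra_simps)
      then show ?thesis using \<open>g > 0\<close> by (simp add: field_simps)
    qed
    moreover have "0 \<le> y / \<alpha>1" "0 \<le> 4 / g * (\<rho>1\<^sup>2 * (norm z)\<^sup>2)"
      using \<open>y \<ge> 0\<close> zz pos \<open>g > 0\<close> by (auto intro: divide_nonneg_pos mult_nonneg_nonneg)
    moreover have "(1 / \<alpha>1 + 4 / g) * \<psi> \<xi>
        = \<rho>1\<^sup>2 * (norm z)\<^sup>2 / \<alpha>1 + y / \<alpha>1 + 4 / g * (\<rho>1\<^sup>2 * (norm z)\<^sup>2) + 4 / g * y"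
      by (simp add: \<psi> distrib_left distrib_right)
    ultimately show ?thesis unfolding V by linarith
  qed
  moreover have "0 < 1 / \<alpha>1 + 4 / g" using pos \<open>g > 0\<close> by (simp add: add_pos_pos)
  ultimately show ?thesis using \<open>g > 0\<close> by blast
qed

lemma speed_pos: "0 < speed"
  using pos a_pos by (simp add: speed_def add_pos_pos)

text \<open>The inequality \<open>h \<le> c * \<psi>\<close> for \<open>h = V - 2 * l\<close> is of Lojasiewicz type with exponent 1/2. It makes
  \<open>h\<close> decay exponentially, and the weight \<open>exp ((t - T) / (2 * c))\<close> in AM-GM turns the decay of \<open>h\<close> into a
  bound on the length of the trajectory.\<close>

lemma trajectory_increment_le:
  assumes x: "trajectory f state_manifold x" and "0 \<le> T"
    and "0 < c" and gap: "\<And>\<xi>. norm (snd \<xi>) = 1 \<Longrightarrow> V \<xi> - 2 * l \<le> g \<Longrightarrow> V \<xi> - 2 * l \<le> c * \<psi> \<xi>"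
    and T: "V (x T) - 2 * l \<le> g" and level: "\<And>t. T \<le> t \<Longrightarrow> 2 * l \<le> V (x t)"
    and "0 < b" "T \<le> s" "s \<le> t"
  shows "norm (x t - x s) \<le> speed * (b * (V (x T) - 2 * l) + c / b) * exp (- ((1 / (2 * c)) * (s - T)))"
proof -
  define h where "h t = V (x t) - 2 * l" for t
  \<comment> \<open>Half the decay rate of \<open>h\<close>: both \<open>E * h\<close> and
    \<open>1 / E\<close> then decay like \<open>1 / E\<close>.\<close>
  define E where "E t = exp ((1 / (2 * c)) * (t - T))" for t
  have E: "0 < E t" for t by (simp add: E_def)
  have h': "(h has_real_derivative Vdot (x r)) (at r within {0..})" if "0 \<le> r" for r
    unfolding h_def by (rule derivative_eq_intros V_deriv[OF x that] refl | simp)+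
  have E': "(E has_real_derivative E r / (2 * c)) (at r within {0..})" for r
    unfolding E_def by (rule derivative_eq_intros refl | simp)+
  have h_le: "h r \<le> c * \<psi> (x r)" if "T \<le> r" for r
    unfolding h_def
    by (rule gap) (use trajectoryD(1)[OF x, of r] V_antimono[OF x \<open>0 \<le> T\<close> that] T that \<open>0 \<le> T\<close> in auto)
  have Vd: "Vdot (x r) \<le> - \<psi> (x r)" if "T \<le> r" for r
    using Vdot_le trajectoryD(1)[OF x, of r] that \<open>0 \<le> T\<close> by simp
  have decay: "h s \<le> h T * exp (- (1 / c) * (s - T))"
  proof (rule gronwall[where S = "{0..}" and h' = "\<lambda>r. Vdot (x r)"])
    fix r assume r: "r \<in> {T..s}"
    show "(h has_real_derivative Vdot (x r)) (at r within {0..})" using r \<open>0 \<le> T\<close> by (intro h') simp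
    show "Vdot (x r) \<le> - (1 / c) * h r"
    proof -
      have "c * Vdot (x r) \<le> c * - \<psi> (x r)"
        using Vd[of r] r \<open>0 < c\<close> by (intro mult_left_mono) auto
      then have "c * Vdot (x r) \<le> - h r" using h_le[of r] r by simp
      then show ?thesis using \<open>0 < c\<close> by (simp add: field_simps)
    qed
  qed (use \<open>T \<le> s\<close> \<open>0 \<le> T\<close> in auto)
  \<comment> \<open>The comparison function is built so that its derivative dominates the speed. The
    first term yields at least \<open>b * E * \<psi> / 2\<close>, since
    \<open>h \<le> c * \<psi>\<close>, and the second exactly \<open>1 / (2 * b * E)\<close>; by
    AM-GM their sum is at least \<open>sqrt \<psi>\<close>.\<close>
  have "norm (x t - x s) \<le> (- speed * (b * (E t * h t) + c / b * inverse (E t)))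
      - (- speed * (b * (E s * h s) + c / b * inverse (E s)))"
  proof (rule norm_increment_le[OF \<open>s \<le> t\<close>, where S = "{0..}"])
    fix r assume r: "r \<in> {s..t}"
    then have "0 \<le> r" "T \<le> r" using \<open>T \<le> s\<close> \<open>0 \<le> T\<close> by auto
    show "(x has_vector_derivative f (x r)) (at r within {0..})"
      by (rule trajectoryD(4)[OF x \<open>0 \<le> r\<close>])
    let ?d = "- speed * (b * (E r / (2 * c) * h r + Vdot (x r) * E r)
        + c / b * - (E r / (2 * c) * inverse ((E r)\<^sup>2)))"
    show "((\<lambda>t. - speed * (b * (E t * h t) + c / b * inverse (E t))) has_real_derivative ?d) (at r within {0..})"
    proof -
      have "E r \<noteq> 0" using E[of r] by simp
      have "((\<lambda>t. inverse (E t)) has_real_derivative - (E r / (2 * c) * inverse ((E r)\<^sup>2))) (at r within {0..})"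
        using DERIV_inverse_fun[OF E' \<open>E r \<noteq> 0\<close>] by (simp add: power2_eq_square)
      then show ?thesis
        by (intro DERIV_cmult DERIV_add DERIV_mult E' h'[OF \<open>0 \<le> r\<close>])
    qed
    have sq: "2 * sqrt (\<psi> (x r)) \<le> b * E r * \<psi> (x r) + inverse (b * E r)"
      using \<open>0 < b\<close> E \<psi>_nonneg by (intro two_sqrt_le) auto
    have "h r / (2 * c) \<le> \<psi> (x r) / 2"
      using h_le[OF \<open>T \<le> r\<close>] \<open>0 < c\<close> by (simp add: field_simps)
    then have "\<psi> (x r) / 2 \<le> - (h r / (2 * c)) - Vdot (x r)"
      using Vd[OF \<open>T \<le> r\<close>] by linarith
    then have "b * E r * (\<psi> (x r) / 2) \<le> b * E r * (- (h r / (2 * c)) - Vdot (x r))"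
      using \<open>0 < b\<close> E by (intro mult_left_mono) (auto intro: less_imp_le)
    with sq have "sqrt (\<psi> (x r)) \<le> b * E r * (- (h r / (2 * c)) - Vdot (x r)) + inverse (b * E r) / 2"
      by linarith
    then have "speed * sqrt (\<psi> (x r)) \<le> speed * (b * E r * (- (h r / (2 * c)) - Vdot (x r)) + inverse (b * E r) / 2)"
      using speed_pos by (intro mult_left_mono) auto
    also have "\<dots> = ?d"
    proof -
      have "c / b * (E r / (2 * c) * inverse ((E r)\<^sup>2)) = inverse (b * E r) / 2"
        using \<open>0 < b\<close> E[of r] \<open>0 < c\<close> by (simp add: field_simps power2_eq_square)
      moreover have "b * E r * (- (h r / (2 * c)) - Vdot (x r)) = - (b * (E r / (2 * c) * h r + Vdot (x r) * E r))"
        by (simp add: algebra_simps)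
      ultimately show ?thesis by (simp add: algebra_simps)
    qed
    finally show "norm (f (x r)) \<le> ?d"
      using norm_f_le[OF trajectoryD(1)[OF x \<open>0 \<le> r\<close>]] by linarith
  qed (use \<open>T \<le> s\<close> \<open>0 \<le> T\<close> in auto)
  also have "\<dots> \<le> speed * (b * (E s * h s) + c / b * inverse (E s))"
  proof -
    have "0 \<le> h t" using level[of t] \<open>T \<le> s\<close> \<open>s \<le> t\<close> by (simp add: h_def)
    then have "0 \<le> speed * (b * (E t * h t) + c / b * inverse (E t))"
      using \<open>0 < b\<close> \<open>0 < c\<close> E[of t] speed_pos
      by (intro mult_nonneg_nonneg add_nonneg_nonneg) auto
    then show ?thesis by linarith
  qed
  also have "\<dots> \<le> speed * (b * (h T * inverse (E s)) + c / b * inverse (E s))"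
  proof -
    have "- (1 / c) * (s - T) = - ((1 / (2 * c)) * (s - T)) + - ((1 / (2 * c)) * (s - T))"
      using \<open>0 < c\<close> by (simp add: field_simps)
    then have "exp (- (1 / c) * (s - T)) = inverse (E s) * inverse (E s)"
      by (simp only: E_def exp_minus exp_add)
    then have "E s * h s \<le> E s * (h T * (inverse (E s) * inverse (E s)))"
      using decay E[of s] by (intro mult_left_mono) auto
    also have "\<dots> = h T * inverse (E s)" using E[of s] by simp
    finally show ?thesis
      using \<open>0 < b\<close> speed_pos by (intro mult_left_mono add_right_mono) auto
  qed
  also have "\<dots> = speed * (b * h T + c / b) * inverse (E s)"
    by (simp add: algebra_simps)
  finally show ?thesis by (simp add: E_def h_def exp_minus)
qed

text \<open>Half the infimum of \<open>V\<close> along the trajectory is taken as the level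
  \<open>l\<close>. It need not be known in advance to be critical, and \<open>V\<close> eventually
  lies in the range where the gap inequality applies.\<close>

lemma trajectory_tendsto:
  assumes x: "trajectory f state_manifold x"
  shows "\<exists>p. (x \<longlongrightarrow> p) at_top"
proof -
  define B where "B = (\<lambda>t. V (x t)) ` {0..}"
  have bdd: "bdd_below B" unfolding B_def by (intro bdd_belowI[of _ 0]) (auto intro: V_nonneg)
  define l where "l = Inf B / 2"
  obtain g c where gc: "0 < g" "0 < c"
    "\<And>\<xi>. norm (snd \<xi>) = 1 \<Longrightarrow> V \<xi> - 2 * l \<le> g \<Longrightarrow> V \<xi> - 2 * l \<le> c * \<psi> \<xi>"
    using V_gap[of l] by blast
  have "\<exists>v\<in>B. v < Inf B + g"
    using gc(1) bdd by (subst cInf_less_iff[symmetric]) (auto simp: B_def)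
  then obtain T where T: "0 \<le> T" "V (x T) - 2 * l \<le> g"
    unfolding B_def l_def by auto
  have level: "2 * l \<le> V (x t)" if "T \<le> t" for t
    using cInf_lower[OF _ bdd, of "V (x t)"] that T(1) by (simp add: B_def l_def)
  show ?thesis
    by (rule exponential_cauchy_convergent[OF _ trajectory_increment_le[OF x T(1) gc(2,3) T(2) level zero_less_one]])
      (use gc(2) in auto)
qed

lemma V_limit_le:
  assumes x: "trajectory f state_manifold x" and "(x \<longlongrightarrow> p) at_top" "0 \<le> t"
  shows "V p \<le> V (x t)"
proof (rule tendsto_upperbound)
  show "((\<lambda>t. V (x t)) \<longlongrightarrow> V p) at_top"
    by (rule continuous_on_tendsto_compose[OF continuous_on_V[of UNIV] assms(2)]) auto
  show "\<forall>\<^sub>F s in at_top. V (x s) \<le> V (x t)"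
    unfolding eventually_at_top_linorder using V_antimono[OF x assms(3)] by blast
qed simp

lemma limit_in_manifold:
  assumes x: "trajectory f state_manifold x" and "(x \<longlongrightarrow> p) at_top"
  shows "norm (snd p) = 1"
proof -
  have "((\<lambda>t. norm (snd (x t))) \<longlongrightarrow> norm (snd p)) at_top" by (intro tendsto_intros assms)
  moreover have "((\<lambda>t. norm (snd (x t))) \<longlongrightarrow> 1) at_top"
    using trajectoryD(1)[OF x] by (intro tendsto_eventually) (auto simp: eventually_at_top_linorder)
  ultimately show ?thesis by (intro tendsto_unique[OF trivial_limit_at_top_linorder])
qed

text \<open>A positive limit of the dissipation would drive \<open>V\<close> below zero in finite
  time.\<close>

lemma limit_critical:
  assumes x: "trajectory f state_manifold x" and "(x \<longlongrightarrow> p) at_top"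
  shows "\<psi> p = 0"
proof (rule ccontr)
  assume "\<psi> p \<noteq> 0"
  define c where "c = \<psi> p / 2"
  have c: "0 < c" using \<open>\<psi> p \<noteq> 0\<close> \<psi>_nonneg[of p] by (simp add: c_def)
  have "((\<lambda>t. \<psi> (x t)) \<longlongrightarrow> \<psi> p) at_top"
    by (rule continuous_on_tendsto_compose[OF continuous_on_\<psi>[of UNIV] assms(2)]) auto
  then have "\<forall>\<^sub>F t in at_top. c < \<psi> (x t)"
    using c by (intro order_tendstoD(1)) (auto simp: c_def)
  then obtain T0 where T0: "\<And>t. T0 \<le> t \<Longrightarrow> c < \<psi> (x t)"
    by (auto simp: eventually_at_top_linorder)
  define T where "T = max 0 T0"
  \<comment> \<open>By this time a decrease at rate \<open>c\<close> would have brought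
    \<open>V\<close> down to -1.\<close>
  define t where "t = T + (V (x T) + 1) / c"
  have "T \<le> t" using c V_nonneg[of "x T"] by (simp add: t_def)
  have "- V (x T) - c * T \<le> - V (x t) - c * t"
  proof (rule deriv_nonneg_mono[OF \<open>T \<le> t\<close>, where S = "{0..}"])
    fix r assume "r \<in> {T..t}"
    then have r: "0 \<le> r" "T0 \<le> r" by (auto simp: T_def)
    show "((\<lambda>t. - V (x t) - c * t) has_real_derivative - Vdot (x r) - c) (at r within {0..})"
      by (rule derivative_eq_intros V_deriv[OF x r(1)] refl | simp)+
    show "0 \<le> - Vdot (x r) - c"
      using Vdot_le[OF trajectoryD(1)[OF x r(1)]] T0[OF r(2)] by linarith
  qed (auto simp: T_def)
  moreover have "c * t = c * T + (V (x T) + 1)"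
    using c by (simp add: t_def field_simps)
  ultimately show False using V_nonneg[of "x t"] by linarith
qed

text \<open>The threshold \<eta> is the same for all trajectories, which is what permits comparing a
  trajectory with its perturbation. At the limit the dissipation vanishes, so the gap inequality
  forces the limit level to be exactly \<open>2 * l\<close>.\<close>

lemma trajectory_captured:
  assumes "0 < \<epsilon>"
  shows "\<exists>\<eta>>0. \<forall>x T p t. trajectory f state_manifold x \<and> 0 \<le> T \<and> (x \<longlongrightarrow> p) at_top \<and> 2 * l \<le> V p
    \<and> V (x T) \<le> 2 * l + \<eta> \<and> T \<le> t \<longrightarrow> V p = 2 * l \<and> norm (x t - p) \<le> \<epsilon>"
proof -
  obtain g c where gc: "0 < g" "0 < c"
    "\<And>\<xi>. norm (snd \<xi>) = 1 \<Longrightarrow> V \<xi> - 2 * l \<le> g \<Longrightarrow> V \<xi> - 2 * l \<le> c * \<psi> \<xi>"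
    using V_gap[of l] by blast
  \<comment> \<open>The free weight is first taken large enough that
    \<open>speed * c / b = \<epsilon> / 2\<close>; \<eta> is then so small that the other term is at
    most \<epsilon> / 2.\<close>
  define b where "b = 2 * speed * c / \<epsilon>"
  have "0 < b" using speed_pos gc(2) assms by (simp add: b_def)
  define \<eta> where "\<eta> = min g (\<epsilon> / (2 * speed * b))"
  have "0 < \<eta>" using gc(1) assms speed_pos \<open>0 < b\<close> by (simp add: \<eta>_def)
  have "V p = 2 * l \<and> norm (x t - p) \<le> \<epsilon>"
    if x: "trajectory f state_manifold x" and "0 \<le> T" and p: "(x \<longlongrightarrow> p) at_top" "2 * l \<le> V p"
      and T: "V (x T) \<le> 2 * l + \<eta>" and "T \<le> t" for x T p t
  proof -
    define h where "h = V (x T) - 2 * l"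
    have level: "2 * l \<le> V (x t)" if "T \<le> t" for t
      using V_limit_le[OF x p(1), of t] p(2) that \<open>0 \<le> T\<close> by simp
    have "h \<le> \<eta>" using T by (simp add: h_def)
    then have Tg: "V (x T) - 2 * l \<le> g" by (simp add: h_def \<eta>_def)
    have "speed * b * h \<le> speed * b * (\<epsilon> / (2 * speed * b))"
      using \<open>h \<le> \<eta>\<close> speed_pos \<open>0 < b\<close> by (intro mult_left_mono) (auto simp: \<eta>_def)
    also have "\<dots> = \<epsilon> / 2" using speed_pos \<open>0 < b\<close> by simp
    finally have "speed * b * h \<le> \<epsilon> / 2" .
    moreover have "speed * (c / b) = \<epsilon> / 2"
      using speed_pos gc(2) assms by (simp add: b_def)
    ultimately have sum: "speed * (b * h + c / b) \<le> \<epsilon>"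
      unfolding distrib_left by (simp add: mult.assoc)
    have bd: "norm (x s - x t) \<le> \<epsilon>" if "t \<le> s" for s
    proof -
      have "0 \<le> speed * (b * h + c / b)"
        using speed_pos \<open>0 < b\<close> gc(2) level[of T] by (simp add: h_def)
      then have "speed * (b * h + c / b) * exp (- ((1 / (2 * c)) * (t - T))) \<le> speed * (b * h + c / b) * 1"
        using gc(2) \<open>T \<le> t\<close> by (intro mult_left_mono) auto
      then show ?thesis
        using trajectory_increment_le[OF x \<open>0 \<le> T\<close> gc(2,3) Tg level \<open>0 < b\<close> \<open>T \<le> t\<close> that] sum
        by (simp add: h_def)
    qed
    have "norm (p - x t) \<le> \<epsilon>"
    proof (rule tendsto_upperbound)
      show "((\<lambda>s. norm (x s - x t)) \<longlongrightarrow> norm (p - x t)) at_top" by (intro tendsto_intros p)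
      show "\<forall>\<^sub>F s in at_top. norm (x s - x t) \<le> \<epsilon>"
        unfolding eventually_at_top_linorder using bd by blast
    qed simp
    moreover have "V p - 2 * l \<le> c * \<psi> p"
      using gc(3)[of p] limit_in_manifold[OF x p(1)] V_limit_le[OF x p(1) \<open>0 \<le> T\<close>] Tg by simp
    then have "V p = 2 * l" using limit_critical[OF x p(1)] p(2) by simp
    ultimately show ?thesis by (simp add: norm_minus_commute)
  qed
  then show ?thesis using \<open>0 < \<eta>\<close> by blast
qed

section \<open>Critical points and equilibria\<close>

lemma eigenvector_W_iff: "eigenvector_of (W_rho \<rho>1 \<rho>2 e m) l v \<longleftrightarrow> v \<noteq> 0 \<and> W v = l *\<^sub>R v"
  by (simp add: eigenvector_of_def W_def)

lemma critical_eigenvector: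
  assumes "norm (snd \<xi>) = 1" "\<psi> \<xi> = 0"
  shows "fst \<xi> = 0" "M (snd \<xi>) = (snd \<xi> \<bullet> M (snd \<xi>)) *\<^sub>R snd \<xi>"
proof -
  have "\<rho>1\<^sup>2 * (norm (fst \<xi>))\<^sup>2 = 0 \<and> (norm (qadj (snd \<xi>) (M (snd \<xi>))))\<^sup>2 = 0"
    using assms(2) unfolding \<psi>_def by (subst (asm) add_nonneg_eq_0_iff) auto
  then have 0: "fst \<xi> = 0" "norm (qadj (snd \<xi>) (M (snd \<xi>))) = 0" using pos by auto
  show "fst \<xi> = 0" by (fact 0)
  show "M (snd \<xi>) = (snd \<xi> \<bullet> M (snd \<xi>)) *\<^sub>R snd \<xi>"
    using norm_M_shift[OF assms(1), of "snd \<xi> \<bullet> M (snd \<xi>)"] 0(2) by simp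
qed

text \<open>A critical quaternion is an eigenvector of \<open>M\<close>. If its vector part is
  nonzero, positivity of \<open>W\<close> makes the eigenvalue nonzero, and the zero block of
  \<open>M\<close> then kills the scalar part.\<close>

lemma critical_iff:
  assumes "norm (snd \<xi>) = 1"
  shows "\<psi> \<xi> = 0 \<longleftrightarrow> \<xi> \<in> Omega1 \<union> Omega2 \<rho>1 \<rho>2 e m"
proof
  assume \<psi>: "\<psi> \<xi> = 0"
  obtain z q0 q where \<xi>: "\<xi> = (z, q0, q)" by (cases \<xi>)
  define u where "u = snd \<xi> \<bullet> M (snd \<xi>)"
  have n: "q0\<^sup>2 + (norm q)\<^sup>2 = 1"
    using assms state_manifold_iff[of z "(q0, q)"] by (simp add: \<xi> state_manifold_def)
  have c: "z = 0" "u * q0 = 0" "W q = u *\<^sub>R q"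
    using critical_eigenvector[OF assms \<psi>] unfolding u_def[symmetric] by (auto simp: \<xi> M_def)
  show "\<xi> \<in> Omega1 \<union> Omega2 \<rho>1 \<rho>2 e m"
  proof (cases "q = 0")
    case True
    then have "q0 = 1 \<or> q0 = -1" using n by (simp add: power2_eq_1_iff)
    then show ?thesis using True c by (auto simp: \<xi> Omega1_def)
  next
    case False
    then have "u \<noteq> 0" using W_pos[OF False] c(3) by auto
    then have "q0 = 0" using c by simp
    then have "norm q = 1" using n by (smt (verit) norm_ge_zero power2_eq_1_iff power_zero_numeral)
    then show ?thesis using \<open>q0 = 0\<close> c False by (auto simp: \<xi> Omega2_def eigenvector_W_iff)
  qed
next
  assume "\<xi> \<in> Omega1 \<union> Omega2 \<rho>1 \<rho>2 e m"
  then show "\<psi> \<xi> = 0"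
  proof
    assume "\<xi> \<in> Omega1"
    then show ?thesis using linear_0[OF W_linear] by (auto simp: Omega1_def \<psi>_def M_def qadj_def)
  next
    assume "\<xi> \<in> Omega2 \<rho>1 \<rho>2 e m"
    then obtain v l where "\<xi> = (0, 0, v)" "W v = l *\<^sub>R v"
      by (auto simp: Omega2_def eigenvector_W_iff)
    then show ?thesis by (simp add: \<psi>_def M_def qadj_def cross_mult_right)
  qed
qed

lemma f_zero_iff:
  assumes "norm (snd \<xi>) = 1"
  shows "f \<xi> = 0 \<longleftrightarrow> \<psi> \<xi> = 0"
proof
  assume "\<psi> \<xi> = 0"
  then show "f \<xi> = 0" using norm_f_le[OF assms] by simp
next
  assume "f \<xi> = 0"
  obtain z Q where \<xi>: "\<xi> = (z, Q)" by (cases \<xi>)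
  have "\<alpha>1 *\<^sub>R z = 0" "field z Q = 0"
    using \<open>f \<xi> = 0\<close> unfolding \<xi> vector_field_eq zero_prod_def by simp_all
  then have "z = 0" using pos by simp
  have "drive Q 0 = 0" by (simp add: drive_def qrot_def)
  moreover have "qmap Q 0 = 0" by (simp add: qmap_def zero_prod_def)
  ultimately have "K Q (M Q) = 0"
    using \<open>field z Q = 0\<close> unfolding \<open>z = 0\<close> field_def by simp
  moreover have "norm (K Q (M Q)) = norm (A (qadj Q (M Q)))"
    using assms by (simp add: K_def norm_qmap \<xi>)
  ultimately have "A (qadj Q (M Q)) = 0" by simp
  then have "qadj Q (M Q) = 0" using inner_A_ge[of "qadj Q (M Q)"] by simp
  then show "\<psi> \<xi> = 0" using \<open>z = 0\<close> by (simp add: \<psi>_def \<xi>)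
qed

lemma equilibria_eq: "equilibria f state_manifold = Omega1 \<union> Omega2 \<rho>1 \<rho>2 e m"
proof -
  have "\<xi> \<in> state_manifold" if "\<xi> \<in> Omega1 \<union> Omega2 \<rho>1 \<rho>2 e m" for \<xi>
    using that by (auto simp: Omega1_def Omega2_def state_manifold_def)
  moreover have "\<xi> \<in> state_manifold \<longleftrightarrow> norm (snd \<xi>) = 1" for \<xi>
    by (metis prod.collapse state_manifold_iff)
  ultimately show ?thesis
    unfolding equilibria_def using f_zero_iff critical_iff by blast
qed

end

section \<open>Lowering the limit level by perturbation\<close>

context attitude_system
begin

text \<open>\<open>K Q\<close> annihilates \<open>Q\<close>, so any level can be subtracted at no
  cost; near the level \<open>l\<close> the argument becomes small.\<close>

lemma K_self_shift: "K Q (M Q) = K Q (M Q - l *\<^sub>R Q)"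
  by (simp add: K_def qadj_diff qadj_scaleR)

lemma norm_shift_le: "norm (M Q - l *\<^sub>R Q) \<le> (onorm M + \<bar>l\<bar>) * norm Q"
  using norm_triangle_ineq4[of "M Q" "l *\<^sub>R Q"] norm_M_le[of Q] by (simp add: distrib_right)

text \<open>Along two trajectories with the same first component that stay close to the level \<open>l\<close>, the
  quadratic form of \<open>M - (l - \<kappa>)\<close> at the difference of the quaternions satisfies a linear differential
  inequality. Once negative it therefore tends to minus infinity.\<close>

lemma cone_inequality:
  "\<exists>g>0. \<forall>\<kappa>>0. 2 * \<kappa> * a\<^sup>2 \<le> g \<longrightarrow> (\<exists>\<epsilon>>0. \<forall>P Q z. norm P = 1 \<longrightarrow> norm Q = 1 \<longrightarrow> norm z \<le> \<epsilon> \<longrightarrow>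
     norm (M P - l *\<^sub>R P) \<le> \<epsilon> \<longrightarrow> norm (M Q - l *\<^sub>R Q) \<le> \<epsilon> \<longrightarrow>
     2 * ((field z P - field z Q) \<bullet> (M (P - Q) - (l - \<kappa>) *\<^sub>R (P - Q)))
       \<le> 3 / 2 * g * ((P - Q) \<bullet> (M (P - Q) - (l - \<kappa>) *\<^sub>R (P - Q))))"
proof -
  obtain g where "g > 0"
    and g: "\<And>D. g * \<bar>D \<bullet> (M D - l *\<^sub>R D)\<bar> \<le> (norm (M D - l *\<^sub>R D))\<^sup>2"
    using selfadjoint_gap[OF shift_linear shift_selfadjoint] by blast
  define n where "n = onorm M + \<bar>l\<bar>"
  have "0 \<le> n" using onorm_M_nonneg by (simp add: n_def)
  define C where "C = 2 * a + 7 * \<rho>1"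
  have "0 < C" using a_pos pos by (simp add: C_def add_pos_pos)
  have "\<exists>\<epsilon>>0. \<forall>P Q z. norm P = 1 \<longrightarrow> norm Q = 1 \<longrightarrow> norm z \<le> \<epsilon> \<longrightarrow>
     norm (M P - l *\<^sub>R P) \<le> \<epsilon> \<longrightarrow> norm (M Q - l *\<^sub>R Q) \<le> \<epsilon> \<longrightarrow>
     2 * ((field z P - field z Q) \<bullet> (M (P - Q) - (l - \<kappa>) *\<^sub>R (P - Q)))
       \<le> 3 / 2 * g * ((P - Q) \<bullet> (M (P - Q) - (l - \<kappa>) *\<^sub>R (P - Q)))"
    if "0 < \<kappa>" and \<kappa>: "2 * \<kappa> * a\<^sup>2 \<le> g" for \<kappa>
  proof -
    \<comment> \<open>Collects the errors proportional to \<epsilon>: the 2 comes from the radial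
      part of \<open>N\<close>, the rest from the remainder \<open>R\<close>. The choice of
      \<epsilon> makes them at most half of \<open>g * \<kappa>\<close>.\<close>
    define B where "B = 2 + 2 * C * (n + \<kappa>)"
    have "0 < B" using \<open>0 < C\<close> \<open>0 \<le> n\<close> \<open>0 < \<kappa>\<close> by (simp add: B_def add_pos_nonneg)
    define \<epsilon> where "\<epsilon> = min 1 (g * \<kappa> / (2 * B))"
    have "0 < \<epsilon>" "\<epsilon> \<le> 1" using \<open>0 < g\<close> \<open>0 < \<kappa>\<close> \<open>0 < B\<close> by (simp_all add: \<epsilon>_def)
    have "\<epsilon> * B \<le> g * \<kappa> / (2 * B) * B" using \<open>0 < B\<close> by (intro mult_right_mono) (auto simp: \<epsilon>_def)
    then have \<epsilon>B: "\<epsilon> * B \<le> g * \<kappa> / 2" using \<open>0 < B\<close> by simp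
    have "2 * ((field z P - field z Q) \<bullet> (M (P - Q) - (l - \<kappa>) *\<^sub>R (P - Q)))
       \<le> 3 / 2 * g * ((P - Q) \<bullet> (M (P - Q) - (l - \<kappa>) *\<^sub>R (P - Q)))"
      if P: "norm P = 1" and Q: "norm Q = 1" and z: "norm z \<le> \<epsilon>"
        and NP: "norm (M P - l *\<^sub>R P) \<le> \<epsilon>" and NQ: "norm (M Q - l *\<^sub>R Q) \<le> \<epsilon>" for P Q z
    proof -
      define D where "D = P - Q"
      define d where "d = norm D"
      define N where "N = M D - l *\<^sub>R D"
      define y where "y = norm N"
      define R where "R = (K P (M Q - l *\<^sub>R Q) - K Q (M Q - l *\<^sub>R Q))
        - (qmap P (drive P z) - qmap Q (drive Q z))"
      have "0 \<le> d" by (simp add: d_def)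
      have N_eq: "M D - (l - \<kappa>) *\<^sub>R D = N + \<kappa> *\<^sub>R D" by (simp add: N_def algebra_simps)
      have eq: "M P - l *\<^sub>R P = N + (M Q - l *\<^sub>R Q)" by (simp add: N_def D_def M_diff algebra_simps)
      have "K P (M P) = K P (M P - l *\<^sub>R P)" by (rule K_self_shift)
      also have "\<dots> = K P (N - - (M Q - l *\<^sub>R Q))" by (simp only: eq diff_minus_eq_add)
      also have "\<dots> = K P N - K P (- (M Q - l *\<^sub>R Q))" by (rule K_diff)
      also have "K P (- (M Q - l *\<^sub>R Q)) = - K P (M Q - l *\<^sub>R Q)"
        using K_diff[of P 0 "M Q - l *\<^sub>R Q"] K_diff[of P 0 0] by simp
      finally have field_eq: "field z P - field z Q = - K P N - R"
        by (simp add: field_def K_self_shift[of Q l] R_def)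
      have R: "norm R \<le> C * \<epsilon> * d"
      proof -
        have "norm R \<le> norm (K P (M Q - l *\<^sub>R Q) - K Q (M Q - l *\<^sub>R Q))
            + norm (qmap P (drive P z) - qmap Q (drive Q z))"
          unfolding R_def by (rule norm_triangle_ineq4)
        also have "\<dots> \<le> 2 * a * norm (P - Q) * norm (M Q - l *\<^sub>R Q) + 7 * \<rho>1 * norm (P - Q) * norm z"
          by (intro add_mono K_diff_le drive_diff_le) (simp_all add: P Q)
        also have "\<dots> \<le> 2 * a * norm (P - Q) * \<epsilon> + 7 * \<rho>1 * norm (P - Q) * \<epsilon>"
          using NQ z a_pos pos by (intro add_mono mult_left_mono mult_nonneg_nonneg) auto
        also have "\<dots> = C * \<epsilon> * d" by (simp add: C_def d_def D_def algebra_simps)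
        finally show ?thesis .
      qed
      have y_le: "y \<le> n * d" unfolding y_def N_def n_def d_def by (rule norm_shift_le)
      \<comment> \<open>\<open>K P\<close> loses only the radial part \<open>P \<bullet> N\<close>.
        By self-adjointness this is the product of \<open>M P - l *\<^sub>R P\<close> with
        \<open>D\<close>, small because \<open>P\<close> is near the level.\<close>
      have T1: "y\<^sup>2 - \<epsilon>\<^sup>2 * d\<^sup>2 \<le> N \<bullet> K P N"
      proof -
        have "P \<bullet> N = (M P - l *\<^sub>R P) \<bullet> D" by (simp add: N_def shift_selfadjoint)
        then have "\<bar>P \<bullet> N\<bar> \<le> norm (M P - l *\<^sub>R P) * norm D" by (simp add: Cauchy_Schwarz_ineq2)
        also have "\<dots> \<le> \<epsilon> * d" using NP by (simp add: d_def mult_right_mono)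
        finally have "(P \<bullet> N)\<^sup>2 \<le> (\<epsilon> * d)\<^sup>2" using power_mono[of "\<bar>P \<bullet> N\<bar>" "\<epsilon> * d" 2] by simp
        moreover have "(norm (qadj P N))\<^sup>2 = y\<^sup>2 - (P \<bullet> N)\<^sup>2"
          using P by (simp add: norm_qadj y_def)
        moreover have "(norm (qadj P N))\<^sup>2 \<le> N \<bullet> K P N"
          unfolding K_def inner_qmap by (rule inner_A_ge)
        ultimately show ?thesis by (simp add: power_mult_distrib)
      qed
      \<comment> \<open>The cross term caused by the shift has no sign. Young's inequality takes a
        quarter of \<open>y\<^sup>2\<close> from the main term and leaves what the smallness of
        \<kappa> covers.\<close>
      have T2: "\<bar>\<kappa> * (D \<bullet> K P N)\<bar> \<le> y\<^sup>2 / 4 + (\<kappa> * a * d)\<^sup>2"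
      proof -
        have "\<bar>D \<bullet> K P N\<bar> \<le> d * (a * y)"
          unfolding d_def y_def using norm_K_le'[of P N] P
          by (intro order_trans[OF Cauchy_Schwarz_ineq2] mult_left_mono) auto
        then have "\<kappa> * \<bar>D \<bullet> K P N\<bar> \<le> \<kappa> * (d * (a * y))"
          using \<open>0 < \<kappa>\<close> by (intro mult_left_mono) auto
        moreover have "2 * (y / 2) * (\<kappa> * a * d) \<le> (y / 2)\<^sup>2 + (\<kappa> * a * d)\<^sup>2"
          by (rule sum_squares_bound)
        moreover have "2 * (y / 2) * (\<kappa> * a * d) = \<kappa> * (d * (a * y))" by (simp only: mult_ac) simp
        moreover have "(y / 2)\<^sup>2 = y\<^sup>2 / 4" by (simp add: power2_eq_square)
        moreover have "\<bar>\<kappa> * (D \<bullet> K P N)\<bar> = \<kappa> * \<bar>D \<bullet> K P N\<bar>" using \<open>0 < \<kappa>\<close> by (simp add: abs_mult)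
        ultimately show ?thesis by linarith
      qed
      have T3: "\<bar>R \<bullet> (N + \<kappa> *\<^sub>R D)\<bar> \<le> C * \<epsilon> * (n + \<kappa>) * d\<^sup>2"
      proof -
        have "norm (N + \<kappa> *\<^sub>R D) \<le> (n + \<kappa>) * d"
          using norm_triangle_ineq[of N "\<kappa> *\<^sub>R D"] y_le \<open>0 < \<kappa>\<close>
          by (simp add: y_def d_def distrib_right)
        then have "\<bar>R \<bullet> (N + \<kappa> *\<^sub>R D)\<bar> \<le> (C * \<epsilon> * d) * ((n + \<kappa>) * d)"
          using R \<open>0 < C\<close> \<open>0 < \<epsilon>\<close> \<open>0 \<le> d\<close>
          by (intro order_trans[OF Cauchy_Schwarz_ineq2] mult_mono) auto
        then show ?thesis by (simp add: power2_eq_square mult_ac)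
      qed
      have gap: "- (y\<^sup>2) \<le> g * (D \<bullet> N)"
        using g[of D] \<open>0 < g\<close> abs_ge_minus_self[of "g * (D \<bullet> N)"]
        by (simp add: N_def y_def abs_mult)
      have \<kappa>': "2 * (\<kappa> * a * d)\<^sup>2 \<le> g * \<kappa> * d\<^sup>2"
      proof -
        have "2 * (\<kappa> * a * d)\<^sup>2 = (2 * \<kappa> * a\<^sup>2) * (\<kappa> * d\<^sup>2)"
          by (simp only: power_mult_distrib power2_eq_square mult_ac)
        also have "\<dots> \<le> g * (\<kappa> * d\<^sup>2)" using \<kappa> \<open>0 < \<kappa>\<close> by (intro mult_right_mono) auto
        finally show ?thesis by (simp only: mult.assoc)
      qed
      have \<epsilon>': "2 * \<epsilon>\<^sup>2 * d\<^sup>2 + 2 * (C * \<epsilon> * (n + \<kappa>) * d\<^sup>2) \<le> g * \<kappa> * d\<^sup>2 / 2"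
      proof -
        have "\<epsilon>\<^sup>2 \<le> \<epsilon> * 1"
          unfolding power2_eq_square using \<open>0 < \<epsilon>\<close> \<open>\<epsilon> \<le> 1\<close> by (intro mult_left_mono) auto
        then have "2 * \<epsilon>\<^sup>2 + 2 * (C * \<epsilon> * (n + \<kappa>)) \<le> \<epsilon> * B" by (simp add: B_def algebra_simps)
        then have "(2 * \<epsilon>\<^sup>2 + 2 * (C * \<epsilon> * (n + \<kappa>))) * d\<^sup>2 \<le> (g * \<kappa> / 2) * d\<^sup>2"
          using \<epsilon>B by (intro mult_right_mono) auto
        then show ?thesis by (simp add: algebra_simps)
      qed
      have "(field z P - field z Q) \<bullet> (N + \<kappa> *\<^sub>R D)
          = - (N \<bullet> K P N) - \<kappa> * (D \<bullet> K P N) - R \<bullet> (N + \<kappa> *\<^sub>R D)"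
        unfolding field_eq inner_diff_left
        by (simp add: inner_add_right inner_commute[of "K P N"])
      \<comment> \<open>Of \<open>- 2 * y\<^sup>2\<close> there remains
        \<open>- 3 / 2 * y\<^sup>2\<close> after the cross term. The other errors sum to at most
        \<open>g * \<kappa> * d\<^sup>2\<close> and half of it again, hence 3/2 on both
        parts.\<close>
      then have "2 * ((field z P - field z Q) \<bullet> (N + \<kappa> *\<^sub>R D))
          \<le> 3 / 2 * (- (y\<^sup>2)) + 3 / 2 * (g * \<kappa> * d\<^sup>2)"
        using T1 T2 T3 \<kappa>' \<epsilon>' by linarith
      also have "\<dots> \<le> 3 / 2 * (g * (D \<bullet> N)) + 3 / 2 * (g * \<kappa> * d\<^sup>2)"
        using gap by simp
      also have "\<dots> = 3 / 2 * g * (D \<bullet> (N + \<kappa> *\<^sub>R D))"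
        by (simp add: inner_add_right d_def power2_norm_eq_inner algebra_simps)
      finally show ?thesis by (simp add: N_eq flip: D_def)
    qed
    then show ?thesis using \<open>0 < \<epsilon>\<close> by blast
  qed
  then show ?thesis using \<open>0 < g\<close> by blast
qed

text \<open>Reflecting \<open>P\<close> along \<open>(1, 0) - r *\<^sub>R P\<close> with \<open>r\<close> close to the scalar part of \<open>P\<close> moves it on the
  sphere by a small step whose direction lies in the cone where the quadratic form is negative.\<close>

lemma cone_perturbation:
  assumes P: "norm P = 1" and "0 < l" "0 < \<kappa>" "\<kappa> \<le> l / 4"
    and NP: "norm (M P - l *\<^sub>R P) \<le> l / 8" and "0 < \<delta>"
  shows "\<exists>Q. norm Q = 1 \<and> norm (P - Q) < \<delta> \<and> (P - Q) \<bullet> (M (P - Q) - (l - \<kappa>) *\<^sub>R (P - Q)) < 0"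
proof -
  define i where "i = (1::real, 0 :: real^3)"
  define F where "F D = D \<bullet> (M D - (l - \<kappa>) *\<^sub>R D)" for D
  define q where "q = fst P"
  define n where "n r = i - r *\<^sub>R P" for r
  have iP: "i \<bullet> P = q" by (cases P) (simp add: i_def q_def)
  have "\<bar>q\<bar> \<le> 1" using norm_fst_snd_le(1)[of P] P by (simp add: q_def)
  have Mi: "M i = 0" by (simp add: M_def i_def linear_0[OF W_linear] zero_prod_def)
  have PP: "P \<bullet> P = 1" using P by (simp add: norm_eq_1)
  have ii: "i \<bullet> i = 1" by (simp add: i_def)
  \<comment> \<open>For \<open>r = q\<close> the vector is the tangential part of the scalar axis at
    \<open>P\<close>, the limiting direction of the perturbation.\<close>
  have "F (n q) < 0"
  proof -
    define N where "N = M P - l *\<^sub>R P"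
    have MP: "M P = N + l *\<^sub>R P" by (simp add: N_def)
    have iN: "\<bar>i \<bullet> N\<bar> \<le> l / 8" "\<bar>P \<bullet> N\<bar> \<le> l / 8"
      using Cauchy_Schwarz_ineq2[of i N] Cauchy_Schwarz_ineq2[of P N] NP P
      by (simp_all add: N_def norm_eq_sqrt_inner[of i] ii)
    have "M (n q) = - (q *\<^sub>R M P)"
      by (simp add: n_def M_diff Mi linear_scale[OF M_linear])
    then have "F (n q) = - (q * (i \<bullet> M P)) + q\<^sup>2 * (P \<bullet> M P) - (l - \<kappa>) * (1 - q\<^sup>2)"
      by (simp add: F_def n_def inner_diff_left inner_diff_right iP inner_commute[of P i] PP ii
          power2_eq_square algebra_simps)
    \<comment> \<open>\<open>M\<close> vanishes on the scalar axis, so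
      \<open>i \<bullet> N = - l * q\<close> and the terms with \<open>l * q\<^sup>2\<close> can be
      written through \<open>N\<close>. All terms but \<open>- l\<close> are small, and the total is
      at most \<open>- 3 * l / 8\<close>.\<close>
    also have "\<dots> = - 2 * (q * (i \<bullet> N)) + q\<^sup>2 * (P \<bullet> N) - l + \<kappa> * (1 - q\<^sup>2)"
    proof -
      have iMP: "i \<bullet> M P = 0" using M_selfadjoint[of i P] by (simp add: Mi)
      then have "i \<bullet> N = - l * q" by (simp add: N_def inner_diff_right iP)
      moreover have "P \<bullet> M P = P \<bullet> N + l" by (simp add: MP inner_add_right PP)
      ultimately show ?thesis by (simp add: iMP power2_eq_square algebra_simps)
    qed
    also have "\<dots> \<le> 2 * (l / 8) + l / 8 - l + l / 4"
    proof -
      have "\<bar>q * (i \<bullet> N)\<bar> \<le> 1 * (l / 8)" unfolding abs_mult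
        using \<open>\<bar>q\<bar> \<le> 1\<close> iN by (intro mult_mono) auto
      moreover have "q\<^sup>2 \<le> 1" using \<open>\<bar>q\<bar> \<le> 1\<close> by (simp add: abs_square_le_1)
      then have "\<bar>q\<^sup>2 * (P \<bullet> N)\<bar> \<le> 1 * (l / 8)" unfolding abs_mult
        using iN by (intro mult_mono) auto
      moreover have "\<kappa> * (1 - q\<^sup>2) \<le> (l / 4) * 1"
        using \<open>q\<^sup>2 \<le> 1\<close> \<open>\<kappa> \<le> l / 4\<close> \<open>0 < \<kappa>\<close> by (intro mult_mono) auto
      ultimately show ?thesis by linarith
    qed
    also have "\<dots> < 0" using \<open>0 < l\<close> by simp
    finally show ?thesis .
  qed
  then have "n q \<noteq> 0" by (auto simp: F_def)
  define Q where "Q r = P - (2 * (P \<bullet> n r) / (n r \<bullet> n r)) *\<^sub>R n r" for r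
  have n_cont: "isCont n q" unfolding n_def by (intro continuous_intros)
  have "isCont (\<lambda>r. M (n r)) q"
    by (rule bounded_linear.isCont[OF _ n_cont]) (simp add: M_linear flip: linear_conv_bounded_linear)
  then have "isCont (\<lambda>r. F (n r)) q" unfolding F_def by (intro continuous_intros n_cont)
  then have ev1: "\<forall>\<^sub>F r in at q. F (n r) < 0"
    using \<open>F (n q) < 0\<close> order_tendstoD(2) unfolding isCont_def by blast
  have "isCont (\<lambda>r. norm (P - Q r)) q"
    unfolding Q_def using \<open>n q \<noteq> 0\<close> by (intro continuous_intros n_cont) auto
  moreover have "P \<bullet> n q = 0"
    by (simp add: n_def inner_diff_right PP inner_commute[of P i] iP)
  then have "norm (P - Q q) = 0" by (simp add: Q_def)
  ultimately have ev2: "\<forall>\<^sub>F r in at q. norm (P - Q r) < \<delta>"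
    using \<open>0 < \<delta>\<close> order_tendstoD(2)[of "\<lambda>r. norm (P - Q r)" 0 "at q" \<delta>] unfolding isCont_def by simp
  \<comment> \<open>At \<open>r = q\<close> the vector is orthogonal to \<open>P\<close> and the
    reflection fixes \<open>P\<close>; a nonzero displacement needs \<open>r\<close> different from
    \<open>q\<close>.\<close>
  have ev3: "\<forall>\<^sub>F r in at q. r \<noteq> q" by (simp add: eventually_at_filter)
  obtain r where r: "F (n r) < 0" "norm (P - Q r) < \<delta>" "r \<noteq> q"
    using eventually_happens[OF eventually_conj[OF ev1 eventually_conj[OF ev2 ev3]]] by auto
  have nn: "n r \<bullet> n r \<noteq> 0" using r(1) by (auto simp: F_def)
  have "Q r \<bullet> Q r = 1"
    using nn by (simp add: Q_def inner_diff_left inner_diff_right PP inner_commute[of "n r" P]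
        power2_eq_square field_simps)
  then have "norm (Q r) = 1" by (simp add: norm_eq_1)
  moreover have "F (P - Q r) < 0"
  proof -
    define c where "c = 2 * (P \<bullet> n r) / (n r \<bullet> n r)"
    have "P \<bullet> n r = q - r" by (simp add: n_def inner_diff_right PP inner_commute[of P i] iP)
    then have "c \<noteq> 0" using r(3) nn by (simp add: c_def)
    have "F (P - Q r) = F (c *\<^sub>R n r)" by (simp add: Q_def c_def)
    also have "\<dots> = c\<^sup>2 * F (n r)"
      by (simp add: F_def linear_scale[OF M_linear] inner_diff_right power2_eq_square algebra_simps)
    finally show ?thesis using \<open>c \<noteq> 0\<close> r(1) by (simp add: mult_pos_neg)
  qed
  ultimately show ?thesis using r(2) unfolding F_def by blast
qed

lemma limit_eigen:
  assumes x: "trajectory f state_manifold x" and p: "(x \<longlongrightarrow> p) at_top"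
  shows "fst p = 0" "M (snd p) = (V p / 2) *\<^sub>R snd p"
proof -
  note c = critical_eigenvector[OF limit_in_manifold[OF x p] limit_critical[OF x p]]
  show "fst p = 0" by (rule c(1))
  then show "M (snd p) = (V p / 2) *\<^sub>R snd p"
    using c(2) by (simp add: V_eq')
qed

text \<open>A negative value of the form at time \<open>T\<close> would tend to minus infinity at an
  exponential rate, although two points of the unit sphere keep the form bounded.\<close>

lemma cone_excludes_level:
  assumes x: "trajectory f state_manifold x" and y: "trajectory f state_manifold y"
    and same: "fst (x 0) = fst (y 0)" and "0 \<le> T" and "0 < g"
    and ineq: "\<And>P Q z. norm P = 1 \<Longrightarrow> norm Q = 1 \<Longrightarrow> norm z \<le> \<epsilon> \<Longrightarrow>
      norm (M P - l *\<^sub>R P) \<le> \<epsilon> \<Longrightarrow> norm (M Q - l *\<^sub>R Q) \<le> \<epsilon> \<Longrightarrow>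
      2 * ((field z P - field z Q) \<bullet> (M (P - Q) - k *\<^sub>R (P - Q)))
        \<le> g * ((P - Q) \<bullet> (M (P - Q) - k *\<^sub>R (P - Q)))"
    and x\<epsilon>: "\<And>t. T \<le> t \<Longrightarrow> norm (fst (x t)) \<le> \<epsilon> \<and> norm (M (snd (x t)) - l *\<^sub>R snd (x t)) \<le> \<epsilon>"
    and y\<epsilon>: "\<And>t. T \<le> t \<Longrightarrow> norm (M (snd (y t)) - l *\<^sub>R snd (y t)) \<le> \<epsilon>"
  shows "0 \<le> (snd (x T) - snd (y T)) \<bullet> (M (snd (x T) - snd (y T)) - k *\<^sub>R (snd (x T) - snd (y T)))"
proof (rule ccontr)
  define D where "D t = snd (x t) - snd (y t)" for t
  define F where "F t = D t \<bullet> (M (D t) - k *\<^sub>R D t)" for t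
  assume "\<not> ?thesis"
  then have "F T < 0" by (simp add: F_def D_def)
  define n where "n = onorm M + \<bar>k\<bar>"
  have "0 \<le> n" using onorm_M_nonneg by (simp add: n_def)
  have bound: "- (4 * n) \<le> F t" if "T \<le> t" for t
  proof -
    have t: "0 \<le> t" using that \<open>0 \<le> T\<close> by simp
    have D2: "norm (D t) \<le> 2"
      using norm_triangle_ineq4[of "snd (x t)" "snd (y t)"] trajectoryD(1)[OF x t] trajectoryD(1)[OF y t]
      by (simp add: D_def)
    have "\<bar>F t\<bar> \<le> norm (D t) * (n * norm (D t))"
      unfolding F_def n_def
      by (intro order_trans[OF Cauchy_Schwarz_ineq2] mult_left_mono norm_shift_le) auto
    also have "\<dots> \<le> 2 * (n * 2)"
      using D2 \<open>0 \<le> n\<close> by (intro mult_mono) auto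
    finally show ?thesis by simp
  qed
  \<comment> \<open>The bound \<open>1 + u \<le> exp u\<close> suffices: at this time it gives
    \<open>F t \<le> F T - 4 * n\<close>, strictly below the lower bound.\<close>
  define t where "t = T + 4 * n / (g * - F T)"
  have "T \<le> t" using \<open>0 \<le> n\<close> \<open>0 < g\<close> \<open>F T < 0\<close> by (simp add: t_def divide_nonneg_neg mult_pos_neg)
  have "F t \<le> F T * exp (g * (t - T))"
  proof (rule gronwall[OF \<open>T \<le> t\<close>, where S = "{0..}"])
    fix r assume "r \<in> {T..t}"
    then have r: "0 \<le> r" "T \<le> r" using \<open>0 \<le> T\<close> by auto
    have z: "fst (y r) = fst (x r)"
      using trajectory_fst[OF x r(1)] trajectory_fst[OF y r(1)] same by simp
    have D': "(D has_vector_derivative field (fst (x r)) (snd (x r)) - field (fst (x r)) (snd (y r))) (at r within {0..})"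
      unfolding D_def
      using has_vector_derivative_diff[OF trajectoryD(3)[OF x r(1)] trajectoryD(3)[OF y r(1)]] by (simp add: z)
    show "(F has_real_derivative 2 * ((field (fst (x r)) (snd (x r)) - field (fst (x r)) (snd (y r)))
        \<bullet> (M (D r) - k *\<^sub>R D r))) (at r within {0..})"
      unfolding F_def by (rule selfadjoint_form_has_real_derivative[OF shift_linear shift_selfadjoint D'])
    show "2 * ((field (fst (x r)) (snd (x r)) - field (fst (x r)) (snd (y r))) \<bullet> (M (D r) - k *\<^sub>R D r)) \<le> g * F r"
      unfolding F_def D_def
      using x\<epsilon>[OF r(2)] y\<epsilon>[OF r(2)] trajectoryD(1)[OF x r(1)] trajectoryD(1)[OF y r(1)]
      by (intro ineq) auto
  qed (use \<open>0 \<le> T\<close> in auto)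
  also have "\<dots> \<le> F T * (1 + g * (t - T))"
    using \<open>F T < 0\<close> by (intro mult_left_mono_neg) auto
  also have "g * (t - T) = 4 * n / - F T"
    using \<open>0 < g\<close> \<open>F T < 0\<close> by (simp add: t_def)
  also have "F T * (1 + 4 * n / - F T) = F T - 4 * n"
    using \<open>F T < 0\<close> by (simp add: field_simps)
  finally show False using bound[OF \<open>T \<le> t\<close>] \<open>F T < 0\<close> by linarith
qed

text \<open>The perturbation is made at a late time \<open>T\<close> inside the cone and below the
  capture threshold. Were the new limit level not lower, the new trajectory would be captured at the
  level of \<open>p\<close> as well, and both would stay where the cone inequality holds.\<close>

lemma limit_level_lowered:
  assumes x: "trajectory f state_manifold x" and p: "(x \<longlongrightarrow> p) at_top" and "0 < V p" "0 < \<delta>"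
  shows "\<exists>y q. trajectory f state_manifold y \<and> norm (y 0 - x 0) < \<delta> \<and> (y \<longlongrightarrow> q) at_top \<and> V q < V p"
proof -
  define l where "l = V p / 2"
  have "0 < l" using assms(3) by (simp add: l_def)
  obtain g where "0 < g" and g: "\<And>\<kappa>. 0 < \<kappa> \<Longrightarrow> 2 * \<kappa> * a\<^sup>2 \<le> g \<Longrightarrow> \<exists>\<epsilon>>0. \<forall>P Q z. norm P = 1 \<longrightarrow> norm Q = 1 \<longrightarrow>
     norm z \<le> \<epsilon> \<longrightarrow> norm (M P - l *\<^sub>R P) \<le> \<epsilon> \<longrightarrow> norm (M Q - l *\<^sub>R Q) \<le> \<epsilon> \<longrightarrow>
     2 * ((field z P - field z Q) \<bullet> (M (P - Q) - (l - \<kappa>) *\<^sub>R (P - Q)))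
       \<le> 3 / 2 * g * ((P - Q) \<bullet> (M (P - Q) - (l - \<kappa>) *\<^sub>R (P - Q)))"
    using cone_inequality[of l] by blast
  define \<kappa> where "\<kappa> = min (g / (2 * a\<^sup>2)) (l / 4)"
  have "0 < \<kappa>" "\<kappa> \<le> l / 4" using \<open>0 < g\<close> \<open>0 < l\<close> a_pos by (simp_all add: \<kappa>_def)
  have "\<kappa> * (2 * a\<^sup>2) \<le> g / (2 * a\<^sup>2) * (2 * a\<^sup>2)" by (intro mult_right_mono) (auto simp: \<kappa>_def)
  then have "2 * \<kappa> * a\<^sup>2 \<le> g" using a_pos by (simp add: mult_ac)
  then obtain \<epsilon>1 where "0 < \<epsilon>1" and ineq: "\<And>P Q z. norm P = 1 \<Longrightarrow> norm Q = 1 \<Longrightarrow>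
     norm z \<le> \<epsilon>1 \<Longrightarrow> norm (M P - l *\<^sub>R P) \<le> \<epsilon>1 \<Longrightarrow> norm (M Q - l *\<^sub>R Q) \<le> \<epsilon>1 \<Longrightarrow>
     2 * ((field z P - field z Q) \<bullet> (M (P - Q) - (l - \<kappa>) *\<^sub>R (P - Q)))
       \<le> 3 / 2 * g * ((P - Q) \<bullet> (M (P - Q) - (l - \<kappa>) *\<^sub>R (P - Q)))"
    using g[OF \<open>0 < \<kappa>\<close>] by blast
  define \<epsilon> where "\<epsilon> = min \<epsilon>1 (l / 8)"
  have "0 < \<epsilon>" using \<open>0 < \<epsilon>1\<close> \<open>0 < l\<close> by (simp add: \<epsilon>_def)
  \<comment> \<open>The limit is an eigenvector for \<open>l\<close>, so distance
    \<open>\<epsilon> / n\<close> to it bounds both the first component and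
    \<open>M Q - l *\<^sub>R Q\<close> by \<epsilon>.\<close>
  define n where "n = 1 + onorm M + \<bar>l\<bar>"
  have "1 \<le> n" using onorm_M_nonneg by (simp add: n_def)
  then have "0 < \<epsilon> / n" using \<open>0 < \<epsilon>\<close> by simp
  then obtain \<eta> where "0 < \<eta>"
    and capture: "\<And>x T p t. trajectory f state_manifold x \<Longrightarrow> 0 \<le> T \<Longrightarrow> (x \<longlongrightarrow> p) at_top \<Longrightarrow> 2 * l \<le> V p \<Longrightarrow>
      V (x T) \<le> 2 * l + \<eta> \<Longrightarrow> T \<le> t \<Longrightarrow> V p = 2 * l \<and> norm (x t - p) \<le> \<epsilon> / n"
    using trajectory_captured[of "\<epsilon> / n" l] by blast
  have close: "norm (fst (x t)) \<le> \<epsilon> \<and> norm (M (snd (x t)) - l *\<^sub>R snd (x t)) \<le> \<epsilon>"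
    if x: "trajectory f state_manifold x" and "0 \<le> T" and p: "(x \<longlongrightarrow> p) at_top" and "2 * l \<le> V p"
      and "V (x T) \<le> 2 * l + \<eta>" and "T \<le> t" for x T p t
  proof -
    have c: "V p = 2 * l" "norm (x t - p) \<le> \<epsilon> / n"
      using capture[OF that] by auto
    have "\<epsilon> / n \<le> \<epsilon>" using \<open>1 \<le> n\<close> \<open>0 < \<epsilon>\<close> by (simp add: field_simps)
    have d: "norm (fst (x t) - fst p) \<le> norm (x t - p)" "norm (snd (x t) - snd p) \<le> norm (x t - p)"
      using norm_fst_le[of "fst (x t - p)" "snd (x t - p)"] norm_snd_le[of "snd (x t - p)" "fst (x t - p)"]
      unfolding prod.collapse by (simp_all only: fst_diff snd_diff)
    have "M (snd (x t)) - l *\<^sub>R snd (x t) = M (snd (x t) - snd p) - l *\<^sub>R (snd (x t) - snd p)"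
      using limit_eigen(2)[OF x p] c(1) by (simp add: M_diff algebra_simps)
    also have "norm \<dots> \<le> (onorm M + \<bar>l\<bar>) * norm (snd (x t) - snd p)" by (rule norm_shift_le)
    also have "\<dots> \<le> n * (\<epsilon> / n)"
      using d(2) c(2) onorm_M_nonneg by (intro mult_mono) (auto simp: n_def)
    also have "\<dots> = \<epsilon>" using \<open>1 \<le> n\<close> by simp
    finally show ?thesis
      using d(1) c(2) \<open>\<epsilon> / n \<le> \<epsilon>\<close> limit_eigen(1)[OF x p] by simp
  qed
  have "((\<lambda>t. V (x t)) \<longlongrightarrow> V p) at_top"
    by (rule continuous_on_tendsto_compose[OF continuous_on_V[of UNIV] p]) auto
  then have "\<forall>\<^sub>F t in at_top. V (x t) < 2 * l + \<eta>"
    using \<open>0 < \<eta>\<close> by (intro order_tendstoD(2)) (auto simp: l_def)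
  then obtain T0 where T0: "\<And>t. T0 \<le> t \<Longrightarrow> V (x t) < 2 * l + \<eta>"
    by (auto simp: eventually_at_top_linorder)
  define T where "T = max 0 T0"
  have "0 \<le> T" and VT: "V (x T) < 2 * l + \<eta>" using T0[of T] by (auto simp: T_def)
  have x\<epsilon>: "norm (fst (x t)) \<le> \<epsilon> \<and> norm (M (snd (x t)) - l *\<^sub>R snd (x t)) \<le> \<epsilon>" if "T \<le> t" for t
    using VT that by (intro close[OF x \<open>0 \<le> T\<close> p]) (auto simp: l_def)
  have "isCont (\<lambda>Q. V (fst (x T), Q)) (snd (x T))"
  proof -
    have "continuous_on UNIV (\<lambda>Q. V (fst (x T), Q))"
      by (rule continuous_on_compose2[OF continuous_on_V[of UNIV]]) (auto intro!: continuous_intros)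
    then show ?thesis using continuous_on_eq_continuous_at[OF open_UNIV] by blast
  qed
  then have "((\<lambda>Q. V (fst (x T), Q)) \<longlongrightarrow> V (fst (x T), snd (x T))) (nhds (snd (x T)))"
    using tendsto_at_iff_tendsto_nhds[of "\<lambda>Q. V (fst (x T), Q)" "snd (x T)"] unfolding isCont_def by blast
  then have "\<forall>\<^sub>F Q in nhds (snd (x T)). V (fst (x T), Q) < 2 * l + \<eta>"
    by (rule order_tendstoD(2)) (use VT in \<open>simp only: prod.collapse\<close>)
  then obtain \<delta>1 where "0 < \<delta>1"
    and \<delta>1: "\<And>Q. dist Q (snd (x T)) < \<delta>1 \<Longrightarrow> V (fst (x T), Q) < 2 * l + \<eta>"
    unfolding eventually_nhds_metric by blast
  define R where "R = norm (fst (x 0))"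
  \<comment> \<open>The first bound keeps \<open>V\<close> below the capture threshold at time
    \<open>T\<close>; the second compensates the growth of distances on the way back to time
    0.\<close>
  define \<delta>2 where "\<delta>2 = min \<delta>1 (\<delta> / exp (lip R * T))"
  have "0 < \<delta>2" using \<open>0 < \<delta>1\<close> \<open>0 < \<delta>\<close> by (simp add: \<delta>2_def)
  have nx: "norm (snd (x T)) = 1" by (rule trajectoryD(1)[OF x \<open>0 \<le> T\<close>])
  have "norm (M (snd (x T)) - l *\<^sub>R snd (x T)) \<le> l / 8"
    using x\<epsilon>[of T] by (simp add: \<epsilon>_def)
  then obtain Q where Q: "norm Q = 1" "norm (snd (x T) - Q) < \<delta>2"
    "(snd (x T) - Q) \<bullet> (M (snd (x T) - Q) - (l - \<kappa>) *\<^sub>R (snd (x T) - Q)) < 0"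
    using cone_perturbation[OF nx \<open>0 < l\<close> \<open>0 < \<kappa>\<close> \<open>\<kappa> \<le> l / 4\<close> _ \<open>0 < \<delta>2\<close>] by blast
  obtain y where y: "trajectory f state_manifold y" "fst (y 0) = fst (x 0)" "snd (y T) = Q"
    using trajectory_exists[OF Q(1) \<open>0 \<le> T\<close>] by blast
  have yT: "y T = (fst (x T), Q)"
    using trajectory_fst[OF x \<open>0 \<le> T\<close>] trajectory_fst[OF y(1) \<open>0 \<le> T\<close>] y(2,3)
    by (simp add: prod_eq_iff)
  have "norm (x T - y T) = norm (snd (x T) - Q)"
    unfolding yT by (cases "x T") (simp add: norm_Pair)
  then have "norm (x 0 - y 0) \<le> norm (snd (x T) - Q) * exp (lip R * T)"
    using trajectory_dist_le(2)[OF x y(1) order_refl \<open>0 \<le> T\<close>] by (simp add: R_def)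
  also have "\<dots> < \<delta> / exp (lip R * T) * exp (lip R * T)"
    using Q(2) by (intro mult_strict_right_mono) (auto simp: \<delta>2_def)
  finally have "norm (y 0 - x 0) < \<delta>" by (simp add: norm_minus_commute)
  moreover obtain q where q: "(y \<longlongrightarrow> q) at_top" using trajectory_tendsto[OF y(1)] by blast
  moreover have "V q < 2 * l"
  proof (rule ccontr)
    assume "\<not> V q < 2 * l"
    moreover have "V (y T) < 2 * l + \<eta>"
      unfolding yT using Q(2) by (intro \<delta>1) (simp add: \<delta>2_def dist_norm norm_minus_commute)
    ultimately have y\<epsilon>: "norm (M (snd (y t)) - l *\<^sub>R snd (y t)) \<le> \<epsilon>" if "T \<le> t" for t
      using close[OF y(1) \<open>0 \<le> T\<close> q _ _ that] by simp
    have "0 \<le> (snd (x T) - snd (y T)) \<bullet> (M (snd (x T) - snd (y T)) - (l - \<kappa>) *\<^sub>R (snd (x T) - snd (y T)))"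
    proof (rule cone_excludes_level[OF x y(1) y(2)[symmetric] \<open>0 \<le> T\<close>, where \<epsilon> = \<epsilon>1 and l = l and g = "3 / 2 * g"])
      show "norm (fst (x t)) \<le> \<epsilon>1 \<and> norm (M (snd (x t)) - l *\<^sub>R snd (x t)) \<le> \<epsilon>1" if "T \<le> t" for t
        using x\<epsilon>[OF that] by (simp add: \<epsilon>_def)
      show "norm (M (snd (y t)) - l *\<^sub>R snd (y t)) \<le> \<epsilon>1" if "T \<le> t" for t
        using y\<epsilon>[OF that] by (simp add: \<epsilon>_def)
      show "0 < 3 / 2 * g" using \<open>0 < g\<close> by simp
      show "2 * ((field z P - field z Q) \<bullet> (M (P - Q) - (l - \<kappa>) *\<^sub>R (P - Q)))
          \<le> 3 / 2 * g * ((P - Q) \<bullet> (M (P - Q) - (l - \<kappa>) *\<^sub>R (P - Q)))"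
        if "norm P = 1" "norm Q = 1" "norm z \<le> \<epsilon>1" "norm (M P - l *\<^sub>R P) \<le> \<epsilon>1" "norm (M Q - l *\<^sub>R Q) \<le> \<epsilon>1"
        for P Q z
        by (rule ineq[OF that])
    qed
    then show False using Q(3) by (simp add: y(3))
  qed
  then have "V q < V p" by (simp add: l_def)
  ultimately show ?thesis using y(1) by blast
qed

lemma trajectory_to_zero_level_dense:
  assumes "norm (snd \<xi>) = 1" "0 < \<delta>"
  shows "\<exists>y q. trajectory f state_manifold y \<and> norm (y 0 - \<xi>) < \<delta> \<and> (y \<longlongrightarrow> q) at_top \<and> V q = 0"
proof -
  define S where "S = {V q / 2 | y q. trajectory f state_manifold y \<and> norm (y 0 - \<xi>) < \<delta> \<and> (y \<longlongrightarrow> q) at_top}"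
  have "S \<subseteq> {l. \<exists>Q. Q \<noteq> 0 \<and> M Q = l *\<^sub>R Q}"
  proof
    fix l assume "l \<in> S"
    then obtain y q where "trajectory f state_manifold y" "(y \<longlongrightarrow> q) at_top" "l = V q / 2"
      by (auto simp: S_def)
    then have "M (snd q) = l *\<^sub>R snd q" "snd q \<noteq> 0"
      using limit_eigen(2) limit_in_manifold by fastforce+
    then show "l \<in> {l. \<exists>Q. Q \<noteq> 0 \<and> M Q = l *\<^sub>R Q}" by blast
  qed
  then have "finite S"
    using selfadjoint_finite_eigenvalues[OF M_selfadjoint] finite_subset by blast
  obtain x where x: "trajectory f state_manifold x" "fst (x 0) = fst \<xi>" "snd (x 0) = snd \<xi>"
    using trajectory_exists[OF assms(1), of 0] by auto
  obtain p where "(x \<longlongrightarrow> p) at_top" using trajectory_tendsto[OF x(1)] by blast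
  moreover have "x 0 = \<xi>" using x by (simp add: prod_eq_iff)
  ultimately have "V p / 2 \<in> S" using x(1) assms(2) unfolding S_def by fastforce
  then have "Min S \<in> S" using \<open>finite S\<close> by (intro Min_in) auto
  then obtain y q where y: "trajectory f state_manifold y" "norm (y 0 - \<xi>) < \<delta>" "(y \<longlongrightarrow> q) at_top"
    and q: "Min S = V q / 2"
    by (auto simp: S_def)
  have "\<not> 0 < V q"
  proof
    assume "0 < V q"
    \<comment> \<open>The new start is kept within the room left in the ball around
      \<open>\<xi>\<close>, so its limit level is again in \<open>S\<close>, against
      minimality.\<close>
    then obtain y' q' where y': "trajectory f state_manifold y'" "norm (y' 0 - y 0) < \<delta> - norm (y 0 - \<xi>)"
      "(y' \<longlongrightarrow> q') at_top" "V q' < V q"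
      using limit_level_lowered[OF y(1,3), of "\<delta> - norm (y 0 - \<xi>)"] y(2) by auto
    have "norm (y' 0 - \<xi>) < \<delta>"
      using norm_triangle_ineq[of "y' 0 - y 0" "y 0 - \<xi>"] y'(2) by simp
    then have "V q' / 2 \<in> S" using y'(1,3) unfolding S_def by blast
    then have "Min S \<le> V q' / 2" using \<open>finite S\<close> by (intro Min_le)
    then show False using y'(4) q by simp
  qed
  then show ?thesis using y V_nonneg[of q] by fastforce
qed

end

section \<open>Stability\<close>

context attitude_system
begin

abbreviation "W\<^sub>m \<equiv> W_rho \<rho>1 \<rho>2 e m"
abbreviation "lmin \<equiv> min_eigenvalue W\<^sub>m"
abbreviation "\<Omega>\<^sub>2 \<equiv> Omega2 \<rho>1 \<rho>2 e m"

text \<open>\<open>LEAST\<close> over the reals has the intended value only if a least element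
  exists; the minimum of the Rayleigh quotient provides it.\<close>

lemma min_eigenvalue_props:
  shows "0 < lmin" and "lmin * (norm v)\<^sup>2 \<le> v \<bullet> W v"
    and "\<And>l v. eigenvector_of W\<^sub>m l v \<Longrightarrow> lmin \<le> l"
proof -
  obtain v l where v: "norm v = 1" "W v = l *\<^sub>R v" "\<And>x. l * (norm x)\<^sup>2 \<le> x \<bullet> W x"
    using selfadjoint_min_eigenvector[OF W_linear W_selfadjoint] by blast
  have "v \<noteq> 0" using v(1) by auto
  have min: "l \<le> l'" if "eigenvector_of W\<^sub>m l' w" for l' w
  proof -
    have w: "w \<noteq> 0" "W w = l' *\<^sub>R w" using that by (auto simp: eigenvector_W_iff)
    then have "l * (norm w)\<^sup>2 \<le> l' * (norm w)\<^sup>2" using v(3)[of w] by (simp add: power2_norm_eq_inner)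
    then show ?thesis using w(1) by simp
  qed
  have "lmin = l"
    unfolding min_eigenvalue_def
    by (rule Least_equality) (use v(2) \<open>v \<noteq> 0\<close> min in \<open>auto simp: eigenvector_W_iff\<close>)
  then show "lmin * (norm v)\<^sup>2 \<le> v \<bullet> W v" "\<And>l v. eigenvector_of W\<^sub>m l v \<Longrightarrow> lmin \<le> l" for v
    using v(3) min by auto
  have "0 < v \<bullet> W v" by (rule W_pos[OF \<open>v \<noteq> 0\<close>])
  then show "0 < lmin" using v(1,2) \<open>lmin = l\<close> by (simp add: norm_eq_1)
qed

lemma V_Omega2:
  assumes "norm v = 1" "W v = l *\<^sub>R v" shows "V (0, 0, v) = 2 * l"
  using assms by (simp add: norm_eq_1 flip: W_def)

lemma limit_in_Omega:
  assumes "trajectory f state_manifold x" "(x \<longlongrightarrow> p) at_top"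
  shows "p \<in> Omega1 \<union> \<Omega>\<^sub>2"
  using critical_iff[OF limit_in_manifold[OF assms]] limit_critical[OF assms] by simp

text \<open>On \<open>\<Omega>\<^sub>2\<close> the value of \<open>V\<close> is twice an eigenvalue
  of \<open>W\<close>, hence at least \<open>2 * lmin\<close>, and \<open>V\<close> does not
  increase on the way to the limit.\<close>

lemma low_level_converges:
  assumes x: "trajectory f state_manifold x" and "0 \<le> t" "V (x t) < 2 * lmin"
  shows "converges_to_set x Omega1"
proof -
  obtain p where p: "(x \<longlongrightarrow> p) at_top" using trajectory_tendsto[OF x] by blast
  have "V p < 2 * lmin" using V_limit_le[OF x p \<open>0 \<le> t\<close>] assms(3) by linarith
  have "p \<notin> \<Omega>\<^sub>2"
  proof
    assume "p \<in> \<Omega>\<^sub>2"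
    then obtain v l where v: "p = (0, 0, v)" "norm v = 1" "eigenvector_of W\<^sub>m l v"
      by (auto simp: Omega2_def)
    then have "V p = 2 * l" using V_Omega2 by (simp only: eigenvector_W_iff)
    then show False using min_eigenvalue_props(3)[OF v(3)] \<open>V p < 2 * lmin\<close> by simp
  qed
  then have "p \<in> Omega1" using limit_in_Omega[OF x p] by blast
  have "((\<lambda>t. dist (x t) p) \<longlongrightarrow> 0) at_top" using p by (simp only: tendsto_dist_iff[symmetric])
  moreover have "\<forall>\<^sub>F t in at_top. norm (infdist (x t) Omega1) \<le> dist (x t) p"
    by (intro always_eventually allI) (simp add: infdist_nonneg infdist_le[OF \<open>p \<in> Omega1\<close>])
  ultimately show ?thesis
    unfolding converges_to_set_def by (rule Lim_null_comparison[rotated])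
qed

text \<open>Entering the sublevel set in finite time is an open condition on the initial state,
  which mere convergence is not by its form. One trajectory per state is enough, since uniqueness
  transfers the property to all.\<close>

definition basin :: "state set" where
  "basin = {\<xi> \<in> state_manifold. \<exists>x t. trajectory f state_manifold x \<and> x 0 = \<xi> \<and> 0 \<le> t \<and> V (x t) < 2 * lmin}"

lemma trajectory_from:
  assumes "\<xi> \<in> state_manifold"
  shows "\<exists>x. trajectory f state_manifold x \<and> x 0 = \<xi>"
proof -
  obtain z Q where \<xi>: "\<xi> = (z, Q)" by (cases \<xi>)
  then have "norm Q = 1" using assms state_manifold_iff by simp
  then obtain x where "trajectory f state_manifold x" "fst (x 0) = z" "snd (x 0) = Q"
    using trajectory_exists[of Q 0 z] by auto
  then show ?thesis by (metis \<xi> prod.collapse)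
qed

lemma basin_subset: "basin \<subseteq> domain_of_attraction f state_manifold Omega1"
proof
  fix \<xi> assume "\<xi> \<in> basin"
  then obtain x t where x: "\<xi> \<in> state_manifold" "trajectory f state_manifold x" "x 0 = \<xi>" "0 \<le> t"
    "V (x t) < 2 * lmin"
    by (auto simp only: basin_def mem_Collect_eq)
  have "converges_to_set y Omega1" if "trajectory f state_manifold y" "y 0 = \<xi>" for y
    using low_level_converges[OF that(1) x(4)] trajectory_unique[OF that(1) x(2) _ x(4)] that(2) x(3,5) by simp
  then show "\<xi> \<in> domain_of_attraction f state_manifold Omega1"
    unfolding domain_of_attraction_def using x by blast
qed

lemma sublevel_subset: "{\<xi> \<in> state_manifold. V \<xi> < 2 * lmin} \<subseteq> basin"
proof
  fix \<xi> assume "\<xi> \<in> {\<xi> \<in> state_manifold. V \<xi> < 2 * lmin}"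
  then have \<xi>: "\<xi> \<in> state_manifold" "V \<xi> < 2 * lmin" by blast+
  then obtain x where "trajectory f state_manifold x" "x 0 = \<xi>" using trajectory_from by blast
  then show "\<xi> \<in> basin" using \<xi> unfolding basin_def by blast
qed

text \<open>Continuous dependence on the initial state up to the entry time into an open sublevel
  set.\<close>

lemma basin_open: "openin (top_of_set state_manifold) basin"
  unfolding openin_euclidean_subtopology_iff
proof (intro conjI ballI)
  show "basin \<subseteq> state_manifold" by (auto simp only: basin_def mem_Collect_eq)
  fix \<xi> assume "\<xi> \<in> basin"
  then obtain x t where x: "trajectory f state_manifold x" "x 0 = \<xi>" "0 \<le> t" "V (x t) < 2 * lmin"
    by (auto simp only: basin_def mem_Collect_eq)
  have "open {\<zeta>. V \<zeta> < 2 * lmin}"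
    by (intro open_Collect_less continuous_on_V continuous_on_const)
  then obtain \<delta> where "0 < \<delta>" and \<delta>: "\<And>\<zeta>. dist \<zeta> (x t) < \<delta> \<Longrightarrow> V \<zeta> < 2 * lmin"
    using x(4) unfolding open_dist by blast
  define R where "R = norm (fst \<xi>)"
  define \<delta>' where "\<delta>' = \<delta> / exp (lip R * t)"
  have "0 < \<delta>'" using \<open>0 < \<delta>\<close> by (simp add: \<delta>'_def)
  have "\<xi>' \<in> basin" if \<xi>': "\<xi>' \<in> state_manifold" "dist \<xi>' \<xi> < \<delta>'" for \<xi>'
  proof -
    obtain y where y: "trajectory f state_manifold y" "y 0 = \<xi>'" using trajectory_from[OF \<xi>'(1)] by blast
    have "norm (x t - y t) \<le> norm (\<xi> - \<xi>') * exp (lip R * t)"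
      using trajectory_dist_le(1)[OF x(1) y(1) order_refl x(3)] by (simp add: R_def x(2) y(2))
    also have "\<dots> < \<delta>' * exp (lip R * t)"
      using \<xi>'(2) by (intro mult_strict_right_mono) (auto simp: dist_norm norm_minus_commute)
    also have "\<dots> = \<delta>" by (simp add: \<delta>'_def)
    finally have "V (y t) < 2 * lmin" by (intro \<delta>) (simp add: dist_norm norm_minus_commute)
    then show ?thesis using y \<xi>'(1) x(3) unfolding basin_def by blast
  qed
  then show "\<exists>e>0. \<forall>x'\<in>state_manifold. dist x' \<xi> < e \<longrightarrow> x' \<in> basin"
    using \<open>0 < \<delta>'\<close> by blast
qed

lemma basin_dense: "state_manifold \<subseteq> closure basin"
proof
  fix \<xi> assume \<xi>: "\<xi> \<in> state_manifold"
  have "norm (snd \<xi>) = 1" using \<xi> by (metis prod.collapse state_manifold_iff)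
  have "\<exists>\<zeta>\<in>basin. dist \<zeta> \<xi> < \<delta>" if \<delta>: "0 < \<delta>" for \<delta>
  proof -
    obtain y q where y: "trajectory f state_manifold y" "norm (y 0 - \<xi>) < \<delta>" "(y \<longlongrightarrow> q) at_top" "V q = 0"
      using trajectory_to_zero_level_dense[OF \<open>norm (snd \<xi>) = 1\<close> \<delta>] by blast
    have "((\<lambda>t. V (y t)) \<longlongrightarrow> V q) at_top"
      by (rule continuous_on_tendsto_compose[OF continuous_on_V[of UNIV] y(3)]) auto
    then have "\<forall>\<^sub>F t in at_top. V (y t) < 2 * lmin"
      using min_eigenvalue_props(1) y(4) by (intro order_tendstoD(2)) auto
    then obtain T where "\<And>t. T \<le> t \<Longrightarrow> V (y t) < 2 * lmin" unfolding eventually_at_top_linorder by blast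
    then have "V (y (max 0 T)) < 2 * lmin" by (meson max.cobounded2)
    moreover have "y 0 \<in> state_manifold" using y(1) by (simp add: trajectory_def)
    ultimately have "y 0 \<in> basin" using y(1) unfolding basin_def by (blast intro: max.cobounded1)
    then show ?thesis using y(2) by (auto simp: dist_norm)
  qed
  then show "\<xi> \<in> closure basin" by (simp only: closure_approachable) blast
qed

lemma infdist_Omega1_le:
  assumes "norm (q0, q) = 1"
  shows "(infdist (z, q0, q) Omega1)\<^sup>2 \<le> (norm z)\<^sup>2 + 2 * (norm q)\<^sup>2"
proof -
  \<comment> \<open>Selects the nearer of the two antipodal points. On the sphere
    \<open>q0\<^sup>2 \<le> \<bar>q0\<bar>\<close>, which bounds the squared scalar error by the
    squared norm of \<open>q\<close>.\<close>
  define s :: real where "s = (if 0 \<le> q0 then 1 else -1)"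
  have n: "q0\<^sup>2 + (norm q)\<^sup>2 = 1"
    using assms state_manifold_iff[of z "(q0, q)"] by (simp add: state_manifold_def)
  then have "q0\<^sup>2 \<le> 1" by (smt (verit) zero_le_power2)
  then have "\<bar>q0\<bar> \<le> 1" by (simp add: abs_square_le_1)
  then have "\<bar>q0\<bar> * \<bar>q0\<bar> \<le> 1 * \<bar>q0\<bar>" by (intro mult_right_mono) auto
  then have "q0\<^sup>2 \<le> \<bar>q0\<bar>" by (simp add: power2_eq_square)
  have "(q0 - s)\<^sup>2 = q0\<^sup>2 - 2 * \<bar>q0\<bar> + 1" by (auto simp: s_def power2_eq_square algebra_simps)
  then have "(q0 - s)\<^sup>2 \<le> (norm q)\<^sup>2" using n \<open>q0\<^sup>2 \<le> \<bar>q0\<bar>\<close> by linarith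
  have "(0, s, 0) \<in> Omega1" by (simp add: Omega1_def s_def)
  then have "infdist (z, q0, q) Omega1 \<le> norm ((z, q0, q) - (0, s, 0))"
    using infdist_le by (metis dist_norm)
  then have "(infdist (z, q0, q) Omega1)\<^sup>2 \<le> (norm ((z, q0, q) - (0, s, 0)))\<^sup>2"
    by (intro power_mono infdist_nonneg)
  also have "\<dots> = (norm z)\<^sup>2 + ((q0 - s)\<^sup>2 + (norm q)\<^sup>2)" by (simp add: norm_Pair)
  finally show ?thesis using \<open>(q0 - s)\<^sup>2 \<le> (norm q)\<^sup>2\<close> by linarith
qed

lemma infdist_Omega1_ge: "norm z \<le> infdist (z, q0, q) Omega1" "norm q \<le> infdist (z, q0, q) Omega1"
proof -
  have ne: "Omega1 \<noteq> {}" by (simp add: Omega1_def)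
  have "norm z \<le> dist (z, q0, q) p \<and> norm q \<le> dist (z, q0, q) p" if p\<Omega>: "p \<in> Omega1" for p
  proof -
    obtain s where p: "p = (0, s, 0)" using p\<Omega> unfolding Omega1_def by blast
    show ?thesis
      using norm_fst_le[of z "(q0 - s, q)"] norm_snd_le[of "(q0 - s, q)" z] norm_snd_le[of q "q0 - s"]
      by (auto simp: p dist_norm)
  qed
  then show "norm z \<le> infdist (z, q0, q) Omega1" "norm q \<le> infdist (z, q0, q) Omega1"
    using ne by (simp_all add: infdist_def cINF_greatest)
qed

text \<open>Comparability of \<open>V\<close> with the squared distance turns monotonicity of
  \<open>V\<close> into Lyapunov stability and places a neighborhood of \<open>Omega1\<close> inside
  the sublevel set.\<close>

lemma V_infdist_bounds:
  "\<exists>c>0. \<exists>C>0. \<forall>\<xi>\<in>state_manifold. c * (infdist \<xi> Omega1)\<^sup>2 \<le> V \<xi> \<and> V \<xi> \<le> C * (infdist \<xi> Omega1)\<^sup>2"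
proof -
  define k where "k = \<rho>1\<^sup>2 / \<alpha>1"
  have "0 < k" using pos by (simp add: k_def)
  define c where "c = min k lmin"
  define C where "C = k + 2 * onorm M"
  have "0 < c" using \<open>0 < k\<close> min_eigenvalue_props(1) by (simp add: c_def)
  have "0 < C" using \<open>0 < k\<close> onorm_M_nonneg by (simp add: C_def)
  have "c * (infdist \<xi> Omega1)\<^sup>2 \<le> V \<xi> \<and> V \<xi> \<le> C * (infdist \<xi> Omega1)\<^sup>2" if "\<xi> \<in> state_manifold" for \<xi>
  proof -
    obtain z q0 q where \<xi>: "\<xi> = (z, q0, q)" by (cases \<xi>)
    let ?d = "infdist \<xi> Omega1"
    have V: "V \<xi> = k * (norm z)\<^sup>2 + 2 * (q \<bullet> W q)" by (simp add: \<xi> k_def W_def)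
    have "c * ?d\<^sup>2 \<le> c * ((norm z)\<^sup>2 + 2 * (norm q)\<^sup>2)"
      using \<open>0 < c\<close> infdist_Omega1_le[of q0 q z] that state_manifold_iff[of z "(q0, q)"]
      by (intro mult_left_mono) (auto simp: \<xi>)
    also have "\<dots> = c * (norm z)\<^sup>2 + 2 * (c * (norm q)\<^sup>2)" by (simp add: algebra_simps)
    also have "\<dots> \<le> k * (norm z)\<^sup>2 + 2 * (lmin * (norm q)\<^sup>2)"
      by (intro add_mono mult_left_mono mult_right_mono) (auto simp: c_def)
    also have "\<dots> \<le> V \<xi>" unfolding V using min_eigenvalue_props(2)[of q] by linarith
    finally have lower: "c * ?d\<^sup>2 \<le> V \<xi>" .
    have "q \<bullet> W q \<le> norm q * (onorm M * norm q)"
    proof -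
      have "norm (W q) \<le> onorm M * norm q" using norm_M_le[of "(0, q)"] by (simp add: M_def norm_Pair)
      then show ?thesis using norm_cauchy_schwarz[of q "W q"] by (meson mult_left_mono norm_ge_zero order_trans)
    qed
    also have "\<dots> = onorm M * (norm q)\<^sup>2" by (simp add: power2_eq_square)
    also have "\<dots> \<le> onorm M * ?d\<^sup>2"
      using onorm_M_nonneg infdist_Omega1_ge(2)[of q z q0] by (intro mult_left_mono power_mono) (auto simp: \<xi>)
    finally have "q \<bullet> W q \<le> onorm M * ?d\<^sup>2" .
    moreover have "k * (norm z)\<^sup>2 \<le> k * ?d\<^sup>2"
      using \<open>0 < k\<close> infdist_Omega1_ge(1)[of z q0 q] by (intro mult_left_mono power_mono) (auto simp: \<xi>)
    ultimately have "V \<xi> \<le> C * ?d\<^sup>2" unfolding V C_def by (simp add: algebra_simps)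
    then show ?thesis using lower by blast
  qed
  then show ?thesis using \<open>0 < c\<close> \<open>0 < C\<close> by blast
qed

lemma Omega1_lyapunov_stable: "lyapunov_stable f state_manifold Omega1"
  unfolding lyapunov_stable_def
proof (intro allI impI)
  fix \<epsilon> :: real assume "0 < \<epsilon>"
  obtain c C where cC: "0 < c" "0 < C"
    "\<And>\<xi>. \<xi> \<in> state_manifold \<Longrightarrow> c * (infdist \<xi> Omega1)\<^sup>2 \<le> V \<xi>"
    "\<And>\<xi>. \<xi> \<in> state_manifold \<Longrightarrow> V \<xi> \<le> C * (infdist \<xi> Omega1)\<^sup>2"
    using V_infdist_bounds by blast
  define \<delta> where "\<delta> = \<epsilon> * sqrt (c / C)"
  have "0 < \<delta>" using \<open>0 < \<epsilon>\<close> cC by (simp add: \<delta>_def)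
  have \<delta>2: "C * \<delta>\<^sup>2 = c * \<epsilon>\<^sup>2" using cC by (simp add: \<delta>_def power_mult_distrib)
  have "infdist (x t) Omega1 < \<epsilon>"
    if x: "trajectory f state_manifold x" and "infdist (x 0) Omega1 < \<delta>" and "0 \<le> t" for x t
  proof -
    have mem: "x s \<in> state_manifold" if "0 \<le> s" for s using x that by (simp add: trajectory_def)
    have "(infdist (x 0) Omega1)\<^sup>2 < \<delta>\<^sup>2" using that(2) infdist_nonneg by (intro power_strict_mono) auto
    then have "C * (infdist (x 0) Omega1)\<^sup>2 < c * \<epsilon>\<^sup>2" using cC(2) \<delta>2 by (metis mult_strict_left_mono)
    moreover have "V (x t) \<le> V (x 0)" by (rule V_antimono[OF x order_refl \<open>0 \<le> t\<close>])
    ultimately have "c * (infdist (x t) Omega1)\<^sup>2 < c * \<epsilon>\<^sup>2"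
      using cC(3)[OF mem[OF \<open>0 \<le> t\<close>]] cC(4)[OF mem[OF order_refl]] by linarith
    then have "(infdist (x t) Omega1)\<^sup>2 < \<epsilon>\<^sup>2" using cC(1) by simp
    then show ?thesis by (rule power2_less_imp_less) (use \<open>0 < \<epsilon>\<close> in simp)
  qed
  then show "\<exists>\<delta>>0. \<forall>x. trajectory f state_manifold x \<and> infdist (x 0) Omega1 < \<delta> \<longrightarrow>
      (\<forall>t\<ge>0. infdist (x t) Omega1 < \<epsilon>)"
    using \<open>0 < \<delta>\<close> by blast
qed

lemma Omega1_asymptotically_stable: "asymptotically_stable f state_manifold Omega1"
proof -
  obtain C where C: "0 < C" "\<And>\<xi>. \<xi> \<in> state_manifold \<Longrightarrow> V \<xi> \<le> C * (infdist \<xi> Omega1)\<^sup>2"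
    using V_infdist_bounds by blast
  define \<delta> where "\<delta> = sqrt (2 * lmin / C)"
  have "0 < \<delta>" using min_eigenvalue_props(1) C(1) by (simp add: \<delta>_def)
  have \<delta>2: "C * \<delta>\<^sup>2 = 2 * lmin" using min_eigenvalue_props(1) C(1) by (simp add: \<delta>_def)
  have "V \<xi> < 2 * lmin" if "\<xi> \<in> state_manifold" "infdist \<xi> Omega1 < \<delta>" for \<xi>
  proof -
    have "(infdist \<xi> Omega1)\<^sup>2 < \<delta>\<^sup>2" using that(2) infdist_nonneg by (intro power_strict_mono) auto
    then have "C * (infdist \<xi> Omega1)\<^sup>2 < 2 * lmin" using C(1) \<delta>2 by (metis mult_strict_left_mono)
    then show ?thesis using C(2)[OF that(1)] by linarith
  qed
  then have "{\<xi> \<in> state_manifold. infdist \<xi> Omega1 < \<delta>} \<subseteq> domain_of_attraction f state_manifold Omega1"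
    using sublevel_subset basin_subset by blast
  then show ?thesis
    unfolding asymptotically_stable_def using Omega1_lyapunov_stable \<open>0 < \<delta>\<close> by blast
qed

text \<open>Tilting \<open>p\<close> towards the scalar axis lowers \<open>V\<close> strictly below
  its value at \<open>p\<close>, so the limit has another level. Its vector part is then zero or a
  unit vector orthogonal to \<open>v\<close>, at distance at least 1 from \<open>v\<close>, which
  contradicts staying within 1/2.\<close>

lemma Omega2_unstable:
  assumes "p \<in> \<Omega>\<^sub>2"
  shows "\<not> lyapunov_stable f state_manifold {p}"
proof
  assume st: "lyapunov_stable f state_manifold {p}"
  obtain v l where p: "p = (0, 0, v)" and v: "norm v = 1" "W v = l *\<^sub>R v"
    using assms by (auto simp: Omega2_def eigenvector_W_iff)
  have "v \<noteq> 0" using v(1) by auto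
  have vv: "v \<bullet> v = 1" using v(1) by (simp add: norm_eq_1)
  have "0 < l" using W_pos[OF \<open>v \<noteq> 0\<close>] v(2) vv by simp
  obtain \<delta> where "0 < \<delta>" and \<delta>: "\<And>x t. trajectory f state_manifold x \<Longrightarrow> dist (x 0) p < \<delta> \<Longrightarrow> 0 \<le> t \<Longrightarrow> dist (x t) p < 1/2"
    using st unfolding lyapunov_stable_def by (auto dest: spec[of _ "1/2"])
  \<comment> \<open>The tilted state with scalar part \<open>s\<close> on the sphere lies at
    distance less than \<open>2 * s\<close> from \<open>p\<close>, hence less than \<delta>.\<close>
  define s where "s = min (1/2) (\<delta>/2)"
  have s: "0 < s" "s < 1" "s \<le> \<delta>/2" using \<open>0 < \<delta>\<close> by (auto simp: s_def)
  have "s\<^sup>2 \<le> s" using s by (simp add: power2_eq_square)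
  define c where "c = sqrt (1 - s\<^sup>2)"
  have c: "c\<^sup>2 = 1 - s\<^sup>2" "0 \<le> c" using s \<open>s\<^sup>2 \<le> s\<close> by (auto simp: c_def)
  define \<xi> where "\<xi> = (0 :: real^3, s, c *\<^sub>R v)"
  have "\<xi> \<in> state_manifold" using c v(1) by (simp add: \<xi>_def state_manifold_def power_mult_distrib)
  then obtain x where x: "trajectory f state_manifold x" "x 0 = \<xi>" using trajectory_from by blast
  have "dist \<xi> p < \<delta>"
  proof -
    have "c\<^sup>2 \<le> 1" using c(1) zero_le_power2[of s] by linarith
    then have "c \<le> 1" using power2_le_imp_le[of c 1] by simp
    then have "c\<^sup>2 \<le> c" using c(2) by (simp add: power2_eq_square mult_left_le_one_le)
    have "\<xi> - p = (0, s, (c - 1) *\<^sub>R v)" by (simp add: \<xi>_def p algebra_simps)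
    then have "(norm (\<xi> - p))\<^sup>2 = s\<^sup>2 + (c - 1)\<^sup>2"
      using v(1) by (simp add: norm_Pair)
    also have "(c - 1)\<^sup>2 = c\<^sup>2 - 2 * c + 1" by (simp add: power2_diff)
    finally have "(norm (\<xi> - p))\<^sup>2 \<le> 2 * s\<^sup>2" using c(1) \<open>c\<^sup>2 \<le> c\<close> by linarith
    also have "\<dots> < (2 * s)\<^sup>2" using s(1) by (simp add: power_mult_distrib)
    finally have "norm (\<xi> - p) < 2 * s" by (rule power2_less_imp_less) (use s(1) in simp)
    then show ?thesis using s(3) by (simp add: dist_norm)
  qed
  then have near: "dist (x t) p < 1/2" if "0 \<le> t" for t using \<delta>[OF x(1) _ that] x(2) by simp
  obtain p' where p': "(x \<longlongrightarrow> p') at_top" using trajectory_tendsto[OF x(1)] by blast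
  have "V \<xi> = 2 * (c\<^sup>2 * l)"
    using v(2) vv by (simp add: \<xi>_def linear_scale[OF W_linear] power2_eq_square flip: W_def)
  also have "\<dots> < 2 * l" using c(1) s(1) \<open>0 < l\<close> by simp
  finally have V': "V p' < 2 * l" using V_limit_le[OF x(1) p' order_refl] x(2) by simp
  have "dist p' p \<le> 1/2"
  proof (rule tendsto_upperbound)
    show "((\<lambda>t. dist (x t) p) \<longlongrightarrow> dist p' p) at_top" by (intro tendsto_intros p')
    show "\<forall>\<^sub>F t in at_top. dist (x t) p \<le> 1/2"
      unfolding eventually_at_top_linorder using near less_imp_le by blast
  qed simp
  obtain z' q0' v' where p'_eq: "p' = (z', q0', v')" by (cases p')
  have "norm (v' - v) \<le> norm (p' - p)"
    using norm_snd_le[of "(q0', v' - v)" z'] norm_snd_le[of "v' - v" q0'] by (simp add: p'_eq p)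
  then have near': "norm (v' - v) \<le> 1/2" using \<open>dist p' p \<le> 1/2\<close> by (simp add: dist_norm)
  consider "p' \<in> Omega1" | "p' \<in> \<Omega>\<^sub>2" using limit_in_Omega[OF x(1) p'] by blast
  then show False
  proof cases
    case 1
    then have "v' = 0" by (auto simp: Omega1_def p'_eq)
    then show False using near' v(1) by simp
  next
    case 2
    then obtain w l' where w: "p' = (0, 0, w)" "norm w = 1" "W w = l' *\<^sub>R w"
      by (auto simp: Omega2_def eigenvector_W_iff)
    then have v': "norm v' = 1" "W v' = l' *\<^sub>R v'" by (simp_all add: p'_eq)
    have "V p' = 2 * l'" unfolding w(1) by (rule V_Omega2[OF w(2,3)])
    then have "l' \<noteq> l" using V' by auto
    then have "v' \<bullet> v = 0"
      by (rule selfadjoint_eigenvectors_orthogonal[OF W_selfadjoint v'(2) v(2)])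
    moreover from this have "v \<bullet> v' = 0" by (simp only: inner_commute)
    moreover have "v' \<bullet> v' = 1" using v'(1) by (simp add: norm_eq_1)
    ultimately have "(norm (v' - v))\<^sup>2 = 2"
      unfolding power2_norm_eq_inner by (simp add: inner_diff_left inner_diff_right vv)
    moreover have "(norm (v' - v))\<^sup>2 \<le> (1/2)\<^sup>2" using near' by (intro power_mono) auto
    ultimately show False by (simp add: power2_eq_square)
  qed
qed

text \<open>The \<open>v j\<close> are orthonormal, so a unit eigenvector is not orthogonal to all
  of them. It shares the eigenvalue of some \<open>v j\<close>, is orthogonal to the other two, and
  is therefore a multiple of \<open>v j\<close>.\<close>

lemma Omega2_distinct_eigenvalues:
  fixes v :: "3 \<Rightarrow> real^3"
  assumes "inj l" and v: "\<And>j. norm (v j) = 1 \<and> eigenvector_of W\<^sub>m (l j) (v j)"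
  shows "\<Omega>\<^sub>2 = (\<Union>j. {(0, 0, v j), (0, 0, - v j)})"
proof (intro subset_antisym subsetI)
  fix p :: state assume "p \<in> (\<Union>j. {(0, 0, v j), (0, 0, - v j)})"
  then obtain j where j: "p = (0, 0, v j) \<or> p = (0, 0, - v j)" by blast
  have "W (- v j) = l j *\<^sub>R (- v j)" using v[of j] by (simp add: eigenvector_W_iff linear_neg[OF W_linear])
  then have "eigenvector_of W\<^sub>m (l j) (- v j)" using v[of j] by (simp add: eigenvector_W_iff)
  then show "p \<in> \<Omega>\<^sub>2" using j v[of j] by (auto simp: Omega2_def)
next
  have Wv: "W (v j) = l j *\<^sub>R v j" for j using v[of j] by (simp add: eigenvector_W_iff)
  have on: "v i \<bullet> v j = (if i = j then 1 else 0)" for i j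
  proof (cases "i = j")
    case True
    then show ?thesis using v[of j] by (simp add: norm_eq_1)
  next
    case False
    then have "l i \<noteq> l j" using assms(1) by (simp add: inj_eq)
    then show ?thesis using False selfadjoint_eigenvectors_orthogonal[OF W_selfadjoint Wv Wv] by simp
  qed
  fix p :: state assume "p \<in> \<Omega>\<^sub>2"
  then obtain w k where p: "p = (0, 0, w)" and w: "norm w = 1" "W w = k *\<^sub>R w"
    by (auto simp: Omega2_def eigenvector_W_iff)
  have "\<exists>j. w \<bullet> v j \<noteq> 0"
    using orthonormal3_eqI[of v w] on w(1) by fastforce
  then obtain j where j: "w \<bullet> v j \<noteq> 0" by blast
  then have "k = l j" using selfadjoint_eigenvectors_orthogonal[OF W_selfadjoint w(2) Wv] by blast
  have "w - (w \<bullet> v j) *\<^sub>R v j = 0"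
  proof (rule orthonormal3_eqI[of v, OF on])
    fix i
    show "(w - (w \<bullet> v j) *\<^sub>R v j) \<bullet> v i = 0"
    proof (cases "i = j")
      case False
      then have "l i \<noteq> k" using assms(1) \<open>k = l j\<close> by (simp add: inj_eq)
      then have "w \<bullet> v i = 0" using selfadjoint_eigenvectors_orthogonal[OF W_selfadjoint w(2) Wv] by metis
      then show ?thesis using False by (simp add: inner_diff_left on)
    qed (simp add: inner_diff_left on)
  qed
  moreover define c where "c = w \<bullet> v j"
  ultimately have w_eq: "w = c *\<^sub>R v j" by simp
  have "norm w = \<bar>c\<bar> * norm (v j)" unfolding w_eq by simp
  then have "c = 1 \<or> c = -1" using w(1) v[of j] by auto
  then have "w = v j \<or> w = - v j" using w_eq by auto
  then show "p \<in> (\<Union>j. {(0, 0, v j), (0, 0, - v j)})" using p by blast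
qed

end

text \<open>If the rotation is the identity, pairing its deviation with \<open>x\<close> removes the
  skew part and leaves a multiple of the squared length of \<open>cross3 q x\<close>, so
  \<open>q\<close> is parallel to every \<open>x\<close> and vanishes.\<close>

lemma Omega1_eq_rotation: "Omega1 = {(z, Q). (z, Q) \<in> state_manifold \<and> z = 0 \<and> quat_rotation Q = mat 1}"
proof -
  have q0: "q = 0" if eq: "quat_rotation (q0, q) = mat 1" for q0 q
  proof -
    have "(2 * q0) *\<^sub>R skew q + 2 *\<^sub>R skew2 q = 0" using eq by simp
    then have "((2 * q0) *\<^sub>R skew q + 2 *\<^sub>R skew2 q) *v x = 0" for x by simp
    then have "(2 * q0) *\<^sub>R cross3 q x + 2 *\<^sub>R cross3 q (cross3 q x) = 0" for x
      by (simp add: matrix_vector_mult_add_rdistrib skew_vector_mult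
          flip: scaleR_matrix_vector_assoc matrix_vector_mul_assoc)
    then have "x \<bullet> ((2 * q0) *\<^sub>R cross3 q x + 2 *\<^sub>R cross3 q (cross3 q x)) = 0" for x by simp
    then have "x \<bullet> cross3 q (cross3 q x) = 0" for x
      by (simp add: inner_add_right dot_cross_self)
    moreover have "x \<bullet> cross3 q (cross3 q x) = - (cross3 q x \<bullet> cross3 q x)" for x :: "real^3"
      by (simp add: cross3_simps)
    ultimately have "cross3 q x = 0" for x by simp
    then show "q = 0" using cross_basis_nonzero by blast
  qed
  show ?thesis
  proof (intro subset_antisym subsetI)
    fix p assume "p \<in> Omega1"
    moreover have "skew 0 = 0" by (simp add: skew_def matrix_def vec_eq_iff)
    ultimately show "p \<in> {(z, Q). (z, Q) \<in> state_manifold \<and> z = 0 \<and> quat_rotation Q = mat 1}"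
      by (auto simp: Omega1_def state_manifold_def)
  next
    fix p assume "p \<in> {(z, Q). (z, Q) \<in> state_manifold \<and> z = 0 \<and> quat_rotation Q = mat 1}"
    then obtain a b where p: "p = (0, a, b)" "(0, a, b) \<in> state_manifold" "quat_rotation (a, b) = mat 1"
      by (cases p) auto
    then have "b = 0" using q0 by blast
    then show "p \<in> Omega1" using p(1,2) by (auto simp: Omega1_def state_manifold_def power2_eq_1_iff)
  qed
qed

theorem theorem5:
  fixes \<alpha>1 \<rho>1 \<rho>2 \<mu> :: real and e m :: "real^3"
  assumes "\<alpha>1 > 0" "\<rho>1 > 0" "\<rho>2 > 0" "\<mu> > 0"
    and "norm e = 1" "norm m = 1" "\<not> collinear {0, e, m}"
  shows
    "(equilibria (vector_field \<alpha>1 \<rho>1 \<rho>2 \<mu> e m) state_manifold = Omega1 \<union> Omega2 \<rho>1 \<rho>2 e m \<and>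
      (\<forall>(v :: 3 \<Rightarrow> real^3) l.
         inj l \<and> (\<forall>j. norm (v j) = 1 \<and> eigenvector_of (W_rho \<rho>1 \<rho>2 e m) (l j) (v j)) \<longrightarrow>
         Omega2 \<rho>1 \<rho>2 e m = (\<Union>j. {(0, 0, v j), (0, 0, - v j)})))
     \<and>
     ((\<forall>\<xi> \<in> state_manifold. \<exists>x.
         trajectory (vector_field \<alpha>1 \<rho>1 \<rho>2 \<mu> e m) state_manifold x \<and> x 0 = \<xi>) \<and>
      (\<forall>x. trajectory (vector_field \<alpha>1 \<rho>1 \<rho>2 \<mu> e m) state_manifold x \<longrightarrow>
         (\<exists>p \<in> Omega1 \<union> Omega2 \<rho>1 \<rho>2 e m. (x \<longlongrightarrow> p) at_top)))
     \<and>
     (Omega1 = {(z, Q). (z, Q) \<in> state_manifold \<and> z = 0 \<and> quat_rotation Q = mat 1} \<and>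
      asymptotically_stable (vector_field \<alpha>1 \<rho>1 \<rho>2 \<mu> e m) state_manifold Omega1 \<and>
      {\<xi> \<in> state_manifold.
         V_fun \<alpha>1 \<rho>1 \<rho>2 e m \<xi> < 2 * min_eigenvalue (W_rho \<rho>1 \<rho>2 e m)}
        \<subseteq> domain_of_attraction (vector_field \<alpha>1 \<rho>1 \<rho>2 \<mu> e m) state_manifold Omega1)
     \<and>
     ((\<forall>p \<in> Omega2 \<rho>1 \<rho>2 e m.
         \<not> lyapunov_stable (vector_field \<alpha>1 \<rho>1 \<rho>2 \<mu> e m) state_manifold {p}) \<and>
      almost_globally_asymptotically_stable
        (vector_field \<alpha>1 \<rho>1 \<rho>2 \<mu> e m) state_manifold Omega1)"
proof -
  interpret attitude_system \<alpha>1 \<rho>1 \<rho>2 \<mu> e m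
    by unfold_locales (fact assms)+
  show ?thesis
  proof (intro conjI)
    show "equilibria f state_manifold = Omega1 \<union> \<Omega>\<^sub>2" by (rule equilibria_eq)
    show "\<forall>(v :: 3 \<Rightarrow> real^3) l. inj l \<and> (\<forall>j. norm (v j) = 1 \<and> eigenvector_of W\<^sub>m (l j) (v j)) \<longrightarrow>
        \<Omega>\<^sub>2 = (\<Union>j. {(0, 0, v j), (0, 0, - v j)})"
      by (intro allI impI Omega2_distinct_eigenvalues) auto
    show "\<forall>\<xi>\<in>state_manifold. \<exists>x. trajectory f state_manifold x \<and> x 0 = \<xi>"
      by (intro ballI trajectory_from)
    show "\<forall>x. trajectory f state_manifold x \<longrightarrow> (\<exists>p\<in>Omega1 \<union> \<Omega>\<^sub>2. (x \<longlongrightarrow> p) at_top)"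
      using trajectory_tendsto limit_in_Omega by blast
    show "Omega1 = {(z, Q). (z, Q) \<in> state_manifold \<and> z = 0 \<and> quat_rotation Q = mat 1}"
      by (rule Omega1_eq_rotation)
    show "asymptotically_stable f state_manifold Omega1" by (rule Omega1_asymptotically_stable)
    show "{\<xi> \<in> state_manifold. V \<xi> < 2 * lmin} \<subseteq> domain_of_attraction f state_manifold Omega1"
      by (rule order_trans[OF sublevel_subset basin_subset])
    show "\<forall>p\<in>\<Omega>\<^sub>2. \<not> lyapunov_stable f state_manifold {p}"
      by (intro ballI Omega2_unstable)
    show "almost_globally_asymptotically_stable f state_manifold Omega1"
      unfolding almost_globally_asymptotically_stable_def
      using Omega1_lyapunov_stable basin_open basin_dense basin_subset by blast
  qed
qed

end
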